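(* Let $k$ be a field of characteristic $0$, $K/k$ a field extension, $G$ a finite group, and $\rho \colon G \to \mathrm{GL}_n(K)$ a representation of $G$ over $K$. (a) If $\rho$ is $K$-irreducible (but not necessarily absolutely irreducible), then $\operatorname{ed}(\rho) \leqslant n^2/4$. (b) If $\rho$ is arbitrary, then $\operatorname{ed}(\rho) \leqslant |G|^2/4$. (c) $\operatorname{ed}(\mathbf{Rep}_{G,k}) \leqslant |G|^2/4$ for any base field $k$ of characteristic $0$.
   Context: $\mathbf{Rep}_{G,k}$ is the covariant functor from field extensions of $k$ to sets, sending $K/k$ to the set of $K$-isomorphism classes of representations $G\to\mathrm{GL}_n(K)$, with $n\ge1$ allowed to vary. For a representation $\rho\colon G\to \mathrm{GL}_n(K)$, $\operatorname{ed}(\rho)$ is the smallest transcendence degree over $k$ of an intermediate field $k\subset K_0\subset K$ such that $\rho$ is $K$-equivalent to a representation $G\to\mathrm{GL}_n(K_0)$. $\operatorname{ed}(\mathbf{Rep}_{G,k})$ is the supremum of $\operatorname{ed}(\rho)$ over all field extensions $K/k$ and all representations $\rho$ of $G$ over $K$. *)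

theory Defs
  imports
    "Jordan_Normal_Form.Matrix"
    "HOL-Library.Extended_Real"
    "HOL-Algebra.Algebra"
begin

section \<open>Fields and field extensions\<close>

definition char_zero :: "('a, 'm) ring_scheme \<Rightarrow> bool" where
  "char_zero R \<longleftrightarrow> (\<forall>m::nat. m > 0 \<longrightarrow> add_pow R m \<one>\<^bsub>R\<^esub> \<noteq> \<zero>\<^bsub>R\<^esub>)"

text \<open>An extension of \<open>k\<close> is a field with a homomorphism \<open>\<iota>\<close> from \<open>k\<close>, so that \<open>K\<close> can vary
  while \<open>k\<close> is fixed; inside \<open>K\<close>, the base field is the subfield \<open>\<iota> ` carrier k\<close>.\<close>

definition field_extension ::
  "('a, 'm) ring_scheme \<Rightarrow> ('b, 'n) ring_scheme \<Rightarrow> ('a \<Rightarrow> 'b) \<Rightarrow> bool" where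
  "field_extension k K \<iota> \<longleftrightarrow> field k \<and> field K \<and> \<iota> \<in> ring_hom k K"

section \<open>Transcendence degree\<close>

text \<open>Polynomials over a set of letters are those of \<open>HOL-Algebra.Indexed_Polynomials\<close>: functions
  from monomials (multisets of letters) to coefficients. Here the letters are themselves
  elements of the ring, and each letter is evaluated at itself.\<close>

definition eval_letters :: "('b, 'm) ring_scheme \<Rightarrow> ('b multiset \<Rightarrow> 'b) \<Rightarrow> 'b" where
  "eval_letters R P =
    (\<Oplus>\<^bsub>R\<^esub>m\<in>{m. P m \<noteq> \<zero>\<^bsub>R\<^esub>}. P m \<otimes>\<^bsub>R\<^esub> (\<Otimes>\<^bsub>R\<^esub>x\<in>set_mset m. x [^]\<^bsub>R\<^esub> count m x))"

definition alg_independent :: "('b, 'm) ring_scheme \<Rightarrow> 'b set \<Rightarrow> 'b set \<Rightarrow> bool" where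
  "alg_independent L F S \<longleftrightarrow> S \<subseteq> carrier L \<and>
    (\<forall>P \<in> ring.indexed_pset L S F. eval_letters L P = \<zero>\<^bsub>L\<^esub> \<longrightarrow> P = (\<lambda>_. \<zero>\<^bsub>L\<^esub>))"

text \<open>Transcendence degree of \<open>L\<close> over its subfield \<open>F\<close>; all infinite cardinalities are
  identified with \<open>\<infinity>\<close>.\<close>

definition trdeg :: "('b, 'm) ring_scheme \<Rightarrow> 'b set \<Rightarrow> enat" where
  "trdeg L F = (SUP S \<in> {S. finite S \<and> alg_independent L F S}. enat (card S))"

section \<open>Matrices and representations\<close>

text \<open>Only the type \<open>'b mat\<close> and its index-wise constructor are taken from
  \<open>Jordan_Normal_Form.Matrix\<close>. The arithmetic there refers to type-class operations, whereas here
  the entries belong to a field given by a record.\<close>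

definition mat_monoid :: "('b, 'm) ring_scheme \<Rightarrow> nat \<Rightarrow> 'b mat monoid" where
  "mat_monoid R n =
    \<lparr> carrier = {A \<in> carrier_mat n n. \<forall>i<n. \<forall>j<n. A $$ (i, j) \<in> carrier R},
      mult = (\<lambda>A B. mat n n (\<lambda>(i, j). \<Oplus>\<^bsub>R\<^esub>l\<in>{..<n}. A $$ (i, l) \<otimes>\<^bsub>R\<^esub> B $$ (l, j))),
      one = mat n n (\<lambda>(i, j). if i = j then \<one>\<^bsub>R\<^esub> else \<zero>\<^bsub>R\<^esub>) \<rparr>"

definition GL :: "('b, 'm) ring_scheme \<Rightarrow> nat \<Rightarrow> 'b mat monoid" where
  "GL R n = units_of (mat_monoid R n)"

definition col_space :: "('b, 'm) ring_scheme \<Rightarrow> nat \<Rightarrow> ('b, 'b vec) module" where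
  "col_space R n =
    \<lparr> carrier = {v \<in> carrier_vec n. \<forall>i<n. v $ i \<in> carrier R},
      mult = undefined,
      one = undefined,
      ring.zero = vec n (\<lambda>_. \<zero>\<^bsub>R\<^esub>),
      add = (\<lambda>v w. vec n (\<lambda>i. v $ i \<oplus>\<^bsub>R\<^esub> w $ i)),
      smult = (\<lambda>c v. vec n (\<lambda>i. c \<otimes>\<^bsub>R\<^esub> v $ i)) \<rparr>"

definition mat_vec :: "('b, 'm) ring_scheme \<Rightarrow> nat \<Rightarrow> 'b mat \<Rightarrow> 'b vec \<Rightarrow> 'b vec" where
  "mat_vec R n A v = vec n (\<lambda>i. \<Oplus>\<^bsub>R\<^esub>j\<in>{..<n}. A $$ (i, j) \<otimes>\<^bsub>R\<^esub> v $ j)"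

definition representation ::
  "('b, 'm) ring_scheme \<Rightarrow> ('g, 'h) monoid_scheme \<Rightarrow> nat \<Rightarrow> ('g \<Rightarrow> 'b mat) \<Rightarrow> bool" where
  "representation K G n \<rho> \<longleftrightarrow> n \<ge> 1 \<and> \<rho> \<in> hom G (GL K n)"

definition equivalent_reps ::
  "('b, 'm) ring_scheme \<Rightarrow> ('g, 'h) monoid_scheme \<Rightarrow> nat \<Rightarrow> ('g \<Rightarrow> 'b mat) \<Rightarrow> ('g \<Rightarrow> 'b mat) \<Rightarrow> bool"
where
  "equivalent_reps K G n \<rho> \<sigma> \<longleftrightarrow>
    (\<exists>P \<in> carrier (GL K n). \<forall>g \<in> carrier G.
      \<sigma> g = P \<otimes>\<^bsub>GL K n\<^esub> \<rho> g \<otimes>\<^bsub>GL K n\<^esub> inv\<^bsub>GL K n\<^esub> P)"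

definition irreducible_rep ::
  "('b, 'm) ring_scheme \<Rightarrow> ('g, 'h) monoid_scheme \<Rightarrow> nat \<Rightarrow> ('g \<Rightarrow> 'b mat) \<Rightarrow> bool" where
  "irreducible_rep K G n \<rho> \<longleftrightarrow> representation K G n \<rho> \<and>
    (\<forall>W. submodule W K (col_space K n) \<longrightarrow>
         (\<forall>g \<in> carrier G. \<forall>w \<in> W. mat_vec K n (\<rho> g) w \<in> W) \<longrightarrow>
         W = {\<zero>\<^bsub>col_space K n\<^esub>} \<or> W = carrier (col_space K n))"

section \<open>Essential dimension\<close>

text \<open>\<open>F\<close> is the base field, as a subfield of \<open>K\<close>. The infimum is over a nonempty set (for a
  representation \<open>\<rho>\<close> it contains
  the value for \<open>K\<^sub>0 = carrier K\<close>), hence it is a minimum, \<open>enat\<close> being well-ordered.\<close>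

definition ed ::
  "'b set \<Rightarrow> ('b, 'm) ring_scheme \<Rightarrow> ('g, 'h) monoid_scheme \<Rightarrow> nat \<Rightarrow> ('g \<Rightarrow> 'b mat) \<Rightarrow> enat" where
  "ed F K G n \<rho> =
    (INF K\<^sub>0 \<in> {K\<^sub>0. subfield K\<^sub>0 K \<and> F \<subseteq> K\<^sub>0 \<and>
                   (\<exists>\<sigma>. representation (K\<lparr>carrier := K\<^sub>0\<rparr>) G n \<sigma> \<and> equivalent_reps K G n \<rho> \<sigma>)}.
      trdeg (K\<lparr>carrier := K\<^sub>0\<rparr>) F)"

text \<open>A supremum inside HOL can only range over the extensions of \<open>k\<close> whose elements are of a given
  type \<open>'b\<close>, which is a parameter. Statements about \<open>ed_Rep\<close> that cover all field extensions are
  polymorphic in \<open>'b\<close>.\<close>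

definition ed_Rep :: "'b itself \<Rightarrow> ('a, 'm) ring_scheme \<Rightarrow> ('g, 'h) monoid_scheme \<Rightarrow> enat" where
  "ed_Rep _ k G =
    Sup {ed (\<iota> ` carrier k) K G n \<rho> | (K :: 'b ring) \<iota> n \<rho>.
           field_extension k K \<iota> \<and> representation K G n \<rho>}"

end

theory Submission
  imports Defs "Jordan_Normal_Form.Missing_VectorSpace"
begin

text \<open>Let \<open>F\<close> be the image of \<open>k\<close> in \<open>K\<close>, and let \<open>V\<close> be an \<open>n\<close>-dimensional representation of \<open>G\<close> over \<open>K\<close>
that is generated by one vector \<open>v\<close>; every irreducible representation is. The proof gives the
bound \<open>n - 1\<close> for its essential dimension, and \<open>n - 1 \<le> n\<^sup>2 / 4\<close> because \<open>(n - 2)\<^sup>2 \<ge> 0\<close>.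

Choose a basis \<open>B\<close> of \<open>V\<close> with \<open>v \<in> B\<close> inside the orbit of \<open>v\<close> (\<open>cyclic_basis\<close>). Let \<open>L\<close> consist of the
elements of \<open>K\<close> that are killed by all those \<open>F\<close>-derivations of \<open>K\<close> that kill the matrix entries of
\<open>G\<close> in the basis \<open>B\<close>. This is a field between \<open>F\<close> and \<open>K\<close> over which the representation is defined.
To bound its transcendence degree, let a derivation \<open>D\<close> act on the coordinates with respect to \<open>B\<close>; this
is a connection on \<open>V\<close>, that is, an additive map \<open>\<nabla>\<close> with \<open>\<nabla>(c w) = D(c) w + c \<nabla>(w)\<close>. Its sum of conjugates
\<open>N = (\<Sum>h. h \<nabla> h\<^sup>-\<^sup>1)\<close> commutes with \<open>G\<close> and satisfies \<open>N(c w) = |G| D(c) w + c N(w)\<close>. Suppose that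
\<open>N(v) = l v\<close> for a scalar \<open>l\<close>. Then \<open>N(b) = l b\<close> for all \<open>b \<in> B\<close>, since \<open>B\<close> lies in the orbit of \<open>v\<close>,
and hence \<open>N(g b) = l (g b)\<close>. Expanding \<open>g b\<close> in the basis before applying \<open>N\<close> yields the same
vector plus \<open>|G|\<close> times the combination of \<open>B\<close> whose coefficients are the derivatives of the matrix
entries. In characteristic \<open>0\<close>, \<open>D\<close> therefore kills all matrix entries
(\<open>structure_constants_rigid\<close>). So these are killed as soon as the \<open>n - 1\<close> coordinates of \<open>N(v)\<close> away from
\<open>v\<close> vanish, and these coordinates depend linearly on \<open>D\<close>. On the other hand, algebraically independent
elements of \<open>K\<close> have dual derivations (\<open>dual_derivation_exists\<close>). If \<open>L\<close> contained \<open>n\<close> algebraically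
independent elements, then some linear combination of their dual derivations would satisfy the \<open>n - 1\<close>
linear conditions without being \<open>0\<close> on all of these elements, contradicting the definition of \<open>L\<close>
(\<open>trdeg_constant_field\<close>).

For an arbitrary representation, decompose the regular representation into irreducible subspaces
(\<open>irreducible_decomposition\<close>, by averaging a projection) of dimensions \<open>n\<^sub>j\<close>, with bases as above. The
same argument, applied to all these bases at once, yields a field \<open>L\<close>, over which all these summands are
defined, of transcendence degree at most the sum of the numbers \<open>n\<^sub>j - 1\<close>. Since the \<open>n\<^sub>j\<close> add up to \<open>|G|\<close>,
this is at most \<open>|G| - 1 \<le> |G|\<^sup>2 / 4\<close>. Every
representation is a sum of images of them under intertwining maps, and each image is \<open>0\<close> or an
isomorphic copy, so every representation is defined over \<open>L\<close> (\<open>basis_defined_over\<close>). Since the bound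
does not depend on the representation, it also bounds the supremum over all of them.\<close>

section \<open>Extending derivations through dual numbers\<close>

text \<open>The ring \<open>R[\<epsilon>] / (\<epsilon>\<^sup>2)\<close>, the pair \<open>(a, x)\<close> standing for \<open>a + x \<epsilon>\<close>. A map \<open>D\<close> on a subring of \<open>R\<close> is a
derivation if and only if its graph is a subring of the dual numbers. A subring is the graph of a
function if it contains no \<open>(\<zero>, x)\<close> with \<open>x \<noteq> \<zero>\<close>. In this form, extending a derivation means enlarging a
subring.\<close>

definition dual_numbers :: "('b, 'm) ring_scheme \<Rightarrow> ('b \<times> 'b) ring" where
  "dual_numbers R =
    \<lparr> carrier = carrier R \<times> carrier R,
      mult = (\<lambda>x y. (fst x \<otimes>\<^bsub>R\<^esub> fst y, fst x \<otimes>\<^bsub>R\<^esub> snd y \<oplus>\<^bsub>R\<^esub> snd x \<otimes>\<^bsub>R\<^esub> fst y)),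
      one = (\<one>\<^bsub>R\<^esub>, \<zero>\<^bsub>R\<^esub>),
      ring.zero = (\<zero>\<^bsub>R\<^esub>, \<zero>\<^bsub>R\<^esub>),
      add = (\<lambda>x y. (fst x \<oplus>\<^bsub>R\<^esub> fst y, snd x \<oplus>\<^bsub>R\<^esub> snd y)) \<rparr>"

lemma dual_numbers_simps:
  "carrier (dual_numbers R) = carrier R \<times> carrier R"
  "x \<otimes>\<^bsub>dual_numbers R\<^esub> y =
     (fst x \<otimes>\<^bsub>R\<^esub> fst y, fst x \<otimes>\<^bsub>R\<^esub> snd y \<oplus>\<^bsub>R\<^esub> snd x \<otimes>\<^bsub>R\<^esub> fst y)"
  "\<one>\<^bsub>dual_numbers R\<^esub> = (\<one>\<^bsub>R\<^esub>, \<zero>\<^bsub>R\<^esub>)"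
  "\<zero>\<^bsub>dual_numbers R\<^esub> = (\<zero>\<^bsub>R\<^esub>, \<zero>\<^bsub>R\<^esub>)"
  "x \<oplus>\<^bsub>dual_numbers R\<^esub> y = (fst x \<oplus>\<^bsub>R\<^esub> fst y, snd x \<oplus>\<^bsub>R\<^esub> snd y)"
  by (simp_all add: dual_numbers_def)

abbreviation (in cring) dual_ring (\<open>\<D>\<close>) where "\<D> \<equiv> dual_numbers R"

lemma (in cring) dual_numbers_cring: "cring \<D>"
proof (rule cringI)
  show "abelian_group \<D>"
    by (rule abelian_groupI)
      (auto simp: dual_numbers_simps a_ac intro!: bexI[of _ "(\<ominus> fst x, \<ominus> snd x)" for x]
        l_neg)
  show "Group.comm_monoid \<D>"
    by (rule comm_monoidI) (auto simp: dual_numbers_simps m_ac a_ac l_distr r_distr)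
qed (auto simp: dual_numbers_simps m_ac a_ac l_distr r_distr)

lemma (in cring) fst_ring_hom: "ring_hom_cring \<D> R fst"
  by (intro ring_hom_cring.intro ring_hom_cring_axioms.intro dual_numbers_cring is_cring)
    (auto intro!: ring_hom_memI simp: dual_numbers_simps)

lemma (in cring) dual_numbers_functional:
  assumes sub: "subring \<Gamma> \<D>" and functional: "\<And>x. (\<zero>, x) \<in> \<Gamma> \<Longrightarrow> x = \<zero>"
    and "(r, x) \<in> \<Gamma>" "(r, y) \<in> \<Gamma>"
  shows "x = y"
proof -
  interpret D: cring \<D> by (rule dual_numbers_cring)
  have cl: "r \<in> carrier R" "x \<in> carrier R" "y \<in> carrier R"
    using subringE(1)[OF sub] assms(3,4) by (auto simp: dual_numbers_simps)
  have "\<ominus>\<^bsub>\<D>\<^esub> (r, y) = (\<ominus> r, \<ominus> y)"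
    using cl by (intro D.minus_equality) (auto simp: dual_numbers_simps l_neg)
  then have "(r, x) \<oplus>\<^bsub>\<D>\<^esub> (\<ominus> r, \<ominus> y) \<in> \<Gamma>"
    using subringE(5)[OF sub assms(4)] subringE(7)[OF sub assms(3)] by simp
  then have "(\<zero>, x \<oplus> \<ominus> y) \<in> \<Gamma>"
    using cl by (simp add: dual_numbers_simps r_neg)
  then have "x \<oplus> \<ominus> y = \<zero>" by (rule functional)
  then show ?thesis using cl by (metis a_inv_closed minus_equality minus_minus)
qed

lemma (in cring) dual_numbers_pow:
  assumes "a \<in> carrier R" "d \<in> carrier R"
  shows "(a, d) [^]\<^bsub>\<D>\<^esub> (n::nat)
    = (a [^] n, d \<otimes> add_pow R n (a [^] (n - 1)))"
proof -
  interpret D: cring \<D> by (rule dual_numbers_cring)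
  show ?thesis
  proof (induction n)
    case 0
    then show ?case using assms by (simp add: dual_numbers_simps)
  next
    case (Suc n)
    have "add_pow R n (a [^] (n - 1)) \<otimes> a = add_pow R n (a [^] n)"
      using assms by (cases n) (auto simp: add_pow_ldistr simp del: add.nat_pow_Suc)
    moreover have "add_pow R (Suc n) (a [^] n) = add_pow R n (a [^] n) \<oplus> a [^] n"
      using assms by simp
    ultimately show ?case
      using Suc assms by (simp add: dual_numbers_simps m_assoc r_distr m_comm a_comm m_lcomm[of a d]
          del: add.nat_pow_Suc)
  qed
qed

text \<open>Taylor's formula \<open>f(a + d \<epsilon>) = f(a) + (f\<^sup>D(a) + d f'(a)) \<epsilon>\<close> for a polynomial with coefficients
\<open>c\<^sub>i + e\<^sub>i \<epsilon>\<close>, where \<open>f\<^sup>D\<close> has the coefficients \<open>e\<^sub>i\<close>.\<close>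

lemma (in cring) dual_numbers_sum:
  fixes n :: nat
  assumes a: "a \<in> carrier R" and d: "d \<in> carrier R"
    and c: "\<And>i. c i \<in> carrier R" and e: "\<And>i. e i \<in> carrier R"
  shows "(\<Oplus>\<^bsub>\<D>\<^esub>i\<in>{..n}. (c i, e i) \<otimes>\<^bsub>\<D>\<^esub> (a, d) [^]\<^bsub>\<D>\<^esub> i)
    = (\<Oplus>i\<in>{..n}. c i \<otimes> a [^] i,
       (\<Oplus>i\<in>{..n}. e i \<otimes> a [^] i) \<oplus> d \<otimes> (\<Oplus>i\<in>{..n}. c i \<otimes> add_pow R i (a [^] (i - 1))))"
proof -
  interpret D: cring \<D> by (rule dual_numbers_cring)
  have cl: "(c i, e i) \<otimes>\<^bsub>\<D>\<^esub> (a, d) [^]\<^bsub>\<D>\<^esub> i \<in> carrier \<D>" for i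
    using assms by (intro D.m_closed D.nat_pow_closed) (auto simp: dual_numbers_simps)
  show ?thesis
  proof (induction n)
    case 0
    then show ?case using cl[of 0] assms by (simp add: dual_numbers_simps)
  next
    case (Suc n)
    have 1: "(c (Suc n), e (Suc n)) \<otimes>\<^bsub>\<D>\<^esub> (a, d) [^]\<^bsub>\<D>\<^esub> Suc n =
      (c (Suc n) \<otimes> a [^] Suc n,
       e (Suc n) \<otimes> a [^] Suc n \<oplus> d \<otimes> (c (Suc n) \<otimes> add_pow R (Suc n) (a [^] n)))"
      using assms unfolding dual_numbers_pow[OF a d]
      by (simp add: dual_numbers_simps m_lcomm a_comm del: add.nat_pow_Suc)
    show ?case
      unfolding D.finsum_Suc[of _ n, OF Pi_I[OF cl]] Suc 1
      using assms by (simp add: dual_numbers_simps r_distr a_ac Pi_def del: add.nat_pow_Suc)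
  qed
qed

lemma (in domain) nat_multiple_nonzero:
  assumes "char_zero R" "n > 0" "x \<in> carrier R" "add_pow R (n::nat) x = \<zero>"
  shows "x = \<zero>"
proof -
  have "add_pow R n \<one> \<otimes> x = \<zero>"
    using assms by (simp add: add_pow_ldistr)
  moreover have "add_pow R n \<one> \<noteq> \<zero>" using assms by (simp add: char_zero_def)
  ultimately show ?thesis using assms integral by blast
qed

lemma coeff_UP: "p \<in> carrier (UP R) \<Longrightarrow> up_ring.coeff (UP R) p i = p i"
  by (simp add: UP_def)

text \<open>A derivation \<open>\<delta>\<close> on a subring \<open>A\<close> extends to \<open>A[a]\<close>. The candidates for the extended graph are the images of
\<open>A[X]\<close> under evaluation at \<open>a + d \<epsilon>\<close>; what has to be found is a \<open>d\<close> such that \<open>f(a) = \<zero>\<close>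
implies \<open>f(a + d \<epsilon>) = \<zero>\<close>. If \<open>a\<close> is transcendental over \<open>A\<close>, any \<open>d\<close> will do. If it is algebraic, take a
relation \<open>g\<close> of least degree. Its derivative does not vanish at \<open>a\<close>, by minimality and because the
characteristic is \<open>0\<close>, so \<open>d\<close> can be chosen to make \<open>g(a + d \<epsilon>) = \<zero>\<close>; every other relation becomes a
multiple of \<open>g\<close> after multiplication by a nonzero constant.\<close>

lemma (in field) extend_derivation_by_one:
  assumes char: "char_zero R"
    and A_sub: "subring A R"
    and \<psi>_hom: "(\<lambda>r. (r, \<delta> r)) \<in> ring_hom (R\<lparr>carrier := A\<rparr>) \<D>"
    and a: "a \<in> carrier R"
  shows "\<exists>d \<Gamma>'. subring \<Gamma>' \<D> \<and> (\<forall>r\<in>A. (r, \<delta> r) \<in> \<Gamma>') \<and> (a, d) \<in> \<Gamma>' \<and>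
           (\<forall>x. (\<zero>, x) \<in> \<Gamma>' \<longrightarrow> x = \<zero>)"
proof -
  define \<psi> where "\<psi> r = (r, \<delta> r)" for r
  define A' where "A' = R\<lparr>carrier := A\<rparr>"
  have A'_simps: "carrier A' = A" "mult A' = mult R" "add A' = add R" "\<one>\<^bsub>A'\<^esub> = \<one>" "\<zero>\<^bsub>A'\<^esub> = \<zero>"
    by (simp_all add: A'_def)
  have \<psi>_hom: "\<psi> \<in> ring_hom A' \<D>"
    using \<psi>_hom unfolding \<psi>_def A'_def .
  have \<psi>_cl: "r \<in> A \<Longrightarrow> r \<in> carrier R \<and> \<delta> r \<in> carrier R" for r
    using ring_hom_closed[OF \<psi>_hom, of r] unfolding \<psi>_def by (simp add: A'_simps dual_numbers_simps)
  have D: "cring \<D>" by (rule dual_numbers_cring)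
  have A: "domain A'" unfolding A'_def by (rule subring_is_domain[OF A_sub])
  have id_hom: "(\<lambda>x. x) \<in> ring_hom A' R"
    by (rule ring_hom_memI) (use subringE(1)[OF A_sub] in \<open>auto simp: A'_simps\<close>)
  interpret U: UP_domain A' "UP A'"
    unfolding UP_domain_def by (fact A)
  have P: "UP_pre_univ_prop A' \<D> \<psi>"
    by (intro UP_pre_univ_prop.intro ring_hom_cring.intro ring_hom_cring_axioms.intro
        UP_cring.intro \<psi>_hom D domain.axioms(1)[OF A])
  have Q: "UP_pre_univ_prop A' R (\<lambda>x. x)"
    by (intro UP_pre_univ_prop.intro ring_hom_cring.intro ring_hom_cring_axioms.intro
        UP_cring.intro id_hom domain.axioms(1)[OF A]) (rule is_cring)
  let ?P = "UP A'" and ?co = "up_ring.coeff (UP A')" and ?deg = "UnivPoly.deg A'"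
  define ev where "ev d = UnivPoly.eval A' \<D> \<psi> (a, d)" for d
  define ev0 where "ev0 = UnivPoly.eval A' R (\<lambda>x. x) a"
  define T where "T f = (\<Oplus>i\<in>{..?deg f}. \<delta> (?co f i) \<otimes> a [^] i)" for f
  define T' where "T' f = (\<Oplus>i\<in>{..?deg f}. ?co f i \<otimes> add_pow R i (a [^] (i - 1)))" for f
  have coeff_A: "?co f i \<in> A" if "f \<in> carrier ?P" for f i
    using U.coeff_closed[OF that] by (simp add: A'_simps)
  note coeff_cl = coeff_A[THEN \<psi>_cl]
  have T_cl: "T f \<in> carrier R" "T' f \<in> carrier R" if "f \<in> carrier ?P" for f
    unfolding T_def T'_def using coeff_cl[OF that] a by (auto intro!: finsum_closed)
  have ev_eq: "ev d f = (ev0 f, T f \<oplus> d \<otimes> T' f)"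
    if f: "f \<in> carrier ?P" and d: "d \<in> carrier R" for f d
    unfolding ev_def ev0_def T_def T'_def U.eval_on_carrier[OF f] \<psi>_def
    by (intro dual_numbers_sum) (use coeff_cl[OF f] a d in auto)
  have ev_hom: "ring_hom_cring ?P \<D> (ev d)" if "d \<in> carrier R" for d
    unfolding ev_def using that a
    by (intro ring_hom_cring.intro ring_hom_cring_axioms.intro U.P.is_cring D
        UP_pre_univ_prop.eval_ring_hom[OF P]) (simp add: dual_numbers_simps)
  have ev0_hom: "ring_hom_cring ?P R ev0"
    unfolding ev0_def using a
    by (intro ring_hom_cring.intro ring_hom_cring_axioms.intro U.P.is_cring is_cring
        UP_pre_univ_prop.eval_ring_hom[OF Q])
  have "\<exists>d\<in>carrier R. \<forall>f\<in>carrier ?P. ev0 f = \<zero> \<longrightarrow> ev d f = (\<zero>, \<zero>)"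
  proof (cases "\<exists>g\<in>carrier ?P. g \<noteq> \<zero>\<^bsub>?P\<^esub> \<and> ev0 g = \<zero>")
    case False
    have "ev \<zero> \<zero>\<^bsub>?P\<^esub> = (\<zero>, \<zero>)"
      using ring_hom_cring.hom_zero[OF ev_hom, of \<zero>] by (simp add: dual_numbers_simps)
    then show ?thesis using False by (intro bexI[of _ \<zero>]) auto
  next
    case True
    define is_rel where
      "is_rel g \<longleftrightarrow> g \<in> carrier ?P \<and> g \<noteq> \<zero>\<^bsub>?P\<^esub> \<and> ev0 g = \<zero>" for g
    obtain g where g: "is_rel g" and g_min: "\<And>h. is_rel h \<Longrightarrow> ?deg g \<le> ?deg h"
      using ex_has_least_nat[of is_rel _ "?deg"] True unfolding is_rel_def by blast
    have gP: "g \<in> carrier ?P" and g0: "g \<noteq> \<zero>\<^bsub>?P\<^esub>" and g_root: "ev0 g = \<zero>"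
      using g by (auto simp: is_rel_def)
    have vanish: "h = \<zero>\<^bsub>?P\<^esub>"
      if "h \<in> carrier ?P" "ev0 h = \<zero>" "h = \<zero>\<^bsub>?P\<^esub> \<or> ?deg h < ?deg g" for h
      using that g_min[of h] unfolding is_rel_def by (metis not_le)
    \<comment> \<open>The derivative of \<open>g\<close> is the polynomial \<open>h\<close>; if it vanished at \<open>a\<close>, it would be the zero polynomial.\<close>
    have g'_nz: "T' g \<noteq> \<zero>"
    proof
      assume T0: "T' g = \<zero>"
      define m where "m = ?deg g"
      define h where "h i = add_pow R (Suc i) (?co g (Suc i))" for i
      have multA: "add_pow R (n::nat) r \<in> A" if "r \<in> A" for n r
        using that by (induction n) (auto simp: subringE[OF A_sub])
      have above: "?co g i = \<zero>" if "m < i" for i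
        using U.deg_aboveD[OF _ gP] that by (simp add: m_def A'_simps)
      have hP: "h \<in> carrier ?P"
        unfolding UP_def up_def bound_def
        using above multA coeff_A[OF gP] by (auto simp: A'_simps h_def intro!: exI[of _ m] simp del: add.nat_pow_Suc)
      have coeff_h: "?co h i = h i" for i
        by (rule coeff_UP[OF hP])
      have m0: "m \<noteq> 0"
      proof
        assume "m = 0"
        then have "g = up_ring.monom ?P (?co g 0) 0"
          using U.deg_zero_impl_monom[OF gP] by (simp add: m_def)
        moreover have "ev0 g = ?co g 0"
          unfolding ev0_def U.eval_on_carrier[OF gP] using \<open>m = 0\<close> coeff_cl[OF gP]
          by (simp add: m_def)
        ultimately show False using g_root g0 by (metis A'_simps(5) U.monom_zero)
      qed
      then obtain l where l: "m = Suc l" by (cases m) auto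
      have deg_h: "?deg h \<le> l"
        by (rule U.deg_aboveI[OF _ hP])
          (use above l in \<open>auto simp: coeff_h h_def A'_simps simp del: add.nat_pow_Suc\<close>)
      have "ev0 h = (\<Oplus>i\<in>{..?deg h}. h i \<otimes> a [^] i)"
        unfolding ev0_def U.eval_on_carrier[OF hP] coeff_h ..
      also have "\<dots> = (\<Oplus>i\<in>{..l}. h i \<otimes> a [^] i)"
      proof (rule add.finprod_mono_neutral_cong_left)
        show "{..?deg h} \<subseteq> {..l}" using deg_h by auto
        fix i assume "i \<in> {..l} - {..?deg h}"
        then have "h i = \<zero>" using U.deg_aboveD[OF _ hP, of i] by (simp add: coeff_h A'_simps)
        then show "h i \<otimes> a [^] i = \<zero>" using a by simp
      qed (use coeff_cl[OF gP] a in \<open>auto simp: h_def\<close>)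
      also have "\<dots> = T' g"
      proof -
        have "T' g = (\<Oplus>i\<in>{..l}. ?co g (Suc i) \<otimes> add_pow R (Suc i) (a [^] i))
            \<oplus> ?co g 0 \<otimes> add_pow R (0::nat) (a [^] (0 - 1 :: nat))"
          unfolding T'_def m_def[symmetric] l
          by (subst finsum_Suc2) (use coeff_cl[OF gP] a in auto)
        also have "\<dots> = (\<Oplus>i\<in>{..l}. ?co g (Suc i) \<otimes> add_pow R (Suc i) (a [^] i))"
          using coeff_cl[OF gP] a by (simp add: Pi_def)
        also have "\<dots> = (\<Oplus>i\<in>{..l}. h i \<otimes> a [^] i)"
          by (intro finsum_cong')
            (use coeff_cl[OF gP] a in \<open>auto simp: h_def add_pow_ldistr add_pow_rdistr simp del: add.nat_pow_Suc\<close>)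
        finally show ?thesis by simp
      qed
      finally have "ev0 h = \<zero>" using T0 by simp
      then have "h = \<zero>\<^bsub>?P\<^esub>" using vanish[OF hP] deg_h l m_def by auto
      then have "h l = \<zero>" by (metis coeff_h U.coeff_zero A'_simps(5))
      then have "?co g (Suc l) = \<zero>"
        using nat_multiple_nonzero[OF char] coeff_cl[OF gP] unfolding h_def by blast
      moreover have "?co g m \<noteq> \<zero>"
        using U.lcoeff_nonzero_deg[OF _ gP] m0 by (simp add: m_def A'_simps)
      ultimately show False using l by simp
    qed
    
    have T'_unit: "T' g \<in> Units R" using g'_nz T_cl(2)[OF gP] by (simp add: field_Units)
    \<comment> \<open>This \<open>d\<close> solves \<open>g\<^sup>\<delta>(a) + d g'(a) = \<zero>\<close>.\<close>
    define d where "d = \<ominus> T g \<otimes> inv (T' g)"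
    have d: "d \<in> carrier R" using T'_unit T_cl[OF gP] by (simp add: d_def)
    have "d \<otimes> T' g = \<ominus> T g"
      unfolding d_def using T'_unit T_cl[OF gP] by (simp add: m_assoc)
    then have ev_g: "ev d g = \<zero>\<^bsub>\<D>\<^esub>"
      unfolding ev_eq[OF gP d] g_root using T_cl[OF gP] by (simp add: dual_numbers_simps r_neg)
    \<comment> \<open>Pseudo-division by \<open>g\<close>, with \<open>c k\<close> a power of its leading coefficient; the remainder has the root \<open>a\<close> and is \<open>0\<close>.\<close>
    have "ev d f = (\<zero>, \<zero>)" if f: "f \<in> carrier ?P" and root: "ev0 f = \<zero>" for f
    proof -
      define c where "c k = ?co g (?deg g) [^]\<^bsub>A'\<^esub> (k::nat)" for k
      have c_cl: "c k \<in> carrier A'" for k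
        unfolding c_def by (intro U.R.nat_pow_closed U.coeff_closed gP)
      have c0: "c k \<noteq> \<zero>" for k
      proof (induction k)
        case (Suc k)
        have "c (Suc k) = c k \<otimes>\<^bsub>A'\<^esub> ?co g (?deg g)"
          unfolding c_def by simp
        moreover have "?co g (?deg g) \<noteq> \<zero>\<^bsub>A'\<^esub>"
          using U.lcoeff_nonzero2[OF gP g0] .
        ultimately show ?case
          using Suc U.R.integral[of "c k"] c_cl[of k] U.coeff_closed[OF gP] by (auto simp: A'_simps)
      qed (simp add: c_def A'_simps)
      obtain q r k where q: "q \<in> carrier ?P" and r: "r \<in> carrier ?P"
        and eq: "c k \<odot>\<^bsub>?P\<^esub> f = g \<otimes>\<^bsub>?P\<^esub> q \<oplus>\<^bsub>?P\<^esub> r"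
        and deg_r: "r = \<zero>\<^bsub>?P\<^esub> \<or> ?deg r < ?deg g"
        using U.long_div_theorem[OF gP f g0] unfolding c_def by blast
      define C where "C = up_ring.monom ?P (c k) 0"
      have C: "C \<in> carrier ?P" unfolding C_def by (rule U.monom_closed[OF c_cl])
      have eq': "C \<otimes>\<^bsub>?P\<^esub> f = g \<otimes>\<^bsub>?P\<^esub> q \<oplus>\<^bsub>?P\<^esub> r"
        unfolding C_def U.monom_mult_is_smult[OF c_cl f] by (rule eq)
      note h0 = ring_hom_cring.homh[OF ev0_hom]
      note h = ring_hom_cring.homh[OF ev_hom[OF d]]
      have "ev0 C \<otimes> ev0 f = ev0 g \<otimes> ev0 q \<oplus> ev0 r"
        using arg_cong[OF eq', of ev0] ring_hom_mult[OF h0] ring_hom_add[OF h0] C f gP q r by simp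
      then have "ev0 r = \<zero>"
        using root g_root ring_hom_closed[OF h0] C q r by simp
      then have "r = \<zero>\<^bsub>?P\<^esub>" using vanish[OF r] deg_r by blast
      then have "C \<otimes>\<^bsub>?P\<^esub> f = g \<otimes>\<^bsub>?P\<^esub> q" using eq' gP q by simp
      then have "ev d C \<otimes>\<^bsub>\<D>\<^esub> ev d f = ev d g \<otimes>\<^bsub>\<D>\<^esub> ev d q"
        using ring_hom_mult[OF h] C f gP q by metis
      also have "\<dots> = (\<zero>, \<zero>)"
        using ring_hom_closed[OF h q] unfolding ev_g by (auto simp: dual_numbers_simps)
      finally have 1: "ev d C \<otimes>\<^bsub>\<D>\<^esub> ev d f = (\<zero>, \<zero>)" .
      have fst_ev: "fst (ev d f) = \<zero>" unfolding ev_eq[OF f d] root by simp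
      have C_ev: "fst (ev d C) = c k"
        unfolding ev_def C_def using UP_pre_univ_prop.eval_const[OF P _ c_cl, of "(a, d)"] a d
        by (simp add: dual_numbers_simps \<psi>_def)
      have cl: "snd (ev d f) \<in> carrier R" "snd (ev d C) \<in> carrier R"
        using ring_hom_closed[OF h f] ring_hom_closed[OF h C] by (auto simp: dual_numbers_simps)
      have ck: "c k \<in> carrier R" using c_cl[of k] \<psi>_cl by (simp add: A'_simps)
      have "c k \<otimes> snd (ev d f) = \<zero>"
        using 1 cl ck unfolding dual_numbers_simps fst_ev C_ev by simp
      then have "snd (ev d f) = \<zero>" using integral c0[of k] ck cl by blast
      then show ?thesis using fst_ev by (simp add: prod_eq_iff)
    qed
    then show ?thesis using d by blast
  qed
  then obtain d where d: "d \<in> carrier R"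
    and d0: "\<And>f. f \<in> carrier ?P \<Longrightarrow> ev0 f = \<zero> \<Longrightarrow> ev d f = (\<zero>, \<zero>)" by blast
  show ?thesis
  proof (intro exI conjI allI ballI impI)
    show "subring (ev d ` carrier ?P) \<D>"
      by (rule ring_hom_ring.img_is_subring[OF _ U.P.carrier_is_subring])
        (intro ring_hom_ringI2 cring.axioms(1)[OF D] U.P.ring_axioms ring_hom_cring.homh[OF ev_hom[OF d]])
    fix r assume "r \<in> A"
    then have r: "r \<in> carrier A'" by (simp add: A'_simps)
    have "ev d (up_ring.monom ?P r 0) = (r, \<delta> r)"
      unfolding ev_def using UP_pre_univ_prop.eval_const[OF P _ r, of "(a, d)"] a d
      by (simp add: dual_numbers_simps \<psi>_def)
    then show "(r, \<delta> r) \<in> ev d ` carrier ?P"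
      using imageI[OF U.monom_closed[OF r, of 0], of "ev d"] by (simp only:)
  next
    have "ev d (up_ring.monom ?P \<one>\<^bsub>A'\<^esub> 1) = (a, d)"
      unfolding ev_def
      by (rule UP_pre_univ_prop.eval_monom1[OF P]) (simp add: dual_numbers_simps a d)
    then show "(a, d) \<in> ev d ` carrier ?P"
      using imageI[OF U.monom_closed[OF U.R.one_closed, of 1], of "ev d"] by (simp only:)
    fix x assume "(\<zero>, x) \<in> ev d ` carrier ?P"
    then obtain f where f: "f \<in> carrier ?P" "(\<zero>, x) = ev d f" by (rule imageE)
    have "ev0 f = \<zero>" using f(2) unfolding ev_eq[OF f(1) d] by simp
    from d0[OF f(1) this] show "x = \<zero>" using f(2) by simp
  qed
qed

lemma (in field) extend_derivation_graph:
  assumes char: "char_zero R"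
    and sub: "subring \<Gamma> \<D>"
    and functional: "\<And>x. (\<zero>, x) \<in> \<Gamma> \<Longrightarrow> x = \<zero>"
    and a: "a \<in> carrier R"
  shows "\<exists>d \<Gamma>'. subring \<Gamma>' \<D> \<and> \<Gamma> \<subseteq> \<Gamma>' \<and> (a, d) \<in> \<Gamma>' \<and>
           (\<forall>x. (\<zero>, x) \<in> \<Gamma>' \<longrightarrow> x = \<zero>)"
proof -
  interpret D: cring \<D> by (rule dual_numbers_cring)
  note sr = subringE[OF sub]
  have G_cl: "r \<in> carrier R \<and> x \<in> carrier R" if "(r, x) \<in> \<Gamma>" for r x
    using that sr(1) by (auto simp: dual_numbers_simps)
  define A where "A = fst ` \<Gamma>"
  define \<delta> where "\<delta> r = (THE x. (r, x) \<in> \<Gamma>)" for r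
  define \<psi> where "\<psi> r = (r, \<delta> r)" for r
  note uniq = dual_numbers_functional[OF sub functional]
  have \<delta>: "\<delta> r = x" if "(r, x) \<in> \<Gamma>" for r x
    unfolding \<delta>_def using that uniq by blast
  have \<psi>: "\<psi> r \<in> \<Gamma>" if "r \<in> A" for r
    using that \<delta> unfolding A_def \<psi>_def by force
  have \<psi>_eq: "\<psi> r = (r, x)" if "(r, x) \<in> \<Gamma>" for r x
    using \<delta>[OF that] by (simp add: \<psi>_def)
  have \<psi>_cl: "r \<in> A \<Longrightarrow> r \<in> carrier R \<and> \<delta> r \<in> carrier R" for r
    using \<psi> G_cl unfolding \<psi>_def by blast
  have A_sub: "subring A R"
    unfolding A_def
    by (rule ring_hom_ring.img_is_subring[OF _ sub])
      (intro ring_hom_ringI2 D.ring_axioms ring_axioms ring_hom_cring.homh[OF fst_ring_hom])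
  define A' where "A' = R\<lparr>carrier := A\<rparr>"
  have A'_simps: "carrier A' = A" "mult A' = mult R" "add A' = add R" "\<one>\<^bsub>A'\<^esub> = \<one>" "\<zero>\<^bsub>A'\<^esub> = \<zero>"
    by (simp_all add: A'_def)
  have \<psi>_hom: "\<psi> \<in> ring_hom A' \<D>"
  proof (rule ring_hom_memI)
    fix r assume "r \<in> carrier A'"
    then show "\<psi> r \<in> carrier \<D>" using \<psi> sr(1) by (auto simp: A'_simps)
  next
    fix r s assume "r \<in> carrier A'" "s \<in> carrier A'"
    then have rs: "r \<in> A" "s \<in> A" by (simp_all add: A'_simps)
    have "\<psi> r \<otimes>\<^bsub>\<D>\<^esub> \<psi> s \<in> \<Gamma>" "\<psi> r \<oplus>\<^bsub>\<D>\<^esub> \<psi> s \<in> \<Gamma>"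
      by (intro sr(6,7) \<psi> rs)+
    then show "\<psi> (r \<otimes>\<^bsub>A'\<^esub> s) = \<psi> r \<otimes>\<^bsub>\<D>\<^esub> \<psi> s"
      "\<psi> (r \<oplus>\<^bsub>A'\<^esub> s) = \<psi> r \<oplus>\<^bsub>\<D>\<^esub> \<psi> s"
      by (auto simp: dual_numbers_simps A'_simps \<psi>_def dest: \<delta>)
  next
    show "\<psi> \<one>\<^bsub>A'\<^esub> = \<one>\<^bsub>\<D>\<^esub>"
      using \<psi>_eq sr(3) by (simp add: A'_simps dual_numbers_simps)
  qed
  obtain d \<Gamma>' where *: "subring \<Gamma>' \<D>" "\<forall>r\<in>A. (r, \<delta> r) \<in> \<Gamma>'" "(a, d) \<in> \<Gamma>'"
      "\<forall>x. (\<zero>, x) \<in> \<Gamma>' \<longrightarrow> x = \<zero>"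
    using extend_derivation_by_one[OF char A_sub _ a, of \<delta>] \<psi>_hom unfolding \<psi>_def A'_def by blast
  have "\<Gamma> \<subseteq> \<Gamma>'"
  proof
    fix z assume "z \<in> \<Gamma>"
    then have "z = (fst z, \<delta> (fst z))" "fst z \<in> A"
      using \<delta>[of "fst z" "snd z"] by (auto simp: A_def)
    then show "z \<in> \<Gamma>'" using *(2) by metis
  qed
  then show ?thesis using * by blast
qed

definition derivation :: "('b, 'm) ring_scheme \<Rightarrow> 'b set \<Rightarrow> ('b \<Rightarrow> 'b) \<Rightarrow> bool" where
  "derivation R F D \<longleftrightarrow> D \<in> carrier R \<rightarrow> carrier R \<and>
     (\<forall>x\<in>carrier R. \<forall>y\<in>carrier R. D (x \<oplus>\<^bsub>R\<^esub> y) = D x \<oplus>\<^bsub>R\<^esub> D y) \<and>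
     (\<forall>x\<in>carrier R. \<forall>y\<in>carrier R. D (x \<otimes>\<^bsub>R\<^esub> y) = x \<otimes>\<^bsub>R\<^esub> D y \<oplus>\<^bsub>R\<^esub> D x \<otimes>\<^bsub>R\<^esub> y) \<and>
     (\<forall>c\<in>F. D c = \<zero>\<^bsub>R\<^esub>)"

text \<open>By Zorn's lemma, a derivation given on a subring by its graph extends to the whole field: a maximal
graph has all of \<open>R\<close> as its domain, since otherwise one more element could be added.\<close>

lemma (in field) derivation_extends:
  assumes char: "char_zero R"
    and sub0: "subring \<Gamma>\<^sub>0 \<D>"
    and func0: "\<And>x. (\<zero>, x) \<in> \<Gamma>\<^sub>0 \<Longrightarrow> x = \<zero>"
  shows "\<exists>D. derivation R {} D \<and> (\<forall>(a, x)\<in>\<Gamma>\<^sub>0. D a = x)"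
proof -
  interpret D: cring \<D> by (rule dual_numbers_cring)
  define \<G> where "\<G> = {\<Gamma>. subring \<Gamma> \<D> \<and> \<Gamma>\<^sub>0 \<subseteq> \<Gamma> \<and> (\<forall>x. (\<zero>, x) \<in> \<Gamma> \<longrightarrow> x = \<zero>)}"
  have "\<Gamma>\<^sub>0 \<in> \<G>" using sub0 func0 by (simp add: \<G>_def)
  then have ne: "\<G> \<noteq> {}" by blast
  have chain: "\<Union>\<C> \<in> \<G>" if \<C>: "\<C> \<noteq> {}" "subset.chain \<G> \<C>" for \<C>
  proof -
    have sub: "subring \<Gamma> \<D>" if "\<Gamma> \<in> \<C>" for \<Gamma>
      using \<C>(2) that by (auto simp: subset.chain_def \<G>_def)
    have common: "\<exists>\<Gamma>\<in>\<C>. x \<in> \<Gamma> \<and> y \<in> \<Gamma>" if "x \<in> \<Union>\<C>" "y \<in> \<Union>\<C>" for x y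
    proof -
      obtain A B where AB: "A \<in> \<C>" "B \<in> \<C>" "x \<in> A" "y \<in> B" using \<open>x \<in> \<Union>\<C>\<close> \<open>y \<in> \<Union>\<C>\<close> by blast
      then have "A \<subseteq> B \<or> B \<subseteq> A" using \<C>(2) by (auto simp: subset_chain_def)
      then show ?thesis using AB by blast
    qed
    have "subring (\<Union>\<C>) \<D>"
    proof (rule D.subringI)
      show "\<Union>\<C> \<subseteq> carrier \<D>" using subringE(1)[OF sub] by blast
      show "\<one>\<^bsub>\<D>\<^esub> \<in> \<Union>\<C>" using \<C>(1) subringE(3)[OF sub] by blast
    next
      fix h assume "h \<in> \<Union>\<C>"
      then show "\<ominus>\<^bsub>\<D>\<^esub> h \<in> \<Union>\<C>" using subringE(5)[OF sub] by blast
    next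
      fix h1 h2 assume "h1 \<in> \<Union>\<C>" "h2 \<in> \<Union>\<C>"
      then obtain \<Gamma> where "\<Gamma> \<in> \<C>" "h1 \<in> \<Gamma>" "h2 \<in> \<Gamma>" using common by blast
      then show "h1 \<otimes>\<^bsub>\<D>\<^esub> h2 \<in> \<Union>\<C>" "h1 \<oplus>\<^bsub>\<D>\<^esub> h2 \<in> \<Union>\<C>"
        using subringE(6,7)[OF sub] by blast+
    qed
    then show ?thesis using \<C> unfolding \<G>_def subset.chain_def by blast
  qed
  obtain M where M: "M \<in> \<G>" and M_max: "\<And>Y. Y \<in> \<G> \<Longrightarrow> M \<subseteq> Y \<Longrightarrow> Y = M"
    using subset_Zorn_nonempty[OF ne chain] by blast
  have sub: "subring M \<D>" and M0: "\<Gamma>\<^sub>0 \<subseteq> M"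
    and func: "\<And>x. (\<zero>, x) \<in> M \<Longrightarrow> x = \<zero>"
    using M by (auto simp: \<G>_def)
  have "\<exists>x. (a, x) \<in> M" if a: "a \<in> carrier R" for a
  proof -
    obtain d \<Gamma>' where *: "subring \<Gamma>' \<D>" "M \<subseteq> \<Gamma>'" "(a, d) \<in> \<Gamma>'"
      "\<forall>x. (\<zero>, x) \<in> \<Gamma>' \<longrightarrow> x = \<zero>"
      using extend_derivation_graph[OF char sub func a] by blast
    then have "\<Gamma>' \<in> \<G>" using M0 by (auto simp: \<G>_def)
    then show ?thesis using M_max * by blast
  qed
  then obtain D where DM: "\<And>a. a \<in> carrier R \<Longrightarrow> (a, D a) \<in> M" by metis
  note sr = subringE[OF sub]
  have D_eq: "D a = x" if "(a, x) \<in> M" for a x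
  proof -
    have "a \<in> carrier R" using that sr(1) by (auto simp: dual_numbers_simps)
    then show ?thesis using dual_numbers_functional[OF sub func DM that] by blast
  qed
  have "derivation R {} D"
    unfolding derivation_def
  proof (intro conjI ballI)
    show "D \<in> carrier R \<rightarrow> carrier R" using DM sr(1) by (auto simp: dual_numbers_simps)
    fix x y assume xy: "x \<in> carrier R" "y \<in> carrier R"
    show "D (x \<oplus> y) = D x \<oplus> D y"
      using sr(7)[OF DM[OF xy(1)] DM[OF xy(2)]] by (intro D_eq) (simp add: dual_numbers_simps)
    show "D (x \<otimes> y) = x \<otimes> D y \<oplus> D x \<otimes> y"
      using sr(6)[OF DM[OF xy(1)] DM[OF xy(2)]] by (intro D_eq) (simp add: dual_numbers_simps)
  qed simp
  then show ?thesis using D_eq M0 by blast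
qed

section \<open>Derivations dual to algebraically independent elements\<close>

lemma (in cring) monomial_value_add_mset:
  fixes \<phi> :: "'c \<Rightarrow> 'a"
  assumes \<phi>: "\<And>x. x \<in># m \<Longrightarrow> \<phi> x \<in> carrier R" "\<phi> i \<in> carrier R"
  shows "(\<Otimes>x\<in>set_mset (add_mset i m). \<phi> x [^] count (add_mset i m) x) =
    (\<Otimes>x\<in>set_mset m. \<phi> x [^] count m x) \<otimes> \<phi> i"
proof -
  define A where "A = set_mset m - {i}"
  have A: "finite A" "i \<notin> A" "\<And>x. x \<in> A \<Longrightarrow> \<phi> x \<in> carrier R" using \<phi> by (auto simp: A_def)
  have cl: "(\<Otimes>x\<in>A. \<phi> x [^] count m x) \<in> carrier R" using A by (intro finprod_closed) auto
  have "set_mset (add_mset i m) = insert i A" by (auto simp: A_def)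
  then have "(\<Otimes>x\<in>set_mset (add_mset i m). \<phi> x [^] count (add_mset i m) x)
      = \<phi> i [^] Suc (count m i) \<otimes> (\<Otimes>x\<in>A. \<phi> x [^] count (add_mset i m) x)"
    using A \<phi>(2) by (simp del: nat_pow_Suc)
  also have "(\<Otimes>x\<in>A. \<phi> x [^] count (add_mset i m) x) = (\<Otimes>x\<in>A. \<phi> x [^] count m x)"
    by (rule finprod_cong') (use A in auto)
  also have "\<phi> i [^] Suc (count m i) \<otimes> \<dots> = (\<phi> i [^] count m i \<otimes> (\<Otimes>x\<in>A. \<phi> x [^] count m x)) \<otimes> \<phi> i"
    using cl \<phi>(2) by (simp add: m_ac)
  also have "\<phi> i [^] count m i \<otimes> (\<Otimes>x\<in>A. \<phi> x [^] count m x) = (\<Otimes>x\<in>insert i A. \<phi> x [^] count m x)"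
    using A \<phi>(2) by simp
  also have "\<dots> = (\<Otimes>x\<in>set_mset m. \<phi> x [^] count m x)"
    by (rule finprod_mono_neutral_cong_right) (use A \<phi> in \<open>auto simp: A_def not_in_iff\<close>)
  finally show ?thesis .
qed

lemma (in ring) indexed_pset_support:
  assumes "P \<in> indexed_pset S F" "F \<subseteq> carrier R"
  shows "finite {m. P m \<noteq> \<zero>}" "P m \<noteq> \<zero> \<Longrightarrow> set_mset m \<subseteq> S" "P m \<in> carrier R"
proof -
  have "finite {m. P m \<noteq> \<zero>} \<and> (\<forall>m. P m \<noteq> \<zero> \<longrightarrow> set_mset m \<subseteq> S) \<and> (\<forall>m. P m \<in> carrier R)"
    using assms(1)
  proof induction
    case (indexed_const k)
    have "finite {m. indexed_const k m \<noteq> \<zero>}"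
      by (rule finite_subset[of _ "{{#}}"]) (auto simp: indexed_const_def)
    then show ?case using indexed_const assms(2) by (auto simp: indexed_const_def)
  next
    case (indexed_padd P Q)
    have "{m. indexed_padd P Q m \<noteq> \<zero>} \<subseteq> {m. P m \<noteq> \<zero>} \<union> {m. Q m \<noteq> \<zero>}"
      by (auto simp: indexed_padd_def)
    moreover have "\<forall>m. indexed_padd P Q m \<noteq> \<zero> \<longrightarrow> set_mset m \<subseteq> S"
      using indexed_padd.IH by (metis indexed_padd_def l_zero zero_closed)
    ultimately show ?case using indexed_padd.IH
      by (meson finite_Un finite_subset indexed_padd_def a_closed carrier_coeff_def indexed_padd_in_carrier)
  next
    case (indexed_pmult P i)
    have "{m. indexed_pmult P i m \<noteq> \<zero>} \<subseteq> add_mset i ` {m. P m \<noteq> \<zero>}"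
    proof
      fix m assume "m \<in> {m. indexed_pmult P i m \<noteq> \<zero>}"
      then have "i \<in># m" "P (m - {#i#}) \<noteq> \<zero>" by (auto simp: indexed_pmult_def split: if_splits)
      then show "m \<in> add_mset i ` {m. P m \<noteq> \<zero>}"
        by (intro image_eqI[of _ _ "m - {#i#}"]) auto
    qed
    moreover have "set_mset m \<subseteq> S" if "indexed_pmult P i m \<noteq> \<zero>" for m
    proof -
      have "i \<in># m" "P (m - {#i#}) \<noteq> \<zero>"
        using that by (auto simp: indexed_pmult_def split: if_splits)
      then have "set_mset (add_mset i (m - {#i#})) \<subseteq> S"
        using indexed_pmult by (metis insert_subset set_mset_add_mset_insert)
      then show ?thesis using \<open>i \<in># m\<close> by simp
    qed
    ultimately show ?case using indexed_pmult.IH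
      by (meson finite_imageI finite_subset carrier_coeff_def indexed_pmult_in_carrier)
  qed
  then show "finite {m. P m \<noteq> \<zero>}" "P m \<noteq> \<zero> \<Longrightarrow> set_mset m \<subseteq> S" "P m \<in> carrier R" by auto
qed

context cring
begin

interpretation D: cring \<D> by (rule dual_numbers_cring)

context
  fixes S F :: "'a set" and s :: 'a
  assumes F: "F \<subseteq> carrier R" and S: "S \<subseteq> carrier R"
begin

text \<open>Evaluating an indexed polynomial at the dual number \<open>s + \<epsilon>\<close> for the letter \<open>s\<close> and at \<open>t\<close> for the other
letters \<open>t\<close> yields its value in the first component and the value of its partial derivative with
respect to \<open>s\<close> in the second.\<close>

definition dual_letter :: "'a \<Rightarrow> 'a \<times> 'a" where
  "dual_letter x = (x, if x = s then \<one> else \<zero>)"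

definition dual_monomial :: "'a multiset \<Rightarrow> 'a \<times> 'a" where
  "dual_monomial m = (\<Otimes>\<^bsub>\<D>\<^esub>x\<in>set_mset m. dual_letter x [^]\<^bsub>\<D>\<^esub> count m x)"

definition dual_eval :: "('a multiset \<Rightarrow> 'a) \<Rightarrow> 'a \<times> 'a" where
  "dual_eval P = (\<Oplus>\<^bsub>\<D>\<^esub>m\<in>{m. P m \<noteq> \<zero>}. (P m, \<zero>) \<otimes>\<^bsub>\<D>\<^esub> dual_monomial m)"

lemma dual_letter_closed: "x \<in> S \<Longrightarrow> dual_letter x \<in> carrier \<D>"
  using S by (auto simp: dual_letter_def dual_numbers_simps)

lemma dual_monomial_closed: "set_mset m \<subseteq> S \<Longrightarrow> dual_monomial m \<in> carrier \<D>"
  unfolding dual_monomial_def by (intro D.finprod_closed) (use dual_letter_closed in auto)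

lemma dual_term_closed:
  assumes "P \<in> indexed_pset S F" "set_mset m \<subseteq> S"
  shows "(P m, \<zero>) \<otimes>\<^bsub>\<D>\<^esub> dual_monomial m \<in> carrier \<D>"
  using indexed_pset_support(3)[OF assms(1) F] dual_monomial_closed[OF assms(2)]
  by (intro D.m_closed) (simp_all add: dual_numbers_simps(1))

lemma dual_eval_closed:
  assumes "P \<in> indexed_pset S F" shows "dual_eval P \<in> carrier \<D>"
  unfolding dual_eval_def
  by (intro D.finsum_closed) (use dual_term_closed[OF assms] indexed_pset_support(2)[OF assms F] in auto)

lemma dual_eval_superset:
  assumes P: "P \<in> indexed_pset S F"
    and A: "finite A" "{m. P m \<noteq> \<zero>} \<subseteq> A" "\<And>m. m \<in> A \<Longrightarrow> set_mset m \<subseteq> S"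
  shows "dual_eval P = (\<Oplus>\<^bsub>\<D>\<^esub>m\<in>A. (P m, \<zero>) \<otimes>\<^bsub>\<D>\<^esub> dual_monomial m)"
  unfolding dual_eval_def
proof (rule D.add.finprod_mono_neutral_cong_left)
  fix m assume "m \<in> A - {m. P m \<noteq> \<zero>}"
  then show "(P m, \<zero>) \<otimes>\<^bsub>\<D>\<^esub> dual_monomial m = \<zero>\<^bsub>\<D>\<^esub>"
    using D.l_null[OF dual_monomial_closed[OF A(3)], of m] by (simp add: dual_numbers_simps(4))
qed (use A dual_term_closed[OF P] in auto)

lemma dual_eval_const:
  assumes k: "k \<in> F" shows "dual_eval (indexed_const k) = (k, \<zero>)"
proof -
  have "dual_eval (indexed_const k) = (\<Oplus>\<^bsub>\<D>\<^esub>m\<in>{{#}}. (indexed_const k m, \<zero>) \<otimes>\<^bsub>\<D>\<^esub> dual_monomial m)"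
    by (rule dual_eval_superset[OF indexed_pset.indexed_const[OF k]]) (auto simp: indexed_const_def)
  moreover have "(k, \<zero>) \<in> carrier \<D>" using k F by (auto simp: dual_numbers_simps)
  ultimately show ?thesis by (simp add: indexed_const_def dual_monomial_def)
qed

lemma dual_eval_padd:
  assumes P: "P \<in> indexed_pset S F" and Q: "Q \<in> indexed_pset S F"
  shows "dual_eval (indexed_padd P Q) = dual_eval P \<oplus>\<^bsub>\<D>\<^esub> dual_eval Q"
proof -
  note sP = indexed_pset_support[OF P F] and sQ = indexed_pset_support[OF Q F]
  define A where "A = {m. P m \<noteq> \<zero>} \<union> {m. Q m \<noteq> \<zero>}"
  have A: "finite A" "\<And>m. m \<in> A \<Longrightarrow> set_mset m \<subseteq> S"
    using sP sQ by (auto simp: A_def)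
  let ?f = "\<lambda>P m. (P m, \<zero>) \<otimes>\<^bsub>\<D>\<^esub> dual_monomial m"
  have "dual_eval (indexed_padd P Q) = (\<Oplus>\<^bsub>\<D>\<^esub>m\<in>A. ?f (indexed_padd P Q) m)"
    by (rule dual_eval_superset[OF indexed_pset.indexed_padd[OF P Q] A(1) _ A(2)])
      (auto simp: A_def indexed_padd_def)
  also have "\<dots> = (\<Oplus>\<^bsub>\<D>\<^esub>m\<in>A. ?f P m \<oplus>\<^bsub>\<D>\<^esub> ?f Q m)"
  proof (rule D.finsum_cong')
    fix m assume "m \<in> A"
    note mon = dual_monomial_closed[OF A(2)[OF this]]
    have "(indexed_padd P Q m, \<zero>) = (P m, \<zero>) \<oplus>\<^bsub>\<D>\<^esub> (Q m, \<zero>)"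
      by (simp add: indexed_padd_def dual_numbers_simps)
    then show "?f (indexed_padd P Q) m = ?f P m \<oplus>\<^bsub>\<D>\<^esub> ?f Q m"
      using D.l_distr[OF _ _ mon] sP(3) sQ(3) by (simp add: dual_numbers_simps(1))
  qed (use A(2) dual_term_closed[OF P] dual_term_closed[OF Q] in auto)
  also have "\<dots> = (\<Oplus>\<^bsub>\<D>\<^esub>m\<in>A. ?f P m) \<oplus>\<^bsub>\<D>\<^esub> (\<Oplus>\<^bsub>\<D>\<^esub>m\<in>A. ?f Q m)"
    by (rule D.finsum_addf) (use A(2) dual_term_closed[OF P] dual_term_closed[OF Q] in auto)
  also have "(\<Oplus>\<^bsub>\<D>\<^esub>m\<in>A. ?f P m) = dual_eval P"
    by (rule dual_eval_superset[OF P A(1) _ A(2), symmetric]) (auto simp: A_def)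
  also have "(\<Oplus>\<^bsub>\<D>\<^esub>m\<in>A. ?f Q m) = dual_eval Q"
    by (rule dual_eval_superset[OF Q A(1) _ A(2), symmetric]) (auto simp: A_def)
  finally show ?thesis .
qed

lemma dual_eval_pmult:
  assumes P: "P \<in> indexed_pset S F" and i: "i \<in> S"
  shows "dual_eval (indexed_pmult P i) = dual_eval P \<otimes>\<^bsub>\<D>\<^esub> dual_letter i"
proof -
  note sP = indexed_pset_support[OF P F]
  have supp: "{m. indexed_pmult P i m \<noteq> \<zero>} = add_mset i ` {m. P m \<noteq> \<zero>}"
    by (force simp: indexed_pmult_def image_iff split: if_splits)
  have mon: "dual_monomial (add_mset i m) = dual_monomial m \<otimes>\<^bsub>\<D>\<^esub> dual_letter i" if "set_mset m \<subseteq> S" for m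
    unfolding dual_monomial_def
    by (rule D.monomial_value_add_mset) (use that i dual_letter_closed in auto)
  let ?f = "\<lambda>P m. (P m, \<zero>) \<otimes>\<^bsub>\<D>\<^esub> dual_monomial m"
  have f_add: "?f (indexed_pmult P i) (add_mset i m) = ?f P m \<otimes>\<^bsub>\<D>\<^esub> dual_letter i" if "set_mset m \<subseteq> S" for m
    using D.m_assoc[OF _ dual_monomial_closed[OF that] dual_letter_closed[OF i], of "(P m, \<zero>)"]
    by (simp add: indexed_pmult_def mon[OF that] sP(3) dual_numbers_simps(1))
  have "dual_eval (indexed_pmult P i) = (\<Oplus>\<^bsub>\<D>\<^esub>m\<in>{m. P m \<noteq> \<zero>}. ?f (indexed_pmult P i) (add_mset i m))"
    unfolding dual_eval_def supp
    by (rule D.finsum_reindex)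
      (use sP(2) f_add dual_term_closed[OF P] dual_letter_closed[OF i] in \<open>auto simp: inj_on_def\<close>)
  also have "\<dots> = (\<Oplus>\<^bsub>\<D>\<^esub>m\<in>{m. P m \<noteq> \<zero>}. ?f P m \<otimes>\<^bsub>\<D>\<^esub> dual_letter i)"
    by (rule D.finsum_cong')
      (use sP(2) f_add dual_term_closed[OF P] dual_letter_closed[OF i] in auto)
  also have "\<dots> = dual_eval P \<otimes>\<^bsub>\<D>\<^esub> dual_letter i"
    unfolding dual_eval_def
    by (rule D.finsum_ldistr[symmetric])
      (use sP(1,2) dual_term_closed[OF P] dual_letter_closed[OF i] in auto)
  finally show ?thesis .
qed

lemma fst_dual_eval:
  assumes P: "P \<in> indexed_pset S F"
  shows "fst (dual_eval P) = eval_letters R P"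
proof -
  interpret fst: ring_hom_cring \<D> R fst by (rule fst_ring_hom)
  note sP = indexed_pset_support[OF P F]
  have mon: "fst (dual_monomial m) = (\<Otimes>x\<in>set_mset m. x [^] count m x)" if m: "set_mset m \<subseteq> S" for m
  proof -
    have "fst (dual_monomial m) = (\<Otimes>x\<in>set_mset m. (fst \<circ> (\<lambda>x. dual_letter x [^]\<^bsub>\<D>\<^esub> count m x)) x)"
      unfolding dual_monomial_def by (rule fst.hom_finprod) (use m dual_letter_closed in auto)
    also have "\<dots> = (\<Otimes>x\<in>set_mset m. x [^] count m x)"
      by (rule finprod_cong') (use m S in \<open>auto simp: dual_letter_def dual_numbers_pow subset_iff\<close>)
    finally show ?thesis .
  qed
  have mon_cl: "(\<Otimes>x\<in>set_mset m. x [^] count m x) \<in> carrier R" if "set_mset m \<subseteq> S" for m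
    by (rule finprod_closed) (use that S in \<open>auto simp: subset_iff\<close>)
  have "fst (dual_eval P) = (\<Oplus>m\<in>{m. P m \<noteq> \<zero>}. (fst \<circ> (\<lambda>m. (P m, \<zero>) \<otimes>\<^bsub>\<D>\<^esub> dual_monomial m)) m)"
    unfolding dual_eval_def by (rule fst.hom_finsum) (use sP(2) dual_term_closed[OF P] in auto)
  also have "\<dots> = (\<Oplus>m\<in>{m. P m \<noteq> \<zero>}. P m \<otimes> (\<Otimes>x\<in>set_mset m. x [^] count m x))"
    by (rule finsum_cong') (use sP mon mon_cl in \<open>auto simp: dual_numbers_simps intro!: m_closed\<close>)
  finally show ?thesis unfolding eval_letters_def .
qed

text \<open>The products of values have to be traced back to indexed polynomials by induction, because these are
generated from constants by sums and by multiplication with letters only.\<close>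

lemma dual_eval_image_subring:
  assumes Fr: "subring F R"
  shows "subring (dual_eval ` indexed_pset S F) \<D>" (is "subring ?\<Gamma> _")
proof -
  note Fs = subringE[OF Fr]
  have const_mult: "(k, \<zero>) \<otimes>\<^bsub>\<D>\<^esub> dual_eval P \<in> ?\<Gamma>"
    if k: "k \<in> F" and P: "P \<in> indexed_pset S F" for k P
    using P
  proof induction
    case (indexed_const l)
    have "(k, \<zero>) \<otimes>\<^bsub>\<D>\<^esub> dual_eval (indexed_const l) = dual_eval (indexed_const (k \<otimes> l))"
      using Fs(6)[OF k indexed_const] k indexed_const F
      by (auto simp: dual_eval_const dual_numbers_simps subset_iff)
    then show ?case
      using imageI[OF indexed_pset.indexed_const[OF Fs(6)[OF k indexed_const]], of dual_eval] by simp
  next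
    case (indexed_padd P Q)
    then obtain P' Q' where *: "P' \<in> indexed_pset S F" "Q' \<in> indexed_pset S F"
      "(k, \<zero>) \<otimes>\<^bsub>\<D>\<^esub> dual_eval P = dual_eval P'"
      "(k, \<zero>) \<otimes>\<^bsub>\<D>\<^esub> dual_eval Q = dual_eval Q'" by auto
    have "(k, \<zero>) \<otimes>\<^bsub>\<D>\<^esub> dual_eval (indexed_padd P Q) = dual_eval (indexed_padd P' Q')"
      using indexed_padd.hyps * k F dual_eval_closed
      by (subst (1 2) dual_eval_padd) (auto simp: D.r_distr dual_numbers_simps(1) subset_iff)
    then show ?case using * by (auto intro: indexed_pset.indexed_padd)
  next
    case (indexed_pmult P i)
    then obtain P' where *: "P' \<in> indexed_pset S F"
      "(k, \<zero>) \<otimes>\<^bsub>\<D>\<^esub> dual_eval P = dual_eval P'" by auto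
    have cl: "(k, \<zero>) \<in> carrier \<D>" "dual_letter i \<in> carrier \<D>"
      using k F dual_letter_closed[OF indexed_pmult.hyps(2)] by (auto simp: dual_numbers_simps(1))
    have "(k, \<zero>) \<otimes>\<^bsub>\<D>\<^esub> dual_eval (indexed_pmult P i) = dual_eval (indexed_pmult P' i)"
      unfolding dual_eval_pmult[OF indexed_pmult.hyps] dual_eval_pmult[OF *(1) indexed_pmult.hyps(2)]
        *(2)[symmetric]
      using cl dual_eval_closed[OF indexed_pmult.hyps(1)] by (simp only: D.m_assoc)
    then show ?case using * indexed_pmult.hyps(2) by (auto intro: indexed_pset.indexed_pmult)
  qed
  have mult: "dual_eval P \<otimes>\<^bsub>\<D>\<^esub> dual_eval Q \<in> ?\<Gamma>"
    if P: "P \<in> indexed_pset S F" and Q: "Q \<in> indexed_pset S F" for P Q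
    using P
  proof induction
    case (indexed_const k)
    then show ?case using const_mult[OF _ Q] by (simp add: dual_eval_const)
  next
    case (indexed_padd P P')
    then obtain A B where *: "A \<in> indexed_pset S F" "B \<in> indexed_pset S F"
      "dual_eval P \<otimes>\<^bsub>\<D>\<^esub> dual_eval Q = dual_eval A"
      "dual_eval P' \<otimes>\<^bsub>\<D>\<^esub> dual_eval Q = dual_eval B" by auto
    have "dual_eval (indexed_padd P P') \<otimes>\<^bsub>\<D>\<^esub> dual_eval Q = dual_eval (indexed_padd A B)"
      unfolding dual_eval_padd[OF indexed_padd.hyps] dual_eval_padd[OF *(1,2)] *(3,4)[symmetric]
      using dual_eval_closed Q indexed_padd.hyps by (intro D.l_distr) auto
    then show ?case using * by (auto intro: indexed_pset.indexed_padd)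
  next
    case (indexed_pmult P i)
    then obtain A where *: "A \<in> indexed_pset S F"
      "dual_eval P \<otimes>\<^bsub>\<D>\<^esub> dual_eval Q = dual_eval A" by auto
    have cl: "dual_letter i \<in> carrier \<D>"
      by (rule dual_letter_closed[OF indexed_pmult.hyps(2)])
    have "dual_eval (indexed_pmult P i) \<otimes>\<^bsub>\<D>\<^esub> dual_eval Q = dual_eval (indexed_pmult A i)"
      unfolding dual_eval_pmult[OF indexed_pmult.hyps] dual_eval_pmult[OF *(1) indexed_pmult.hyps(2)]
        *(2)[symmetric]
      using cl dual_eval_closed[OF indexed_pmult.hyps(1)] dual_eval_closed[OF Q]
      by (simp only: D.m_assoc D.m_comm)
    then show ?case using * indexed_pmult.hyps(2) by (auto intro: indexed_pset.indexed_pmult)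
  qed
  show ?thesis
  proof (rule D.subringI)
    show "?\<Gamma> \<subseteq> carrier \<D>" using dual_eval_closed by blast
    have "dual_eval (indexed_const \<one>) = \<one>\<^bsub>\<D>\<^esub>"
      using Fs(3) by (simp add: dual_eval_const dual_numbers_simps)
    then show "\<one>\<^bsub>\<D>\<^esub> \<in> ?\<Gamma>"
      using imageI[OF indexed_pset.indexed_const[OF Fs(3), of S], of dual_eval] by simp
  next
    fix h1 h2 assume "h1 \<in> ?\<Gamma>" "h2 \<in> ?\<Gamma>"
    then show "h1 \<otimes>\<^bsub>\<D>\<^esub> h2 \<in> ?\<Gamma>" using mult by blast
  next
    fix h1 h2 assume "h1 \<in> ?\<Gamma>" "h2 \<in> ?\<Gamma>"
    then obtain P Q where "P \<in> indexed_pset S F" "h1 = dual_eval P"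
      "Q \<in> indexed_pset S F" "h2 = dual_eval Q" by blast
    then show "h1 \<oplus>\<^bsub>\<D>\<^esub> h2 \<in> ?\<Gamma>"
      using imageI[OF indexed_pset.indexed_padd, of P S F Q dual_eval] by (simp add: dual_eval_padd)
  next
    fix h assume "h \<in> ?\<Gamma>"
    then obtain P where P: "P \<in> indexed_pset S F" "h = dual_eval P" by blast
    obtain a b where ab: "h = (a, b)" "a \<in> carrier R" "b \<in> carrier R"
      using dual_eval_closed[OF P(1)] P(2) by (auto simp: dual_numbers_simps)
    have "(\<ominus> \<one>, \<zero>) \<otimes>\<^bsub>\<D>\<^esub> h \<in> ?\<Gamma>"
      using const_mult[OF Fs(5)[OF Fs(3)] P(1)] P(2) by simp
    moreover have "\<ominus>\<^bsub>\<D>\<^esub> h = (\<ominus> a, \<ominus> b)"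
      using ab by (intro D.minus_equality) (auto simp: dual_numbers_simps l_neg)
    moreover have "(\<ominus> \<one>, \<zero>) \<otimes>\<^bsub>\<D>\<^esub> h = (\<ominus> a, \<ominus> b)"
      using ab by (simp add: dual_numbers_simps l_minus)
    ultimately show "\<ominus>\<^bsub>\<D>\<^esub> h \<in> ?\<Gamma>" by simp
  qed
qed

end

end

text \<open>If \<open>S\<close> is algebraically independent, a polynomial in \<open>S\<close> is determined by its value, so \<open>\<partial>/\<partial>s\<close> is a well defined
derivation of \<open>F[S]\<close>; it extends to the whole field. These derivations are what makes transcendence
degrees accessible to linear algebra.\<close>

theorem (in field) dual_derivation_exists:
  assumes char: "char_zero R" and F: "subring F R" and S: "alg_independent R F S" and s: "s \<in> S"
  shows "\<exists>D. derivation R F D \<and> D s = \<one> \<and> (\<forall>t\<in>S - {s}. D t = \<zero>)"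
proof -
  interpret D: cring \<D> by (rule dual_numbers_cring)
  have FC: "F \<subseteq> carrier R" and one: "\<one> \<in> F" using subringE[OF F] by auto
  have SC: "S \<subseteq> carrier R" using S by (simp add: alg_independent_def)
  let ?\<Gamma> = "dual_eval s ` indexed_pset S F"
  have func: "x = \<zero>" if "(\<zero>, x) \<in> ?\<Gamma>" for x
  proof -
    from that obtain P where P: "(\<zero>, x) = dual_eval s P" "P \<in> indexed_pset S F" by (rule imageE)
    then have "eval_letters R P = \<zero>"
      using fst_dual_eval[OF FC SC P(2), of s] by (metis P(1) fst_conv)
    then have "P = (\<lambda>_. \<zero>)" using S P(2) by (auto simp: alg_independent_def)
    then have "dual_eval s P = \<zero>\<^bsub>\<D>\<^esub>" by (simp add: dual_eval_def[OF FC SC] D.finsum_empty)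
    then show ?thesis using P(1) by (simp add: dual_numbers_simps)
  qed
  obtain D where D: "derivation R {} D" and D': "\<forall>(a, x)\<in>?\<Gamma>. D a = x"
    using derivation_extends[OF char dual_eval_image_subring[OF FC SC F] func] by blast
  have D\<Gamma>: "D a = x" if "(a, x) \<in> ?\<Gamma>" for a x
    using bspec[OF D' that] by simp
  have const: "D c = \<zero>" if "c \<in> F" for c
    using imageI[OF indexed_pset.indexed_const[OF that], of "dual_eval s" S]
    unfolding dual_eval_const[OF FC SC that] by (rule D\<Gamma>)
  have var: "D t = (if t = s then \<one> else \<zero>)" if t: "t \<in> S" for t
  proof (rule D\<Gamma>)
    have P: "indexed_const \<one> \<in> indexed_pset S F" by (rule indexed_pset.indexed_const[OF one])
    have "dual_eval s (indexed_pmult (indexed_const \<one>) t) = (t, if t = s then \<one> else \<zero>)"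
      unfolding dual_eval_pmult[OF FC SC P t] dual_letter_def[OF FC SC] dual_eval_const[OF FC SC one]
      using t SC by (auto simp: dual_numbers_simps)
    then show "(t, if t = s then \<one> else \<zero>) \<in> ?\<Gamma>"
      using imageI[OF indexed_pset.indexed_pmult[OF P t], of "dual_eval s"] by simp
  qed
  have "derivation R F D" using D const by (simp add: derivation_def)
  then show ?thesis using var s by (intro exI[of _ D]) auto
qed

section \<open>Transcendence degree of a field of constants\<close>

lemma (in cring) derivationD:
  assumes "derivation R F D"
  shows "x \<in> carrier R \<Longrightarrow> D x \<in> carrier R"
    and "x \<in> carrier R \<Longrightarrow> y \<in> carrier R \<Longrightarrow> D (x \<oplus> y) = D x \<oplus> D y"
    and "x \<in> carrier R \<Longrightarrow> y \<in> carrier R \<Longrightarrow> D (x \<otimes> y) = x \<otimes> D y \<oplus> D x \<otimes> y"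
    and "c \<in> F \<Longrightarrow> D c = \<zero>"
    and "D \<zero> = \<zero>" and "D \<one> = \<zero>" and "x \<in> carrier R \<Longrightarrow> D (\<ominus> x) = \<ominus> D x"
proof -
  have cl: "\<And>x. x \<in> carrier R \<Longrightarrow> D x \<in> carrier R"
    and add: "\<And>x y. x \<in> carrier R \<Longrightarrow> y \<in> carrier R \<Longrightarrow> D (x \<oplus> y) = D x \<oplus> D y"
    and mult: "\<And>x y. x \<in> carrier R \<Longrightarrow> y \<in> carrier R \<Longrightarrow> D (x \<otimes> y) = x \<otimes> D y \<oplus> D x \<otimes> y"
    and "\<And>c. c \<in> F \<Longrightarrow> D c = \<zero>"
    using assms by (auto simp: derivation_def)
  then show "x \<in> carrier R \<Longrightarrow> D x \<in> carrier R"
    and "x \<in> carrier R \<Longrightarrow> y \<in> carrier R \<Longrightarrow> D (x \<oplus> y) = D x \<oplus> D y"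
    and "x \<in> carrier R \<Longrightarrow> y \<in> carrier R \<Longrightarrow> D (x \<otimes> y) = x \<otimes> D y \<oplus> D x \<otimes> y"
    and "c \<in> F \<Longrightarrow> D c = \<zero>" by blast+
  have "D \<zero> \<oplus> D \<zero> = D \<zero> \<oplus> \<zero>" using add[of \<zero> \<zero>] cl[of \<zero>] by simp
  then show D0: "D \<zero> = \<zero>" using cl[of \<zero>] by (simp only: add.l_cancel zero_closed)
  have "D \<one> \<oplus> D \<one> = D \<one> \<oplus> \<zero>" using mult[of \<one> \<one>] cl[of \<one>] by simp
  then show "D \<one> = \<zero>" using cl[of \<one>] by (simp only: add.l_cancel zero_closed one_closed)
  show "D (\<ominus> x) = \<ominus> D x" if x: "x \<in> carrier R"
    using add[of "\<ominus> x" x] D0 cl[of x] cl[of "\<ominus> x"] x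
    by (simp add: l_neg minus_equality)
qed

lemma (in cring) derivation_lincomb:
  assumes "derivation R F D" "derivation R F E" "c \<in> carrier R" "F \<subseteq> carrier R"
  shows "derivation R F (\<lambda>x. D x \<oplus> c \<otimes> E x)"
  unfolding derivation_def
  using derivationD[OF assms(1)] derivationD[OF assms(2)] assms(3,4)
  by (auto simp: r_distr l_distr a_ac m_ac)

text \<open>Fewer linear conditions than independent elements: some combination of the dual derivations satisfies
all conditions and is still nonzero on one of the elements. The proof is Gaussian elimination, one
condition at a time: \<open>L\<close> shrinks to the derivations that satisfy the condition, and at most one element
of \<open>S\<close> is given up.\<close>

lemma (in field) linear_functionals_killed:
  assumes "finite I" "finite S" "card I < card S"
    and closed: "\<And>D E c. D \<in> L \<Longrightarrow> E \<in> L \<Longrightarrow> c \<in> carrier R \<Longrightarrow> (\<lambda>x. D x \<oplus> c \<otimes> E x) \<in> L"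
    and val: "\<And>D s. D \<in> L \<Longrightarrow> s \<in> S \<Longrightarrow> D s \<in> carrier R"
    and \<phi>_cl: "\<And>i D. i \<in> I \<Longrightarrow> D \<in> L \<Longrightarrow> \<phi> i D \<in> carrier R"
    and \<phi>_lin: "\<And>i D E c. i \<in> I \<Longrightarrow> D \<in> L \<Longrightarrow> E \<in> L \<Longrightarrow> c \<in> carrier R \<Longrightarrow>
        \<phi> i (\<lambda>x. D x \<oplus> c \<otimes> E x) = \<phi> i D \<oplus> c \<otimes> \<phi> i E"
    and dual: "\<And>s. s \<in> S \<Longrightarrow> \<exists>D\<in>L. D s = \<one> \<and> (\<forall>t\<in>S - {s}. D t = \<zero>)"
  shows "\<exists>D\<in>L. (\<forall>i\<in>I. \<phi> i D = \<zero>) \<and> (\<exists>s\<in>S. D s \<noteq> \<zero>)"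
  using assms
proof (induction I arbitrary: S L rule: finite_induct)
  case empty
  then obtain s where "s \<in> S" by fastforce
  then show ?case using empty.prems(7)[of s] by force
next
  case (insert i I)
  note closed = insert.prems(3) and val = insert.prems(4) and cl = insert.prems(5)
    and lin = insert.prems(6) and dual = insert.prems(7)
  define L' where "L' = {D \<in> L. \<phi> i D = \<zero>}"
  have closed': "(\<lambda>x. D x \<oplus> c \<otimes> E x) \<in> L'" if "D \<in> L'" "E \<in> L'" "c \<in> carrier R" for D E c
    using that closed lin by (auto simp: L'_def)
  have "\<exists>S'\<subseteq>S. card I < card S' \<and> (\<forall>s\<in>S'. \<exists>D\<in>L'. D s = \<one> \<and> (\<forall>t\<in>S' - {s}. D t = \<zero>))"
  proof (cases "\<exists>s\<in>S. \<exists>D\<in>L. \<phi> i D \<noteq> \<zero> \<and> D s = \<one> \<and> (\<forall>t\<in>S - {s}. D t = \<zero>)")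
    case False
    then have "\<forall>s\<in>S. \<exists>D\<in>L'. D s = \<one> \<and> (\<forall>t\<in>S - {s}. D t = \<zero>)"
      using dual unfolding L'_def by blast
    then show ?thesis using insert.prems(2) insert.hyps by auto
  next
    case True
    then obtain s0 D0 where s0: "s0 \<in> S" and D0: "D0 \<in> L" "\<phi> i D0 \<noteq> \<zero>"
      "\<forall>t\<in>S - {s0}. D0 t = \<zero>" by blast
    have u: "\<phi> i D0 \<in> Units R" using cl[of i D0] D0 by (simp add: field_Units)
    have "\<exists>D\<in>L'. D s = \<one> \<and> (\<forall>t\<in>(S - {s0}) - {s}. D t = \<zero>)" if s: "s \<in> S - {s0}" for s
    proof -
      obtain D where D: "D \<in> L" "D s = \<one>" "\<forall>t\<in>S - {s}. D t = \<zero>" using dual s by blast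
      \<comment> \<open>\<open>D + c D0\<close> satisfies the condition \<open>i\<close>, and agrees with \<open>D\<close> on \<open>S - {s0}\<close>.\<close>
      define c where "c = \<ominus> (\<phi> i D \<otimes> inv (\<phi> i D0))"
      have D_cl: "\<phi> i D \<in> carrier R" using cl D by auto
      have c: "c \<in> carrier R" using u D_cl by (simp add: c_def)
      have "c \<otimes> \<phi> i D0 = \<ominus> \<phi> i D"
        using u D_cl cl[of i D0] D0(1) l_minus[of "\<phi> i D \<otimes> inv (\<phi> i D0)" "\<phi> i D0"]
        by (simp add: c_def m_assoc)
      then have "\<phi> i (\<lambda>x. D x \<oplus> c \<otimes> D0 x) = \<zero>"
        using lin[of i D D0 c] D(1) D0(1) c D_cl by (simp add: r_neg)
      then have "(\<lambda>x. D x \<oplus> c \<otimes> D0 x) \<in> L'" using closed D D0 c by (simp add: L'_def)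
      then show ?thesis
        using D D0 s c by (intro bexI[of _ "\<lambda>x. D x \<oplus> c \<otimes> D0 x"]) auto
    qed
    moreover have "card I < card (S - {s0})"
      using insert.prems(1,2) insert.hyps s0 by simp
    ultimately show ?thesis by (intro exI[of _ "S - {s0}"]) auto
  qed
  then obtain S' where S': "S' \<subseteq> S" "card I < card S'"
    "\<And>s. s \<in> S' \<Longrightarrow> \<exists>D\<in>L'. D s = \<one> \<and> (\<forall>t\<in>S' - {s}. D t = \<zero>)" by blast
  have "\<exists>D\<in>L'. (\<forall>i\<in>I. \<phi> i D = \<zero>) \<and> (\<exists>s\<in>S'. D s \<noteq> \<zero>)"
  proof (rule insert.IH)
    show "finite S'" using S'(1) insert.prems(1) finite_subset by blast
    show "card I < card S'" by (rule S'(2))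
  qed (use closed' S' cl lin val in \<open>auto simp: L'_def\<close>)
  then show ?case using S'(1) by (auto simp: L'_def)
qed

text \<open>In characteristic \<open>0\<close> this is the algebraic closure of \<open>F(P)\<close> in \<open>R\<close>. The description by derivations turns
bounds on its transcendence degree into linear algebra.\<close>

definition constant_field :: "('b, 'm) ring_scheme \<Rightarrow> 'b set \<Rightarrow> 'b set \<Rightarrow> 'b set" where
  "constant_field R F P =
    {x \<in> carrier R. \<forall>D. derivation R F D \<and> (\<forall>p\<in>P. D p = \<zero>\<^bsub>R\<^esub>) \<longrightarrow> D x = \<zero>\<^bsub>R\<^esub>}"

lemma (in field) constant_field_subfield: "subfield (constant_field R F P) R"
proof (rule subfieldI')
  show "subring (constant_field R F P) R"
  proof (rule subringI)
    fix h assume h: "h \<in> constant_field R F P"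
    then show "\<ominus> h \<in> constant_field R F P"
      unfolding constant_field_def by (force simp: derivationD)
    fix h' assume h': "h' \<in> constant_field R F P"
    have hC: "h \<in> carrier R" "h' \<in> carrier R" using h h' by (auto simp: constant_field_def)
    have "D (h \<otimes> h') = \<zero> \<and> D (h \<oplus> h') = \<zero>" if D: "derivation R F D" "\<forall>p\<in>P. D p = \<zero>" for D
    proof -
      have "D h = \<zero>" "D h' = \<zero>" using h h' D by (auto simp: constant_field_def)
      then show ?thesis using hC by (simp add: derivationD[OF D(1)])
    qed
    then show "h \<otimes> h' \<in> constant_field R F P" "h \<oplus> h' \<in> constant_field R F P"
      using hC by (auto simp: constant_field_def)
  qed (auto simp: constant_field_def derivationD)
  fix x assume x: "x \<in> constant_field R F P - {\<zero>}"
  then have xC: "x \<in> carrier R" and xU: "x \<in> Units R"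
    by (auto simp: constant_field_def field_Units)
  have "D (inv x) = \<zero>" if D: "derivation R F D" "\<forall>p\<in>P. D p = \<zero>" for D
  proof -
    have "D x = \<zero>" using x D by (auto simp: constant_field_def)
    then have "x \<otimes> D (inv x) = \<zero>"
      using derivationD(3)[OF D(1), of x "inv x"] derivationD(6)[OF D(1)] derivationD(1)[OF D(1), of "inv x"] xU xC by simp
    then show ?thesis
      using integral[of x "D (inv x)"] x xC xU derivationD(1)[OF D(1), of "inv x"] by auto
  qed
  then show "inv x \<in> constant_field R F P" using xU by (simp add: constant_field_def)
qed

lemma constant_field_contains:
  assumes "F \<subseteq> carrier R" "P \<subseteq> carrier R"
  shows "F \<subseteq> constant_field R F P" "P \<subseteq> constant_field R F P"
  using assms by (auto simp: constant_field_def derivation_def)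

context field
begin

context
  fixes L assumes L: "subring L R"
begin

lemma subring_id_hom: "ring_hom_cring (R\<lparr>carrier := L\<rparr>) R (\<lambda>x. x)"
proof -
  have "cring (R\<lparr>carrier := L\<rparr>)" using subring_is_domain[OF L] by (rule domain.axioms(1))
  then show ?thesis
    by (intro ring_hom_cring.intro ring_hom_cring_axioms.intro is_cring)
      (use subringE(1)[OF L] in \<open>auto intro!: ring_hom_memI\<close>)
qed

lemma subring_finsum: "f \<in> A \<rightarrow> L \<Longrightarrow> finsum (R\<lparr>carrier := L\<rparr>) f A = finsum R f A"
  using ring_hom_cring.hom_finsum[OF subring_id_hom, of f A] by (simp add: comp_def)

lemma subring_finprod: "f \<in> A \<rightarrow> L \<Longrightarrow> finprod (R\<lparr>carrier := L\<rparr>) f A = finprod R f A"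
  using ring_hom_cring.hom_finprod[OF subring_id_hom, of f A] by (simp add: comp_def)

lemma alg_independent_subring:
  assumes F: "F \<subseteq> L" and S: "alg_independent (R\<lparr>carrier := L\<rparr>) F S"
  shows "alg_independent R F S"
proof -
  let ?L = "R\<lparr>carrier := L\<rparr>"
  have LC: "L \<subseteq> carrier R" by (rule subringE(1)[OF L])
  interpret L: ring ?L by (rule cring.axioms(1)[OF domain.axioms(1)[OF subring_is_domain[OF L]]])
  have SL: "S \<subseteq> L" using S by (simp add: alg_independent_def)
  have zero: "\<zero>\<^bsub>?L\<^esub> = \<zero>" by simp
  have pset: "P \<in> L.indexed_pset S F" if "P \<in> indexed_pset S F" for P
    using that
  proof induction
    case (indexed_const k)
    show ?case using L.indexed_pset.indexed_const[OF indexed_const, of S]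
      unfolding indexed_const_def L.indexed_const_def zero .
  next
    case (indexed_padd P Q)
    show ?case using L.indexed_pset.indexed_padd[OF indexed_padd.IH]
      unfolding indexed_padd_def L.indexed_padd_def by simp
  next
    case (indexed_pmult P i)
    show ?case using L.indexed_pset.indexed_pmult[OF indexed_pmult.IH indexed_pmult.hyps(2)]
      unfolding indexed_pmult_def L.indexed_pmult_def zero .
  qed
  have eval: "eval_letters ?L P = eval_letters R P" if P: "P \<in> indexed_pset S F" for P
  proof -
    note sP = L.indexed_pset_support[OF pset[OF P], simplified, OF F]
    have pow: "x [^]\<^bsub>?L\<^esub> (n::nat) = x [^] n" for x n
      by (simp add: nat_pow_def)
    have pow_cl: "x [^] (n::nat) \<in> L" if "x \<in> L" for x n
      using L.nat_pow_closed[of x n] that by (simp add: pow)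
    have prod: "(\<Otimes>\<^bsub>?L\<^esub>x\<in>set_mset m. x [^]\<^bsub>?L\<^esub> count m x) = (\<Otimes>x\<in>set_mset m. x [^] count m x)"
      if "set_mset m \<subseteq> S" for m
      unfolding pow by (rule subring_finprod) (use that SL pow_cl in auto)
    have prod_cl: "(\<Otimes>\<^bsub>?L\<^esub>x\<in>set_mset m. x [^]\<^bsub>?L\<^esub> count m x) \<in> L" if "set_mset m \<subseteq> S" for m
      using comm_monoid.finprod_closed[OF cring.axioms(2)[OF domain.axioms(1)[OF subring_is_domain[OF L]]],
          of "\<lambda>x. x [^]\<^bsub>?L\<^esub> count m x" "set_mset m"] that SL pow_cl
      by (auto simp: pow)
    have prod_cl': "(\<Otimes>x\<in>set_mset m. x [^] count m x) \<in> carrier R" if "set_mset m \<subseteq> S" for m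
      using prod_cl[OF that] LC unfolding prod[OF that] by blast
    have "eval_letters ?L P =
      (\<Oplus>\<^bsub>?L\<^esub>m\<in>{m. P m \<noteq> \<zero>}. P m \<otimes> (\<Otimes>\<^bsub>?L\<^esub>x\<in>set_mset m. x [^]\<^bsub>?L\<^esub> count m x))"
      by (simp add: eval_letters_def)
    also have "\<dots> = (\<Oplus>m\<in>{m. P m \<noteq> \<zero>}. P m \<otimes> (\<Otimes>\<^bsub>?L\<^esub>x\<in>set_mset m. x [^]\<^bsub>?L\<^esub> count m x))"
      by (rule subring_finsum) (use sP prod_cl subringE(6)[OF L] in auto)
    also have "\<dots> = eval_letters R P"
      unfolding eval_letters_def
      by (rule finsum_cong') (use sP prod prod_cl' LC in \<open>auto intro!: m_closed\<close>)
    finally show ?thesis .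
  qed
  show ?thesis
    unfolding alg_independent_def
  proof (intro conjI ballI impI)
    show "S \<subseteq> carrier R" using SL LC by blast
    fix P assume P: "P \<in> indexed_pset S F" and "eval_letters R P = \<zero>"
    then have "eval_letters ?L P = \<zero>\<^bsub>?L\<^esub>" using eval by simp
    moreover have "\<forall>P\<in>L.indexed_pset S F. eval_letters ?L P = \<zero>\<^bsub>?L\<^esub> \<longrightarrow> P = (\<lambda>_. \<zero>\<^bsub>?L\<^esub>)"
      using S unfolding alg_independent_def by blast
    ultimately show "P = (\<lambda>_. \<zero>)" using pset[OF P] by simp
  qed
qed

end

text \<open>If the vanishing of the linear functionals \<open>\<phi> i\<close> on a derivation forces it to kill \<open>P\<close>, then there are at
most \<open>card I\<close> algebraically independent elements of the field of constants: by
\<open>linear_functionals_killed\<close>, more of them would admit a derivation that kills \<open>P\<close>, hence the field of constants,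
but not all of these elements.\<close>

lemma trdeg_constant_field:
  assumes char: "char_zero R" and F: "subring F R" and P: "P \<subseteq> carrier R" and I: "finite I"
    and \<phi>_cl: "\<And>i D. i \<in> I \<Longrightarrow> derivation R F D \<Longrightarrow> \<phi> i D \<in> carrier R"
    and \<phi>_lin: "\<And>i D E c. i \<in> I \<Longrightarrow> derivation R F D \<Longrightarrow> derivation R F E \<Longrightarrow> c \<in> carrier R \<Longrightarrow>
        \<phi> i (\<lambda>x. D x \<oplus> c \<otimes> E x) = \<phi> i D \<oplus> c \<otimes> \<phi> i E"
    and rigid: "\<And>D p. derivation R F D \<Longrightarrow> \<forall>i\<in>I. \<phi> i D = \<zero> \<Longrightarrow> p \<in> P \<Longrightarrow> D p = \<zero>"
  shows "trdeg (R\<lparr>carrier := constant_field R F P\<rparr>) F \<le> enat (card I)"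
  unfolding trdeg_def
proof (rule SUP_least)
  let ?L = "constant_field R F P"
  have FC: "F \<subseteq> carrier R" by (rule subringE(1)[OF F])
  have L: "subring ?L R" by (rule subfieldE(1)[OF constant_field_subfield])
  fix S assume "S \<in> {S. finite S \<and> alg_independent (R\<lparr>carrier := ?L\<rparr>) F S}"
  then have S: "finite S" and SL: "S \<subseteq> ?L" and indep: "alg_independent R F S"
    using alg_independent_subring[OF L constant_field_contains(1)[OF FC P]]
    by (auto simp: alg_independent_def)
  have "card S \<le> card I"
  proof (rule ccontr)
    assume "\<not> card S \<le> card I"
    then have less: "card I < card S" by simp
    have "\<exists>D\<in>{D. derivation R F D}. (\<forall>i\<in>I. \<phi> i D = \<zero>) \<and> (\<exists>s\<in>S. D s \<noteq> \<zero>)"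
    proof (rule linear_functionals_killed[OF I S less])
      show "\<exists>D\<in>{D. derivation R F D}. D s = \<one> \<and> (\<forall>t\<in>S - {s}. D t = \<zero>)" if "s \<in> S" for s
        using dual_derivation_exists[OF char F indep that] by blast
      show "D s \<in> carrier R" if "D \<in> {D. derivation R F D}" "s \<in> S" for D s
        using that SL derivationD(1) by (auto simp: constant_field_def)
    qed (use \<phi>_cl \<phi>_lin derivation_lincomb[OF _ _ _ FC] in auto)
    then obtain D s where D: "derivation R F D" "\<forall>i\<in>I. \<phi> i D = \<zero>" "s \<in> S" "D s \<noteq> \<zero>" by blast
    then have "\<forall>p\<in>P. D p = \<zero>" using rigid by blast
    then show False using D SL by (auto simp: constant_field_def)
  qed
  then show "enat (card S) \<le> enat (card I)" by simp
qed

end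

section \<open>Coordinates in a vector space\<close>

context vectorspace
begin

lemma lincomb_unique:
  assumes B: "finite B" "B \<subseteq> carrier V" "lin_indpt B"
    and a: "a \<in> B \<rightarrow> carrier K" and b: "b \<in> B \<rightarrow> carrier K" and eq: "lincomb a B = lincomb b B"
    and v: "v \<in> B"
  shows "a v = b v"
proof -
  have "lincomb (\<lambda>v. a v \<ominus>\<^bsub>K\<^esub> b v) B = lincomb a B \<ominus>\<^bsub>V\<^esub> lincomb b B"
    by (rule lincomb_diff[OF B(1,2) a b])
  also have "\<dots> = \<zero>\<^bsub>V\<^esub>"
    unfolding eq using lincomb_closed[OF B(2) b] by (simp add: a_minus_def M.r_neg)
  finally have "(\<lambda>v. a v \<ominus>\<^bsub>K\<^esub> b v) \<in> B \<rightarrow> {\<zero>\<^bsub>K\<^esub>}"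
    by (intro not_lindepD[OF B(3) B(1) subset_refl]) (use a b in auto)
  then have "a v \<ominus>\<^bsub>K\<^esub> b v = \<zero>\<^bsub>K\<^esub>" using v by auto
  moreover have "a v \<in> carrier K" "b v \<in> carrier K" using a b v by auto
  ultimately show ?thesis by (simp add: R.r_right_minus_eq)
qed

text \<open>For \<open>w \<notin> span B\<close> the value is arbitrary.\<close>

definition coord :: "'c set \<Rightarrow> 'c \<Rightarrow> 'c \<Rightarrow> 'a" where
  "coord B w = (SOME a. a \<in> B \<rightarrow> carrier K \<and> lincomb a B = w)"

lemma coord_spec:
  assumes "finite B" "B \<subseteq> carrier V" "w \<in> span B"
  shows "coord B w \<in> B \<rightarrow> carrier K" "lincomb (coord B w) B = w"
proof -
  have "\<exists>a. a \<in> B \<rightarrow> carrier K \<and> lincomb a B = w" by (rule finite_in_span[OF assms])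
  from someI_ex[OF this] show "coord B w \<in> B \<rightarrow> carrier K" "lincomb (coord B w) B = w"
    unfolding coord_def by auto
qed

lemma lincomb_in_span:
  assumes "finite B" "B \<subseteq> carrier V" "a \<in> B \<rightarrow> carrier K"
  shows "lincomb a B \<in> span B"
  unfolding finite_span[OF assms(1,2)] using assms(3) by blast

context
  fixes B assumes B: "finite B" "B \<subseteq> carrier V" "lin_indpt B"
begin

lemma coord_cl: "w \<in> span B \<Longrightarrow> b \<in> B \<Longrightarrow> coord B w b \<in> carrier K"
  using coord_spec(1)[OF B(1,2)] by blast

lemma coord_lincomb:
  assumes "a \<in> B \<rightarrow> carrier K" "b \<in> B"
  shows "coord B (lincomb a B) b = a b"
  using coord_spec[OF B(1,2) lincomb_in_span[OF B(1,2) assms(1)]] assms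
  by (intro lincomb_unique[OF B]) auto

lemma coord_add:
  assumes "v \<in> span B" "w \<in> span B" "b \<in> B"
  shows "coord B (v \<oplus>\<^bsub>V\<^esub> w) b = coord B v b \<oplus>\<^bsub>K\<^esub> coord B w b"
proof -
  note v = coord_spec[OF B(1,2) assms(1)] and w = coord_spec[OF B(1,2) assms(2)]
  have "v \<oplus>\<^bsub>V\<^esub> w = lincomb (\<lambda>b. coord B v b \<oplus>\<^bsub>K\<^esub> coord B w b) B"
    using lincomb_sum[OF B(1,2) v(1) w(1)] v(2) w(2) by simp
  then show ?thesis using coord_lincomb[of "\<lambda>b. coord B v b \<oplus>\<^bsub>K\<^esub> coord B w b" b] v w assms(3)
    by (auto simp: Pi_def)
qed

lemma coord_smult:
  assumes "v \<in> span B" "c \<in> carrier K" "b \<in> B"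
  shows "coord B (c \<odot>\<^bsub>V\<^esub> v) b = c \<otimes>\<^bsub>K\<^esub> coord B v b"
proof -
  note v = coord_spec[OF B(1,2) assms(1)]
  have "c \<odot>\<^bsub>V\<^esub> v = lincomb (\<lambda>b. c \<otimes>\<^bsub>K\<^esub> coord B v b) B"
    using lincomb_smult[OF B(2) v(1) assms(2)] v(2) by simp
  then show ?thesis using coord_lincomb[of "\<lambda>b. c \<otimes>\<^bsub>K\<^esub> coord B v b" b] v assms(2,3)
    by (auto simp: Pi_def)
qed

lemma lincomb_single:
  assumes "v \<in> B" "c \<in> carrier K"
  shows "lincomb (\<lambda>b. if b = v then c else \<zero>\<^bsub>K\<^esub>) B = c \<odot>\<^bsub>V\<^esub> v"
proof -
  have "lincomb (\<lambda>b. if b = v then c else \<zero>\<^bsub>K\<^esub>) B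
      = (\<Oplus>\<^bsub>V\<^esub>b\<in>B. if v = b then c \<odot>\<^bsub>V\<^esub> b else \<zero>\<^bsub>V\<^esub>)"
    unfolding lincomb_def
    by (rule M.finsum_cong') (use assms B in \<open>auto simp: subset_iff\<close>)
  also have "\<dots> = c \<odot>\<^bsub>V\<^esub> v"
    by (rule M.add.finprod_singleton) (use assms B in auto)
  finally show ?thesis .
qed

lemma coord_basis:
  assumes "v \<in> B" "b \<in> B"
  shows "coord B v b = (if b = v then \<one>\<^bsub>K\<^esub> else \<zero>\<^bsub>K\<^esub>)"
  using coord_lincomb[of "\<lambda>b. if b = v then \<one>\<^bsub>K\<^esub> else \<zero>\<^bsub>K\<^esub>" b] lincomb_single[OF assms(1), of "\<one>\<^bsub>K\<^esub>"]
    assms B(2) by auto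

end

lemma lin_indpt_insert:
  assumes "A \<subseteq> carrier V" "lin_indpt A" "v \<in> carrier V" "v \<notin> span A"
  shows "lin_indpt (insert v A)"
proof -
  have "v \<notin> A" using in_own_span[OF assms(1)] assms(4) by blast
  then show ?thesis using lin_dep_iff_in_span[OF assms(1-3)] assms(4) by simp
qed

lemma lin_indpt_empty: "lin_indpt {}"
  by (rule finite_lin_indpt2) auto

lemma subspaceD:
  assumes "subspace K W V"
  shows "W \<subseteq> carrier V" "\<zero>\<^bsub>V\<^esub> \<in> W" "\<And>v w. v \<in> W \<Longrightarrow> w \<in> W \<Longrightarrow> v \<oplus>\<^bsub>V\<^esub> w \<in> W"
    "\<And>c v. c \<in> carrier K \<Longrightarrow> v \<in> W \<Longrightarrow> c \<odot>\<^bsub>V\<^esub> v \<in> W"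
    "\<And>A f. f \<in> A \<rightarrow> W \<Longrightarrow> finsum V f A \<in> W"
    "\<And>A. A \<subseteq> W \<Longrightarrow> span A \<subseteq> W"
proof -
  have s: "LinearCombinations.submodule K W V" using assms by (simp add: subspace_def)
  then show 1: "W \<subseteq> carrier V" "\<zero>\<^bsub>V\<^esub> \<in> W" "\<And>v w. v \<in> W \<Longrightarrow> w \<in> W \<Longrightarrow> v \<oplus>\<^bsub>V\<^esub> w \<in> W"
    "\<And>c v. c \<in> carrier K \<Longrightarrow> v \<in> W \<Longrightarrow> c \<odot>\<^bsub>V\<^esub> v \<in> W"
    by (auto simp: LinearCombinations.submodule_def)
  show "finsum V f A \<in> W" if "f \<in> A \<rightarrow> W" for f A
    using that
  proof (induction A rule: infinite_finite_induct)
    case (insert x A)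
    then have "f x \<in> W" "f \<in> A \<rightarrow> W" by auto
    then have "finsum V f (insert x A) = f x \<oplus>\<^bsub>V\<^esub> finsum V f A"
      using insert.hyps 1(1) by (subst M.finsum_insert) auto
    then show ?case using insert.IH \<open>f x \<in> W\<close> \<open>f \<in> A \<rightarrow> W\<close> 1(3) by simp
  qed (use 1(2) in auto)
  show "span A \<subseteq> W" if "A \<subseteq> W" for A by (rule span_is_subset[OF that s])
qed

lemma subspaceI:
  assumes "W \<subseteq> carrier V" "\<zero>\<^bsub>V\<^esub> \<in> W" "\<And>v w. v \<in> W \<Longrightarrow> w \<in> W \<Longrightarrow> v \<oplus>\<^bsub>V\<^esub> w \<in> W"
    "\<And>c v. c \<in> carrier K \<Longrightarrow> v \<in> W \<Longrightarrow> c \<odot>\<^bsub>V\<^esub> v \<in> W"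
  shows "subspace K W V"
  unfolding subspace_def LinearCombinations.submodule_def
  using assms vectorspace_axioms module_axioms by auto

lemma additive_finsum:
  assumes W: "subspace K W V" and "finite A" and g: "g \<in> A \<rightarrow> W"
    and f_cl: "\<And>w. w \<in> W \<Longrightarrow> f w \<in> carrier V"
    and f_add: "\<And>v w. v \<in> W \<Longrightarrow> w \<in> W \<Longrightarrow> f (v \<oplus>\<^bsub>V\<^esub> w) = f v \<oplus>\<^bsub>V\<^esub> f w"
  shows "f (finsum V g A) = (\<Oplus>\<^bsub>V\<^esub>x\<in>A. f (g x))"
  using assms(2) g
proof induction
  case empty
  have "f \<zero>\<^bsub>V\<^esub> \<oplus>\<^bsub>V\<^esub> f \<zero>\<^bsub>V\<^esub> = f \<zero>\<^bsub>V\<^esub> \<oplus>\<^bsub>V\<^esub> \<zero>\<^bsub>V\<^esub>"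
    using f_add[of "\<zero>\<^bsub>V\<^esub>" "\<zero>\<^bsub>V\<^esub>"] f_cl[of "\<zero>\<^bsub>V\<^esub>"] subspaceD(2)[OF W] by simp
  then show ?case
    using f_cl[OF subspaceD(2)[OF W]] by (simp only: M.add.l_cancel M.zero_closed M.finsum_empty)
next
  case (insert x A)
  then have gx: "g x \<in> W" "g \<in> A \<rightarrow> W" by auto
  have cl: "g x \<in> carrier V" "g \<in> A \<rightarrow> carrier V" using gx subspaceD(1)[OF W] by auto
  have "f (finsum V g (insert x A)) = f (g x \<oplus>\<^bsub>V\<^esub> finsum V g A)"
    using insert.hyps cl by simp
  also have "\<dots> = f (g x) \<oplus>\<^bsub>V\<^esub> f (finsum V g A)"
    by (rule f_add[OF gx(1) subspaceD(5)[OF W gx(2)]])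
  also have "\<dots> = (\<Oplus>\<^bsub>V\<^esub>x\<in>insert x A. f (g x))"
    using insert.IH[OF gx(2)] insert.hyps f_cl gx by (subst M.finsum_insert) auto
  finally show ?case .
qed

lemma finsum_smult:
  assumes "finite A" "c \<in> carrier K" "f \<in> A \<rightarrow> carrier V"
  shows "c \<odot>\<^bsub>V\<^esub> finsum V f A = (\<Oplus>\<^bsub>V\<^esub>x\<in>A. c \<odot>\<^bsub>V\<^esub> f x)"
  by (rule finsum_smult_ldistr[OF assms(1,2)]) (use assms in auto)

lemma finsum_const_smult:
  assumes "finite A" "d \<in> carrier K" "w \<in> carrier V"
  shows "(\<Oplus>\<^bsub>V\<^esub>h\<in>A. d \<odot>\<^bsub>V\<^esub> w) = add_pow K (card A) d \<odot>\<^bsub>V\<^esub> w"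
  using assms(1)
proof induction
  case (insert x A)
  then show ?case using assms by (simp add: smult_l_distr M.a_comm)
qed (use assms in simp)

lemma lin_indpt_Un:
  assumes A: "finite A" "A \<subseteq> carrier V" "lin_indpt A" and B: "finite B" "B \<subseteq> carrier V" "lin_indpt B"
    and AB: "span A \<inter> span B \<subseteq> {\<zero>\<^bsub>V\<^esub>}"
  shows "A \<inter> B = {}" "lin_indpt (A \<union> B)"
proof -
  show disj: "A \<inter> B = {}"
    using in_own_span[OF A(2)] in_own_span[OF B(2)] AB vs_zero_lin_dep[OF A(2,3)] by blast
  show "lin_indpt (A \<union> B)"
  proof (rule finite_lin_indpt2)
    fix a assume a: "a \<in> A \<union> B \<rightarrow> carrier K" and 0: "lincomb a (A \<union> B) = \<zero>\<^bsub>V\<^esub>"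
    have aA: "a \<in> A \<rightarrow> carrier K" and aB: "a \<in> B \<rightarrow> carrier K" using a by auto
    note cl = lincomb_closed[OF A(2) aA] lincomb_closed[OF B(2) aB]
    have sum: "lincomb a A \<oplus>\<^bsub>V\<^esub> lincomb a B = \<zero>\<^bsub>V\<^esub>"
      using 0 lincomb_union[OF A(2) B(2) disj A(1) B(1) a] by simp
    then have "lincomb a A = \<ominus>\<^bsub>V\<^esub> lincomb a B"
      using cl by (metis M.minus_equality)
    moreover have "\<ominus>\<^bsub>V\<^esub> lincomb a B \<in> span B"
      by (rule span_neg[OF B(2) lincomb_in_span[OF B(1,2) aB]])
    ultimately have A0: "lincomb a A = \<zero>\<^bsub>V\<^esub>"
      using AB lincomb_in_span[OF A(1,2) aA] by auto
    then have B0: "lincomb a B = \<zero>\<^bsub>V\<^esub>" using sum cl by simp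
    show "\<forall>v\<in>A \<union> B. a v = \<zero>\<^bsub>K\<^esub>"
      using not_lindepD[OF A(3,1) subset_refl aA A0] not_lindepD[OF B(3,1) subset_refl aB B0] by auto
  qed (use A B in auto)
qed

lemma card_lin_indpt_le:
  assumes "finite A" "finite B" "B \<subseteq> carrier V" "lin_indpt A" "A \<subseteq> span B"
  shows "card A \<le> card B"
  using replacement[OF assms] by linarith

text \<open>The size of independent sets is bounded by the dimension, so there is a maximal one between \<open>A\<close> and \<open>W\<close>; it
spans \<open>W\<close>.\<close>

lemma subspace_has_basis:
  assumes fd: "fin_dim" and W: "subspace K W V"
    and A: "A \<subseteq> W" "lin_indpt A"
  shows "\<exists>B. A \<subseteq> B \<and> finite B \<and> B \<subseteq> W \<and> lin_indpt B \<and> span B = W"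
proof -
  note WC = subspaceD(1)[OF W]
  let ?P = "\<lambda>B. A \<subseteq> B \<and> B \<subseteq> W \<and> lin_indpt B"
  obtain B where B: "finite B" "maximal B ?P"
    using maximal_exists[of ?P dim A] li_le_dim[OF fd] A WC by blast
  have BP: "?P B" and max: "\<And>B'. B \<subseteq> B' \<Longrightarrow> ?P B' \<Longrightarrow> B' = B"
    using B(2) by (auto simp: maximal_def)
  have "w \<in> span B" if w: "w \<in> W" for w
  proof (rule ccontr)
    assume n: "w \<notin> span B"
    have "lin_indpt (insert w B)" using lin_indpt_insert BP WC w n by blast
    then have "insert w B = B" using max[of "insert w B"] BP w by blast
    then show False using n in_own_span[of B] BP WC by blast
  qed
  then have "span B = W" using subspaceD(6)[OF W] BP by blast
  then show ?thesis using BP B(1) by blast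
qed

end

section \<open>Finite groups acting linearly\<close>

locale linear_action = vectorspace K V + G: group G
  for K :: "('a, 'm) ring_scheme" and V :: "('a, 'c, 'd) module_scheme" and G :: "('g, 'h) monoid_scheme" +
  fixes act :: "'g \<Rightarrow> 'c \<Rightarrow> 'c"
  assumes finite_group: "finite (carrier G)"
    and act_closed: "g \<in> carrier G \<Longrightarrow> v \<in> carrier V \<Longrightarrow> act g v \<in> carrier V"
    and act_add: "g \<in> carrier G \<Longrightarrow> v \<in> carrier V \<Longrightarrow> w \<in> carrier V \<Longrightarrow>
      act g (v \<oplus>\<^bsub>V\<^esub> w) = act g v \<oplus>\<^bsub>V\<^esub> act g w"
    and act_smult: "g \<in> carrier G \<Longrightarrow> c \<in> carrier K \<Longrightarrow> v \<in> carrier V \<Longrightarrow>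
      act g (c \<odot>\<^bsub>V\<^esub> v) = c \<odot>\<^bsub>V\<^esub> act g v"
    and act_one: "v \<in> carrier V \<Longrightarrow> act \<one>\<^bsub>G\<^esub> v = v"
    and act_mult: "g \<in> carrier G \<Longrightarrow> h \<in> carrier G \<Longrightarrow> v \<in> carrier V \<Longrightarrow>
      act (g \<otimes>\<^bsub>G\<^esub> h) v = act g (act h v)"
begin

lemma act_inv [simp]:
  assumes "g \<in> carrier G" "v \<in> carrier V"
  shows "act g (act (inv\<^bsub>G\<^esub> g) v) = v" "act (inv\<^bsub>G\<^esub> g) (act g v) = v"
  using act_mult[of g "inv\<^bsub>G\<^esub> g" v] act_mult[of "inv\<^bsub>G\<^esub> g" g v] act_one assms by auto

lemma whole_subspace: "subspace K (carrier V) V"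
  by (rule subspaceI) auto

lemma act_zero: "g \<in> carrier G \<Longrightarrow> act g \<zero>\<^bsub>V\<^esub> = \<zero>\<^bsub>V\<^esub>"
  using act_smult[of g "\<zero>\<^bsub>K\<^esub>" "\<zero>\<^bsub>V\<^esub>"] act_closed[of g "\<zero>\<^bsub>V\<^esub>"] by simp

lemma act_finsum:
  assumes "finite A" "f \<in> A \<rightarrow> carrier V" "g \<in> carrier G"
  shows "act g (finsum V f A) = (\<Oplus>\<^bsub>V\<^esub>x\<in>A. act g (f x))"
  by (rule additive_finsum[OF whole_subspace assms(1,2)]) (use assms(3) act_closed act_add in auto)

definition invariant :: "'c set \<Rightarrow> bool" where
  "invariant W \<longleftrightarrow> subspace K W V \<and> (\<forall>g\<in>carrier G. \<forall>w\<in>W. act g w \<in> W)"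

definition irreducible :: "'c set \<Rightarrow> bool" where
  "irreducible W \<longleftrightarrow> invariant W \<and> W \<noteq> {\<zero>\<^bsub>V\<^esub>} \<and>
     (\<forall>U. invariant U \<and> U \<subseteq> W \<longrightarrow> U = {\<zero>\<^bsub>V\<^esub>} \<or> U = W)"

lemma invariant_span:
  assumes A: "A \<subseteq> carrier V" and act: "\<And>g a. g \<in> carrier G \<Longrightarrow> a \<in> A \<Longrightarrow> act g a \<in> span A"
  shows "invariant (span A)"
proof -
  note S = span_is_subspace[OF A]
  have "act g w \<in> span A" if g: "g \<in> carrier G" and w: "w \<in> span A" for g w
  proof -
    have "subspace K {w \<in> carrier V. act g w \<in> span A} V"
      by (rule subspaceI) (use subspaceD[OF S] g act_add act_smult act_zero in auto)
    from subspaceD(6)[OF this] show ?thesis using A act[OF g] w by blast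
  qed
  then show ?thesis using S by (simp add: invariant_def)
qed

text \<open>Without division by the group order, the average of a projection or a connection picks up a factor \<open>|G|\<close>,
which is nonzero in characteristic \<open>0\<close>.\<close>

definition average :: "('c \<Rightarrow> 'c) \<Rightarrow> 'c \<Rightarrow> 'c" where
  "average f w = (\<Oplus>\<^bsub>V\<^esub>h\<in>carrier G. act h (f (act (inv\<^bsub>G\<^esub> h) w)))"

context
  fixes W f
  assumes W: "invariant W" and f_cl: "\<And>w. w \<in> W \<Longrightarrow> f w \<in> carrier V"
begin

lemma W_act: "g \<in> carrier G \<Longrightarrow> w \<in> W \<Longrightarrow> act g w \<in> W"
  and W_sub: "subspace K W V" and W_cl: "w \<in> W \<Longrightarrow> w \<in> carrier V"
  using W subspaceD(1) by (auto simp: invariant_def)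

lemma average_summand: "w \<in> W \<Longrightarrow> h \<in> carrier G \<Longrightarrow> act h (f (act (inv\<^bsub>G\<^esub> h) w)) \<in> carrier V"
  by (intro act_closed f_cl W_act) auto

lemma average_closed: "w \<in> W \<Longrightarrow> average f w \<in> carrier V"
  unfolding average_def by (intro M.finsum_closed) (use average_summand in auto)

lemma average_equivariant:
  assumes g: "g \<in> carrier G" and w: "w \<in> W"
  shows "average f (act g w) = act g (average f w)"
proof -
  let ?F = "\<lambda>h. act h (f (act (inv\<^bsub>G\<^esub> h) (act g w)))"
  have gw: "act g w \<in> W" by (rule W_act[OF g w])
  have img: "(\<lambda>h. g \<otimes>\<^bsub>G\<^esub> h) ` carrier G = carrier G" by (rule G.surj_const_mult[OF g])
  have "average f (act g w) = (\<Oplus>\<^bsub>V\<^esub>h\<in>(\<lambda>h. g \<otimes>\<^bsub>G\<^esub> h) ` carrier G. ?F h)"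
    unfolding average_def img ..
  also have "\<dots> = (\<Oplus>\<^bsub>V\<^esub>h\<in>carrier G. ?F (g \<otimes>\<^bsub>G\<^esub> h))"
    by (rule M.finsum_reindex) (use img average_summand[OF gw] G.inj_on_cmult[OF g] in auto)
  also have "\<dots> = (\<Oplus>\<^bsub>V\<^esub>h\<in>carrier G. act g (act h (f (act (inv\<^bsub>G\<^esub> h) w))))"
  proof (rule M.finsum_cong')
    fix h assume h: "h \<in> carrier G"
    have "act (inv\<^bsub>G\<^esub> (g \<otimes>\<^bsub>G\<^esub> h)) (act g w) = act (inv\<^bsub>G\<^esub> h) w"
      using g h w by (simp add: G.inv_mult_group act_mult W_cl act_closed)
    then show "?F (g \<otimes>\<^bsub>G\<^esub> h) = act g (act h (f (act (inv\<^bsub>G\<^esub> h) w)))"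
      using g h w by (simp add: act_mult f_cl W_act)
  qed (use average_summand[OF w] g act_closed in auto)
  also have "\<dots> = act g (average f w)"
    unfolding average_def by (rule act_finsum[symmetric]) (use finite_group g average_summand[OF w] in auto)
  finally show ?thesis .
qed

lemma average_add:
  assumes f_add: "\<And>v w. v \<in> W \<Longrightarrow> w \<in> W \<Longrightarrow> f (v \<oplus>\<^bsub>V\<^esub> w) = f v \<oplus>\<^bsub>V\<^esub> f w"
    and vw: "v \<in> W" "w \<in> W"
  shows "average f (v \<oplus>\<^bsub>V\<^esub> w) = average f v \<oplus>\<^bsub>V\<^esub> average f w"
proof -
  have "average f (v \<oplus>\<^bsub>V\<^esub> w) = (\<Oplus>\<^bsub>V\<^esub>h\<in>carrier G. act h (f (act (inv\<^bsub>G\<^esub> h) v)) \<oplus>\<^bsub>V\<^esub> act h (f (act (inv\<^bsub>G\<^esub> h) w)))"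
    unfolding average_def
    by (rule M.finsum_cong') (use vw average_summand in \<open>auto simp: act_add f_add W_cl W_act f_cl\<close>)
  also have "\<dots> = average f v \<oplus>\<^bsub>V\<^esub> average f w"
    unfolding average_def by (rule M.finsum_addf) (use vw average_summand in auto)
  finally show ?thesis .
qed

text \<open>The hypothesis is the Leibniz rule of a connection with \<open>d = D(c)\<close>, and it includes linear maps as the case
\<open>d = \<zero>\<close>. Since the terms \<open>d w\<close> are invariant under conjugation, they add up to \<open>|G| d w\<close>.\<close>

lemma average_smult:
  assumes f_smult: "\<And>w. w \<in> W \<Longrightarrow> f (c \<odot>\<^bsub>V\<^esub> w) = d \<odot>\<^bsub>V\<^esub> w \<oplus>\<^bsub>V\<^esub> c \<odot>\<^bsub>V\<^esub> f w"
    and c: "c \<in> carrier K" and d: "d \<in> carrier K" and w: "w \<in> W"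
  shows "average f (c \<odot>\<^bsub>V\<^esub> w) = (add_pow K (order G) d) \<odot>\<^bsub>V\<^esub> w \<oplus>\<^bsub>V\<^esub> c \<odot>\<^bsub>V\<^esub> average f w"
proof -
  have "average f (c \<odot>\<^bsub>V\<^esub> w) = (\<Oplus>\<^bsub>V\<^esub>h\<in>carrier G. d \<odot>\<^bsub>V\<^esub> w \<oplus>\<^bsub>V\<^esub> c \<odot>\<^bsub>V\<^esub> act h (f (act (inv\<^bsub>G\<^esub> h) w)))"
    unfolding average_def
  proof (rule M.finsum_cong')
    fix h assume h: "h \<in> carrier G"
    then have hw: "act (inv\<^bsub>G\<^esub> h) w \<in> W" using w by (simp add: W_act)
    have "act h (f (act (inv\<^bsub>G\<^esub> h) (c \<odot>\<^bsub>V\<^esub> w))) = act h (f (c \<odot>\<^bsub>V\<^esub> act (inv\<^bsub>G\<^esub> h) w))"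
      using h c w by (simp add: act_smult W_cl)
    also have "\<dots> = act h (d \<odot>\<^bsub>V\<^esub> act (inv\<^bsub>G\<^esub> h) w) \<oplus>\<^bsub>V\<^esub> act h (c \<odot>\<^bsub>V\<^esub> f (act (inv\<^bsub>G\<^esub> h) w))"
      using h c d hw by (simp add: f_smult act_add f_cl W_cl)
    also have "\<dots> = d \<odot>\<^bsub>V\<^esub> w \<oplus>\<^bsub>V\<^esub> c \<odot>\<^bsub>V\<^esub> act h (f (act (inv\<^bsub>G\<^esub> h) w))"
      using h c d hw w W_cl[OF hw] W_cl[OF w] by (simp add: act_smult f_cl)
    finally show "act h (f (act (inv\<^bsub>G\<^esub> h) (c \<odot>\<^bsub>V\<^esub> w))) = d \<odot>\<^bsub>V\<^esub> w \<oplus>\<^bsub>V\<^esub> c \<odot>\<^bsub>V\<^esub> act h (f (act (inv\<^bsub>G\<^esub> h) w))" .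
  qed (use c d w average_summand W_cl in auto)
  also have "\<dots> = (\<Oplus>\<^bsub>V\<^esub>h\<in>carrier G. d \<odot>\<^bsub>V\<^esub> w) \<oplus>\<^bsub>V\<^esub> (\<Oplus>\<^bsub>V\<^esub>h\<in>carrier G. c \<odot>\<^bsub>V\<^esub> act h (f (act (inv\<^bsub>G\<^esub> h) w)))"
    by (rule M.finsum_addf) (use c d w average_summand W_cl in auto)
  also have "(\<Oplus>\<^bsub>V\<^esub>h\<in>carrier G. c \<odot>\<^bsub>V\<^esub> act h (f (act (inv\<^bsub>G\<^esub> h) w))) = c \<odot>\<^bsub>V\<^esub> average f w"
    unfolding average_def by (rule finsum_smult[symmetric]) (use finite_group c w average_summand in auto)
  finally show ?thesis using finsum_const_smult[OF finite_group d W_cl[OF w]] by (simp add: order_def)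
qed

end

end

section \<open>Equivariant connections\<close>

context linear_action
begin

text \<open>The connection for which the vectors of \<open>B\<close> are horizontal. It need not commute with \<open>G\<close>; its average does, but
need not vanish on \<open>B\<close>.\<close>

definition connection :: "'c set \<Rightarrow> ('a \<Rightarrow> 'a) \<Rightarrow> 'c \<Rightarrow> 'c" where
  "connection B D w = lincomb (\<lambda>b. D (coord B w b)) B"

context
  fixes B F
  assumes B: "finite B" "B \<subseteq> carrier V" "lin_indpt B" and inv: "invariant (span B)"
    and FK: "F \<subseteq> carrier K"
begin

lemma span_cl: "w \<in> span B \<Longrightarrow> w \<in> carrier V"
  and span_sub: "subspace K (span B) V" and span_act: "g \<in> carrier G \<Longrightarrow> w \<in> span B \<Longrightarrow> act g w \<in> span B"
  using inv subspaceD(1) by (auto simp: invariant_def)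

lemma connection_closed:
  assumes "derivation K F D" "w \<in> span B"
  shows "connection B D w \<in> span B" "connection B D w \<in> carrier V"
proof -
  show "connection B D w \<in> span B"
    unfolding connection_def
    by (rule lincomb_in_span[OF B(1,2)]) (use assms coord_cl[OF B] derivationD(1) in auto)
  then show "connection B D w \<in> carrier V" by (rule span_cl)
qed

lemma connection_add:
  assumes D: "derivation K F D" and vw: "v \<in> span B" "w \<in> span B"
  shows "connection B D (v \<oplus>\<^bsub>V\<^esub> w) = connection B D v \<oplus>\<^bsub>V\<^esub> connection B D w"
proof -
  have "connection B D (v \<oplus>\<^bsub>V\<^esub> w) = lincomb (\<lambda>b. D (coord B v b) \<oplus>\<^bsub>K\<^esub> D (coord B w b)) B"
    unfolding connection_def
    by (rule lincomb_cong[OF refl B(2)])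
      (use vw coord_add[OF B vw] coord_cl[OF B] derivationD[OF D] in auto)
  also have "\<dots> = connection B D v \<oplus>\<^bsub>V\<^esub> connection B D w"
    unfolding connection_def
    by (rule lincomb_sum[OF B(1,2)]) (use vw coord_cl[OF B] derivationD(1)[OF D] in auto)
  finally show ?thesis .
qed

lemma connection_smult:
  assumes D: "derivation K F D" and c: "c \<in> carrier K" and w: "w \<in> span B"
  shows "connection B D (c \<odot>\<^bsub>V\<^esub> w) = D c \<odot>\<^bsub>V\<^esub> w \<oplus>\<^bsub>V\<^esub> c \<odot>\<^bsub>V\<^esub> connection B D w"
proof -
  note cl = coord_cl[OF B w] derivationD(1)[OF D]
  have "connection B D (c \<odot>\<^bsub>V\<^esub> w)
      = lincomb (\<lambda>b. D c \<otimes>\<^bsub>K\<^esub> coord B w b \<oplus>\<^bsub>K\<^esub> c \<otimes>\<^bsub>K\<^esub> D (coord B w b)) B"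
    unfolding connection_def
    by (rule lincomb_cong[OF refl B(2)])
      (use w c cl coord_smult[OF B w c] derivationD(3)[OF D] R.a_comm in auto)
  also have "\<dots> = lincomb (\<lambda>b. D c \<otimes>\<^bsub>K\<^esub> coord B w b) B \<oplus>\<^bsub>V\<^esub> lincomb (\<lambda>b. c \<otimes>\<^bsub>K\<^esub> D (coord B w b)) B"
    by (rule lincomb_sum[OF B(1,2)]) (use w c cl in auto)
  also have "lincomb (\<lambda>b. D c \<otimes>\<^bsub>K\<^esub> coord B w b) B = D c \<odot>\<^bsub>V\<^esub> w"
    using lincomb_smult[OF B(2), of "coord B w" "D c"] coord_spec[OF B(1,2) w] c cl by auto
  also have "lincomb (\<lambda>b. c \<otimes>\<^bsub>K\<^esub> D (coord B w b)) B = c \<odot>\<^bsub>V\<^esub> connection B D w"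
    unfolding connection_def by (rule lincomb_smult[OF B(2)]) (use w c cl in auto)
  finally show ?thesis .
qed

lemma connection_lincomb:
  assumes D: "derivation K F D" and E: "derivation K F E" and c: "c \<in> carrier K" and w: "w \<in> span B"
  shows "connection B (\<lambda>x. D x \<oplus>\<^bsub>K\<^esub> c \<otimes>\<^bsub>K\<^esub> E x) w = connection B D w \<oplus>\<^bsub>V\<^esub> c \<odot>\<^bsub>V\<^esub> connection B E w"
proof -
  note cl = coord_cl[OF B w] derivationD(1)[OF D] derivationD(1)[OF E]
  have "connection B (\<lambda>x. D x \<oplus>\<^bsub>K\<^esub> c \<otimes>\<^bsub>K\<^esub> E x) w =
      lincomb (\<lambda>b. D (coord B w b)) B \<oplus>\<^bsub>V\<^esub> lincomb (\<lambda>b. c \<otimes>\<^bsub>K\<^esub> E (coord B w b)) B"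
    unfolding connection_def by (rule lincomb_sum[OF B(1,2)]) (use c cl in auto)
  also have "lincomb (\<lambda>b. c \<otimes>\<^bsub>K\<^esub> E (coord B w b)) B = c \<odot>\<^bsub>V\<^esub> connection B E w"
    unfolding connection_def by (rule lincomb_smult[OF B(2)]) (use c cl in auto)
  finally show ?thesis unfolding connection_def .
qed

lemma average_connection_span:
  assumes D: "derivation K F D" and w: "w \<in> span B"
  shows "average (connection B D) w \<in> span B"
  unfolding average_def
  by (rule subspaceD(5)[OF span_sub]) (use w span_act connection_closed(1)[OF D] in auto)

lemma average_connection_lincomb:
  assumes D: "derivation K F D" and E: "derivation K F E" and c: "c \<in> carrier K" and w: "w \<in> span B"
  shows "average (connection B (\<lambda>x. D x \<oplus>\<^bsub>K\<^esub> c \<otimes>\<^bsub>K\<^esub> E x)) w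
    = average (connection B D) w \<oplus>\<^bsub>V\<^esub> c \<odot>\<^bsub>V\<^esub> average (connection B E) w"
proof -
  note cl = connection_closed(2)[OF D] connection_closed(2)[OF E]
  note sum = average_summand[OF inv, of "connection B D", OF cl(1) w]
    average_summand[OF inv, of "connection B E", OF cl(2) w]
  have "average (connection B (\<lambda>x. D x \<oplus>\<^bsub>K\<^esub> c \<otimes>\<^bsub>K\<^esub> E x)) w =
     (\<Oplus>\<^bsub>V\<^esub>h\<in>carrier G. act h (connection B D (act (inv\<^bsub>G\<^esub> h) w))
        \<oplus>\<^bsub>V\<^esub> c \<odot>\<^bsub>V\<^esub> act h (connection B E (act (inv\<^bsub>G\<^esub> h) w)))"
    unfolding average_def
    by (rule M.finsum_cong')
      (use sum w c cl span_act in \<open>auto simp: connection_lincomb[OF D E c] act_add act_smult\<close>)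
  also have "\<dots> = average (connection B D) w \<oplus>\<^bsub>V\<^esub>
      (\<Oplus>\<^bsub>V\<^esub>h\<in>carrier G. c \<odot>\<^bsub>V\<^esub> act h (connection B E (act (inv\<^bsub>G\<^esub> h) w)))"
    unfolding average_def by (rule M.finsum_addf) (use sum c in auto)
  also have "(\<Oplus>\<^bsub>V\<^esub>h\<in>carrier G. c \<odot>\<^bsub>V\<^esub> act h (connection B E (act (inv\<^bsub>G\<^esub> h) w)))
      = c \<odot>\<^bsub>V\<^esub> average (connection B E) w"
    unfolding average_def by (rule finsum_smult[symmetric]) (use finite_group c sum in auto)
  finally show ?thesis .
qed

text \<open>The averaged connection \<open>N\<close> commutes with \<open>G\<close>, so it is determined on \<open>B\<close> by \<open>N v\<close>. If \<open>N v\<close> is a multiple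
\<open>l v\<close> of \<open>v\<close>, then \<open>N = l\<close> on all elements \<open>g b\<close>. By the Leibniz rule, \<open>N (g b) - l (g b)\<close> is also the combination of \<open>B\<close>
with the coefficients \<open>|G| D(c)\<close>, for \<open>c\<close> the coordinates of \<open>g b\<close>.\<close>

lemma structure_constants_rigid:
  assumes D: "derivation K F D" and char: "char_zero K"
    and v: "v \<in> B" and orbit: "B \<subseteq> (\<lambda>g. act g v) ` carrier G"
    and eigen: "\<And>b. b \<in> B - {v} \<Longrightarrow> coord B (average (connection B D) v) b = \<zero>\<^bsub>K\<^esub>"
    and g: "g \<in> carrier G" and b: "b \<in> B" "b' \<in> B"
  shows "D (coord B (act g b) b') = \<zero>\<^bsub>K\<^esub>"
proof -
  let ?N = "average (connection B D)"
  note cl = connection_closed(2)[OF D]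
  have BS: "b \<in> span B" if "b \<in> B" for b using in_own_span[OF B(2)] that by blast
  have N_cl: "?N w \<in> carrier V" if "w \<in> span B" for w by (rule average_closed[OF inv cl that])
  have N_equiv: "?N (act h w) = act h (?N w)" if "h \<in> carrier G" "w \<in> span B" for h w
    by (rule average_equivariant[OF inv cl that])
  have N_add: "?N (x \<oplus>\<^bsub>V\<^esub> y) = ?N x \<oplus>\<^bsub>V\<^esub> ?N y" if "x \<in> span B" "y \<in> span B" for x y
    by (rule average_add[OF inv cl connection_add[OF D] that])
  have N_smult: "?N (c \<odot>\<^bsub>V\<^esub> w) = add_pow K (order G) (D c) \<odot>\<^bsub>V\<^esub> w \<oplus>\<^bsub>V\<^esub> c \<odot>\<^bsub>V\<^esub> ?N w"
    if "c \<in> carrier K" "w \<in> span B" for c w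
    by (rule average_smult[OF inv cl connection_smult[OF D that(1)] that(1) derivationD(1)[OF D that(1)] that(2)])
  define l where "l = coord B (?N v) v"
  note Nv = coord_spec[OF B(1,2) average_connection_span[OF D BS[OF v]]]
  have l: "l \<in> carrier K" using Nv(1) v by (auto simp: l_def)
  have "?N v = lincomb (coord B (?N v)) B" by (rule Nv(2)[symmetric])
  also have "\<dots> = lincomb (\<lambda>b. if b = v then l else \<zero>\<^bsub>K\<^esub>) B"
    by (rule lincomb_cong[OF refl B(2)]) (use eigen l l_def in auto)
  also have "\<dots> = l \<odot>\<^bsub>V\<^esub> v" by (rule lincomb_single[OF B v l])
  finally have Nv_eq: "?N v = l \<odot>\<^bsub>V\<^esub> v" .
  have N_basis: "?N x = l \<odot>\<^bsub>V\<^esub> x" if x: "x \<in> B" for x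
  proof -
    obtain h where h: "h \<in> carrier G" "x = act h v" using orbit x by blast
    then show ?thesis using N_equiv[OF h(1) BS[OF v]] Nv_eq act_smult[OF h(1) l] v B(2) by auto
  qed
  define c where "c = coord B (act g b)"
  have w: "act g b \<in> span B" by (rule span_act[OF g BS[OF b(1)]])
  have c: "c \<in> B \<rightarrow> carrier K" and cw: "lincomb c B = act g b"
    using coord_spec[OF B(1,2) w] by (auto simp: c_def)
  have cx: "c x \<in> carrier K" "x \<in> carrier V" "D (c x) \<in> carrier K" if "x \<in> B" for x
    using c B(2) that derivationD(1)[OF D] by auto
  have 1: "?N (act g b) = l \<odot>\<^bsub>V\<^esub> act g b"
    using N_equiv[OF g BS[OF b(1)]] N_basis[OF b(1)] act_smult[OF g l] b(1) B(2) by auto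
  have summand: "?N (c x \<odot>\<^bsub>V\<^esub> x) = (add_pow K (order G) (D (c x)) \<oplus>\<^bsub>K\<^esub> l \<otimes>\<^bsub>K\<^esub> c x) \<odot>\<^bsub>V\<^esub> x" if x: "x \<in> B" for x
    unfolding N_smult[OF cx(1)[OF x] BS[OF x]] N_basis[OF x]
    using cx[OF x] l by (simp add: smult_l_distr smult_assoc1[symmetric] R.m_comm)
  have "?N (act g b) = (\<Oplus>\<^bsub>V\<^esub>x\<in>B. ?N (c x \<odot>\<^bsub>V\<^esub> x))"
    unfolding cw[symmetric] lincomb_def
    by (rule additive_finsum[OF span_sub B(1)]) (use cx subspaceD(4)[OF span_sub] BS N_cl N_add in auto)
  also have "\<dots> = lincomb (\<lambda>x. add_pow K (order G) (D (c x)) \<oplus>\<^bsub>K\<^esub> l \<otimes>\<^bsub>K\<^esub> c x) B"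
    unfolding lincomb_def by (rule M.finsum_cong') (use summand cx l in auto)
  also have "\<dots> = lincomb (\<lambda>x. add_pow K (order G) (D (c x))) B \<oplus>\<^bsub>V\<^esub> lincomb (\<lambda>x. l \<otimes>\<^bsub>K\<^esub> c x) B"
    by (rule lincomb_sum[OF B(1,2)]) (use cx l in auto)
  also have "lincomb (\<lambda>x. l \<otimes>\<^bsub>K\<^esub> c x) B = l \<odot>\<^bsub>V\<^esub> act g b"
    unfolding cw[symmetric] by (rule lincomb_smult[OF B(2) c l])
  finally have 2: "l \<odot>\<^bsub>V\<^esub> act g b = lincomb (\<lambda>x. add_pow K (order G) (D (c x))) B \<oplus>\<^bsub>V\<^esub> l \<odot>\<^bsub>V\<^esub> act g b"
    unfolding 1 .
  have cl': "lincomb (\<lambda>x. add_pow K (order G) (D (c x))) B \<in> carrier V"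
    by (rule lincomb_closed[OF B(2)]) (use cx in auto)
  have lw: "l \<odot>\<^bsub>V\<^esub> act g b \<in> carrier V" using l span_cl[OF w] by simp
  have "lincomb (\<lambda>x. add_pow K (order G) (D (c x))) B = \<zero>\<^bsub>V\<^esub>"
    using 2 cl' lw by (metis M.add.l_cancel_one' M.a_comm)
  then have "add_pow K (order G) (D (c b')) = \<zero>\<^bsub>K\<^esub>"
    using not_lindepD[OF B(3,1) subset_refl, of "\<lambda>x. add_pow K (order G) (D (c x))"] cx b(2) by auto
  then have "D (c b') = \<zero>\<^bsub>K\<^esub>"
    using nat_multiple_nonzero[OF char _ cx(3)[OF b(2)], of "order G"] finite_group G.order_gt_0_iff_finite
    by auto
  then show ?thesis by (simp add: c_def)
qed

end

end

section \<open>Irreducible subspaces\<close>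

context linear_action
begin

text \<open>The orbit of a nonzero vector spans an invariant subspace, which is \<open>W\<close> by irreducibility; a maximal
independent subset of the orbit that contains the vector is a basis.\<close>

lemma cyclic_basis:
  assumes W: "irreducible W"
  shows "\<exists>B v. finite B \<and> B \<subseteq> carrier V \<and> lin_indpt B \<and> span B = W \<and> v \<in> B \<and> B \<subseteq> (\<lambda>g. act g v) ` carrier G"
proof -
  have inv: "invariant W" and ne: "W \<noteq> {\<zero>\<^bsub>V\<^esub>}"
    and irr: "\<And>U. invariant U \<Longrightarrow> U \<subseteq> W \<Longrightarrow> U = {\<zero>\<^bsub>V\<^esub>} \<or> U = W"
    using W by (auto simp: irreducible_def)
  have S: "subspace K W V" using inv by (simp add: invariant_def)
  obtain v where v: "v \<in> W" "v \<noteq> \<zero>\<^bsub>V\<^esub>" using ne subspaceD(2)[OF S] by blast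
  have vV: "v \<in> carrier V" using v subspaceD(1)[OF S] by blast
  define Orb where "Orb = (\<lambda>g. act g v) ` carrier G"
  have Orb: "finite Orb" "Orb \<subseteq> W" "v \<in> Orb" "Orb \<subseteq> carrier V"
    using finite_group inv v act_one[OF vV] act_closed vV
    by (auto simp: Orb_def invariant_def intro: image_eqI[of _ _ "\<one>\<^bsub>G\<^esub>"])
  let ?P = "\<lambda>B. v \<in> B \<and> B \<subseteq> Orb \<and> lin_indpt B"
  have "v \<notin> span {}" using v(2) by (simp add: span_empty)
  then have "?P {v}" using lin_indpt_insert[OF _ lin_indpt_empty vV] Orb(3) by simp
  moreover have "finite A \<and> card A \<le> card Orb" if "?P A" for A
    using that Orb(1) by (meson card_mono finite_subset)
  ultimately obtain B where B: "finite B" "maximal B ?P"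
    using maximal_exists[of ?P "card Orb" "{v}"] by blast
  have BP: "?P B" and max: "\<And>B'. B \<subseteq> B' \<Longrightarrow> ?P B' \<Longrightarrow> B' = B"
    using B(2) by (auto simp: maximal_def)
  have BV: "B \<subseteq> carrier V" using BP Orb by blast
  have OS: "Orb \<subseteq> span B"
  proof
    fix w assume w: "w \<in> Orb"
    show "w \<in> span B"
    proof (rule ccontr)
      assume n: "w \<notin> span B"
      then have "lin_indpt (insert w B)" using lin_indpt_insert BP BV w Orb by blast
      then have "insert w B = B" using max[of "insert w B"] BP w by blast
      then show False using n in_own_span[OF BV] by blast
    qed
  qed
  have "invariant (span B)"
  proof (rule invariant_span[OF BV])
    fix g a assume g: "g \<in> carrier G" and a: "a \<in> B"
    then obtain h where h: "h \<in> carrier G" "a = act h v" using BP by (auto simp: Orb_def)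
    then have "act g a = act (g \<otimes>\<^bsub>G\<^esub> h) v" using g vV by (simp add: act_mult)
    then have "act g a \<in> Orb" using g h by (auto simp: Orb_def)
    then show "act g a \<in> span B" using OS by blast
  qed
  moreover have "span B \<subseteq> W" using subspaceD(6)[OF S] BP Orb(2) by blast
  moreover have "v \<in> span B" using OS Orb(3) by blast
  ultimately have "span B = W" using irr[of "span B"] v(2) by blast
  then show ?thesis using B(1) BV BP unfolding Orb_def by blast
qed

text \<open>A nonzero invariant subspace of least dimension is irreducible.\<close>

lemma irreducible_sub_exists:
  assumes fd: "fin_dim" and U: "invariant U" "U \<noteq> {\<zero>\<^bsub>V\<^esub>}"
  shows "\<exists>W\<subseteq>U. irreducible W"
proof -
  define rank where "rank W n \<longleftrightarrow> (\<exists>A. finite A \<and> A \<subseteq> carrier V \<and> lin_indpt A \<and> span A = W \<and> card A = n)" for W n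
  have rank_ex: "\<exists>n. rank W n" if "invariant W" for W
  proof -
    have S: "subspace K W V" using that by (simp add: invariant_def)
    obtain A where A: "finite A" "A \<subseteq> W" "lin_indpt A" "span A = W"
      using subspace_has_basis[OF fd S empty_subsetI lin_indpt_empty] by auto
    then have "rank W (card A)" using subspaceD(1)[OF S] unfolding rank_def by blast
    then show ?thesis ..
  qed
  let ?Q = "\<lambda>n. \<exists>W\<subseteq>U. invariant W \<and> W \<noteq> {\<zero>\<^bsub>V\<^esub>} \<and> rank W n"
  have "\<exists>n. ?Q n" using rank_ex U by blast
  define n where "n = (LEAST n. ?Q n)"
  have least: "n \<le> m" if "?Q m" for m unfolding n_def by (rule Least_le[of ?Q, OF that])
  have "?Q n" unfolding n_def by (rule LeastI_ex[of ?Q]) (fact \<open>\<exists>n. ?Q n\<close>)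
  then obtain W where W: "W \<subseteq> U" "invariant W" "W \<noteq> {\<zero>\<^bsub>V\<^esub>}" "rank W n" by blast
  obtain A where A: "finite A" "A \<subseteq> carrier V" "lin_indpt A" "span A = W" "card A = n"
    using W(4) by (auto simp: rank_def)
  have "W' = W" if W': "invariant W'" "W' \<subseteq> W" "W' \<noteq> {\<zero>\<^bsub>V\<^esub>}" for W'
  proof (rule ccontr)
    assume "W' \<noteq> W"
    then obtain x where x: "x \<in> W" "x \<notin> W'" using W'(2) by blast
    obtain A' where A': "finite A'" "A' \<subseteq> carrier V" "lin_indpt A'" "span A' = W'"
      using rank_ex[OF W'(1)] by (auto simp: rank_def)
    then have "n \<le> card A'" using least[of "card A'"] W' W(1) by (auto simp: rank_def)
    moreover have xV: "x \<in> carrier V" using x A span_closed[OF A(2)] by blast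
    have "lin_indpt (insert x A')" using lin_indpt_insert[OF A'(2,3) xV] x A'(4) by simp
    moreover have "insert x A' \<subseteq> span A" using x A(4) W'(2) A' in_own_span[OF A'(2)] by blast
    ultimately have "card (insert x A') \<le> n"
      using card_lin_indpt_le[of "insert x A'" A] A A'(1) by simp
    moreover have "x \<notin> A'" using x A' in_own_span[OF A'(2)] by blast
    ultimately show False using A'(1) \<open>n \<le> card A'\<close> by simp
  qed
  then have "irreducible W" using W by (auto simp: irreducible_def)
  then show ?thesis using W(1) by blast
qed

text \<open>Maschke's theorem in the form needed to build up a decomposition. If \<open>p\<close> is a linear projection onto \<open>W\<close>,
its average \<open>q\<close> commutes with \<open>G\<close> and is multiplication by \<open>|G|\<close> on \<open>W\<close>. Hence the kernel of \<open>q\<close> is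
invariant, meets \<open>W\<close> in \<open>0\<close> and contains \<open>|G| x - q x\<close>, which is nonzero for \<open>x \<notin> W\<close>.\<close>

lemma irreducible_outside:
  assumes fd: "fin_dim" and char: "char_zero K" and W: "invariant W" "W \<noteq> carrier V"
  shows "\<exists>U. irreducible U \<and> U \<inter> W \<subseteq> {\<zero>\<^bsub>V\<^esub>}"
proof -
  have WS: "subspace K W V" using W by (simp add: invariant_def)
  have WV: "W \<subseteq> carrier V" by (rule subspaceD(1)[OF WS])
  have whole: "invariant (carrier V)" using whole_subspace act_closed by (simp add: invariant_def)
  obtain A where A: "finite A" "A \<subseteq> W" "lin_indpt A" "span A = W"
    using subspace_has_basis[OF fd WS, of "{}"] lin_indpt_empty by blast
  have AV: "A \<subseteq> carrier V" using A WV by blast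
  obtain C where C: "A \<subseteq> C" "finite C" "C \<subseteq> carrier V" "lin_indpt C" "span C = carrier V"
    using subspace_has_basis[OF fd whole_subspace AV A(3)] by blast
  \<comment> \<open>The projection onto \<open>W\<close> along the span of \<open>C - A\<close>.\<close>
  define p where "p w = lincomb (coord C w) A" for w
  have co: "coord C w \<in> A \<rightarrow> carrier K" if "w \<in> carrier V" for w
    using coord_spec(1)[OF C(2,3)] C(1,5) that by blast
  have pW: "p w \<in> W" if "w \<in> carrier V" for w
    unfolding p_def A(4)[symmetric] by (rule lincomb_in_span[OF A(1) AV co[OF that]])
  have pV: "p w \<in> carrier V" if "w \<in> carrier V" for w using pW[OF that] WV by blast
  have p_add: "p (v \<oplus>\<^bsub>V\<^esub> w) = p v \<oplus>\<^bsub>V\<^esub> p w" if "v \<in> carrier V" "w \<in> carrier V" for v w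
  proof -
    have "p (v \<oplus>\<^bsub>V\<^esub> w) = lincomb (\<lambda>b. coord C v b \<oplus>\<^bsub>K\<^esub> coord C w b) A"
      unfolding p_def
    proof (rule lincomb_cong[OF refl AV])
      show "coord C (v \<oplus>\<^bsub>V\<^esub> w) b = coord C v b \<oplus>\<^bsub>K\<^esub> coord C w b" if "b \<in> A" for b
        by (rule coord_add[OF C(2-4)]) (use C(1,5) that \<open>v \<in> _\<close> \<open>w \<in> _\<close> in auto)
    qed (use co[OF that(1)] co[OF that(2)] in auto)
    then show ?thesis unfolding p_def using lincomb_sum[OF A(1) AV co co] that by simp
  qed
  have p_smult: "p (c \<odot>\<^bsub>V\<^esub> w) = c \<odot>\<^bsub>V\<^esub> p w" if "c \<in> carrier K" "w \<in> carrier V" for c w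
  proof -
    have "p (c \<odot>\<^bsub>V\<^esub> w) = lincomb (\<lambda>b. c \<otimes>\<^bsub>K\<^esub> coord C w b) A"
      unfolding p_def
    proof (rule lincomb_cong[OF refl AV])
      show "coord C (c \<odot>\<^bsub>V\<^esub> w) b = c \<otimes>\<^bsub>K\<^esub> coord C w b" if "b \<in> A" for b
        by (rule coord_smult[OF C(2-4)]) (use C(1,5) that \<open>c \<in> _\<close> \<open>w \<in> _\<close> in auto)
    qed (use co[OF that(2)] that(1) in auto)
    then show ?thesis unfolding p_def using lincomb_smult[OF AV co] that by simp
  qed
  have p_id: "p w = w" if w: "w \<in> W" for w
  proof -
    obtain a where a: "a \<in> A \<rightarrow> carrier K" "lincomb a A = w"
      using finite_in_span[OF A(1) AV] A(4) w by blast
    have subsp: "subspace K {w \<in> carrier V. p w = w} V"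
    proof (rule subspaceI)
      show "\<zero>\<^bsub>V\<^esub> \<in> {w \<in> carrier V. p w = w}"
        using p_smult[of "\<zero>\<^bsub>K\<^esub>" "\<zero>\<^bsub>V\<^esub>"] pV[of "\<zero>\<^bsub>V\<^esub>"] by simp
    qed (auto simp: p_add p_smult)
    have "p b = b" if b: "b \<in> A" for b
    proof -
      have "p b = lincomb (\<lambda>x. if x = b then \<one>\<^bsub>K\<^esub> else \<zero>\<^bsub>K\<^esub>) A"
        unfolding p_def by (rule lincomb_cong[OF refl AV]) (use coord_basis[OF C(2-4)] b C(1) in \<open>auto simp: subset_iff\<close>)
      then show ?thesis using lincomb_single[OF A(1) AV A(3) b R.one_closed] b AV by auto
    qed
    then have "span A \<subseteq> {w \<in> carrier V. p w = w}" using subspaceD(6)[OF subsp] AV by blast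
    then show ?thesis using A(4) w by blast
  qed
  let ?q = "average p"
  have q_cl: "?q w \<in> carrier V" if "w \<in> carrier V" for w
    by (rule average_closed[OF whole pV that])
  have qW: "?q w \<in> W" if "w \<in> carrier V" for w
    unfolding average_def
    by (rule subspaceD(5)[OF WS]) (use that W(1) pW act_closed in \<open>auto simp: invariant_def\<close>)
  have q_add: "?q (v \<oplus>\<^bsub>V\<^esub> w) = ?q v \<oplus>\<^bsub>V\<^esub> ?q w" if "v \<in> carrier V" "w \<in> carrier V" for v w
    by (rule average_add[OF whole pV p_add that])
  have q_smult: "?q (c \<odot>\<^bsub>V\<^esub> w) = c \<odot>\<^bsub>V\<^esub> ?q w" if c: "c \<in> carrier K" and w: "w \<in> carrier V" for c w
    using average_smult[OF whole pV _ c R.zero_closed w] p_smult[OF c] pV q_cl[OF w] c w by simp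
  have q_equiv: "?q (act g w) = act g (?q w)" if "g \<in> carrier G" "w \<in> carrier V" for g w
    by (rule average_equivariant[OF whole pV that])
  define n where "n = add_pow K (order G) \<one>\<^bsub>K\<^esub>"
  have nK: "n \<in> carrier K" by (simp add: n_def)
  have n0: "n \<noteq> \<zero>\<^bsub>K\<^esub>"
    using char finite_group G.order_gt_0_iff_finite by (auto simp: n_def char_zero_def)
  have q_W: "?q w = n \<odot>\<^bsub>V\<^esub> w" if w: "w \<in> W" for w
  proof -
    have wV: "w \<in> carrier V" using w WV by blast
    have "?q w = (\<Oplus>\<^bsub>V\<^esub>h\<in>carrier G. w)"
      unfolding average_def
      by (rule M.finsum_cong') (use w wV W(1) in \<open>auto simp: invariant_def p_id\<close>)
    then show ?thesis
      using finsum_const_smult[OF finite_group R.one_closed wV] wV by (simp add: n_def order_def)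
  qed
  define U where "U = {w \<in> carrier V. ?q w = \<zero>\<^bsub>V\<^esub>}"
  have q0: "?q \<zero>\<^bsub>V\<^esub> = \<zero>\<^bsub>V\<^esub>"
    using q_smult[of "\<zero>\<^bsub>K\<^esub>" "\<zero>\<^bsub>V\<^esub>"] q_cl[of "\<zero>\<^bsub>V\<^esub>"] by simp
  have "subspace K U V"
    unfolding U_def by (rule subspaceI) (auto simp: q0 q_add q_smult)
  then have Uinv: "invariant U"
    using q_equiv act_zero act_closed by (auto simp: invariant_def U_def)
  have UW: "U \<inter> W \<subseteq> {\<zero>\<^bsub>V\<^esub>}"
  proof
    fix w assume w: "w \<in> U \<inter> W"
    then have wV: "w \<in> carrier V" and "n \<odot>\<^bsub>V\<^esub> w = \<zero>\<^bsub>V\<^esub>" using q_W by (auto simp: U_def)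
    then have "w = inv\<^bsub>K\<^esub> n \<odot>\<^bsub>V\<^esub> \<zero>\<^bsub>V\<^esub>" using mult_inverse[OF nK wV _ n0] by blast
    then show "w \<in> {\<zero>\<^bsub>V\<^esub>}" using nK n0 field_Units by (simp add: smult_r_null)
  qed
  obtain x where x: "x \<in> carrier V" "x \<notin> W" using W(2) WV by blast
  define u where "u = n \<odot>\<^bsub>V\<^esub> x \<oplus>\<^bsub>V\<^esub> (\<ominus>\<^bsub>K\<^esub> \<one>\<^bsub>K\<^esub>) \<odot>\<^bsub>V\<^esub> ?q x"
  have uV: "u \<in> carrier V" using x nK q_cl[OF x(1)] by (simp add: u_def)
  have neg: "(\<ominus>\<^bsub>K\<^esub> \<one>\<^bsub>K\<^esub>) \<odot>\<^bsub>V\<^esub> w = \<ominus>\<^bsub>V\<^esub> w" if "w \<in> carrier V" for w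
    using that by (simp add: smult_l_minus)
  have "?q u = n \<odot>\<^bsub>V\<^esub> ?q x \<oplus>\<^bsub>V\<^esub> (\<ominus>\<^bsub>K\<^esub> \<one>\<^bsub>K\<^esub>) \<odot>\<^bsub>V\<^esub> ?q (?q x)"
    unfolding u_def using x nK q_cl[OF x(1)] by (simp add: q_add q_smult)
  also have "\<dots> = \<zero>\<^bsub>V\<^esub>"
    using q_W[OF qW[OF x(1)]] nK q_cl[OF x(1)] by (simp add: neg M.r_neg)
  finally have "u \<in> U" using uV by (simp add: U_def)
  moreover have "u \<noteq> \<zero>\<^bsub>V\<^esub>"
  proof
    assume "u = \<zero>\<^bsub>V\<^esub>"
    then have "n \<odot>\<^bsub>V\<^esub> x \<oplus>\<^bsub>V\<^esub> \<ominus>\<^bsub>V\<^esub> ?q x = \<zero>\<^bsub>V\<^esub>" using neg q_cl[OF x(1)] by (simp add: u_def)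
    then have "n \<odot>\<^bsub>V\<^esub> x = ?q x"
      using q_cl[OF x(1)] x nK by (metis M.minus_equality M.minus_minus M.a_inv_closed smult_closed)
    then have "x = inv\<^bsub>K\<^esub> n \<odot>\<^bsub>V\<^esub> ?q x" using mult_inverse[OF nK x(1) _ n0] by blast
    then show False
      using subspaceD(4)[OF WS _ qW[OF x(1)], of "inv\<^bsub>K\<^esub> n"] nK n0 field_Units x(2) by simp
  qed
  ultimately have "U \<noteq> {\<zero>\<^bsub>V\<^esub>}" by blast
  then obtain W' where "W' \<subseteq> U" "irreducible W'" using irreducible_sub_exists[OF fd Uinv] by blast
  then show ?thesis using UW by blast
qed

end

section \<open>Structure constants\<close>

context linear_action
begin

lemma invariantD:
  assumes "invariant W"
  shows "subspace K W V" "W \<subseteq> carrier V" "g \<in> carrier G \<Longrightarrow> w \<in> W \<Longrightarrow> act g w \<in> W"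
  using assms subspaceD(1) by (auto simp: invariant_def)

text \<open>A basis to which \<open>structure_constants_rigid\<close> applies.\<close>

definition cyclic_piece :: "'c set \<Rightarrow> 'c \<Rightarrow> bool" where
  "cyclic_piece B v \<longleftrightarrow> finite B \<and> B \<subseteq> carrier V \<and> lin_indpt B \<and> invariant (span B) \<and>
     v \<in> B \<and> B \<subseteq> (\<lambda>g. act g v) ` carrier G"

definition structure_constants :: "'c set \<Rightarrow> 'a set" where
  "structure_constants B = {coord B (act g b) b' | g b b'. g \<in> carrier G \<and> b \<in> B \<and> b' \<in> B}"

definition defined_over :: "'a set \<Rightarrow> 'c set \<Rightarrow> bool" where
  "defined_over L B \<longleftrightarrow> (\<forall>g\<in>carrier G. \<forall>b\<in>B. \<exists>a\<in>B \<rightarrow> L. act g b = lincomb a B)"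

lemma structure_constants_closed:
  assumes "cyclic_piece B v"
  shows "structure_constants B \<subseteq> carrier K"
proof -
  have B: "finite B" "B \<subseteq> carrier V" "lin_indpt B" "invariant (span B)"
    using assms by (auto simp: cyclic_piece_def)
  show ?thesis
    using coord_cl[OF B(1-3)] invariantD(3)[OF B(4)] in_own_span[OF B(2)]
    by (auto simp: structure_constants_def)
qed

lemma defined_over_structure_constants:
  assumes "cyclic_piece B v" and L: "structure_constants B \<subseteq> L"
  shows "defined_over L B"
  unfolding defined_over_def
proof (intro ballI)
  fix g b assume g: "g \<in> carrier G" and b: "b \<in> B"
  have B: "finite B" "B \<subseteq> carrier V" "lin_indpt B" "invariant (span B)"
    using assms by (auto simp: cyclic_piece_def)
  have "act g b \<in> span B" using invariantD(3)[OF B(4) g] in_own_span[OF B(2)] b by blast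
  then have "lincomb (coord B (act g b)) B = act g b" by (rule coord_spec(2)[OF B(1,2)])
  moreover have "coord B (act g b) \<in> B \<rightarrow> L"
    using L g b by (auto simp: structure_constants_def)
  ultimately show "\<exists>a\<in>B \<rightarrow> L. act g b = lincomb a B" by metis
qed

text \<open>Each basis \<open>B\<close> in the family contributes \<open>card B - 1\<close> linear conditions on a derivation: that the averaged
connection maps the generator \<open>v B\<close> to a multiple of itself.\<close>

lemma trdeg_structure_constants:
  assumes char: "char_zero K" and F: "subring F K" and fin: "finite \<B>"
    and pieces: "\<And>B. B \<in> \<B> \<Longrightarrow> cyclic_piece B (v B)"
  shows "trdeg (K\<lparr>carrier := constant_field K F (\<Union>B\<in>\<B>. structure_constants B)\<rparr>) F
    \<le> enat (card (SIGMA B:\<B>. B - {v B}))"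
proof -
  have FK: "F \<subseteq> carrier K" by (rule subringE(1)[OF F])
  have B: "finite B" "B \<subseteq> carrier V" "lin_indpt B" "invariant (span B)" "v B \<in> B"
      "B \<subseteq> (\<lambda>g. act g (v B)) ` carrier G" if "B \<in> \<B>" for B
    using pieces[OF that] by (auto simp: cyclic_piece_def)
  have vS: "v B \<in> span B" if "B \<in> \<B>" for B
    using in_own_span[OF B(2)[OF that]] B(5)[OF that] by blast
  define \<phi> where "\<phi> = (\<lambda>(B, b) D. coord B (average (connection B D) (v B)) b)"
  show ?thesis
  proof (rule trdeg_constant_field[where \<phi> = \<phi>])
    show "(\<Union>B\<in>\<B>. structure_constants B) \<subseteq> carrier K"
      using structure_constants_closed[OF pieces] by blast
    show "finite (SIGMA B:\<B>. B - {v B})" using fin B(1) by auto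
  next
    fix i D assume i: "i \<in> (SIGMA B:\<B>. B - {v B})" and D: "derivation K F D"
    obtain A b where Ab: "i = (A, b)" "A \<in> \<B>" "b \<in> A" using i by auto
    note A = B[OF Ab(2)]
    note N = average_connection_span[OF A(1-4) FK D vS[OF Ab(2)]]
    show "\<phi> i D \<in> carrier K"
      using coord_cl[OF A(1-3) N Ab(3)] by (simp add: \<phi>_def Ab(1))
    fix E c assume E: "derivation K F E" and c: "c \<in> carrier K"
    note N' = average_connection_span[OF A(1-4) FK E vS[OF Ab(2)]]
    show "\<phi> i (\<lambda>x. D x \<oplus>\<^bsub>K\<^esub> c \<otimes>\<^bsub>K\<^esub> E x) = \<phi> i D \<oplus>\<^bsub>K\<^esub> c \<otimes>\<^bsub>K\<^esub> \<phi> i E"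
      unfolding \<phi>_def Ab(1) prod.case average_connection_lincomb[OF A(1-4) FK D E c vS[OF Ab(2)]]
        coord_add[OF A(1-3) N subspaceD(4)[OF invariantD(1)[OF A(4)] c N'] Ab(3)]
        coord_smult[OF A(1-3) N' c Ab(3)] ..
  next
    fix D p assume D: "derivation K F D" and 0: "\<forall>i\<in>(SIGMA B:\<B>. B - {v B}). \<phi> i D = \<zero>\<^bsub>K\<^esub>"
      and "p \<in> (\<Union>B\<in>\<B>. structure_constants B)"
    then obtain A g b b' where A: "A \<in> \<B>" and p: "p = coord A (act g b) b'"
      and g: "g \<in> carrier G" "b \<in> A" "b' \<in> A" by (auto simp: structure_constants_def)
    note A' = B[OF A]
    show "D p = \<zero>\<^bsub>K\<^esub>"
      unfolding p
    proof (rule structure_constants_rigid[OF A'(1-4) FK D char A'(5,6) _ g])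
      fix x assume "x \<in> A - {v A}"
      then show "coord A (average (connection A D) (v A)) x = \<zero>\<^bsub>K\<^esub>"
        using 0 A by (auto simp: \<phi>_def)
    qed
  qed (use char F in auto)
qed

text \<open>Among the families of cyclic bases of irreducible subspaces whose union is independent, one with the
largest union spans \<open>V\<close>, since otherwise \<open>irreducible_outside\<close> provides a further member.\<close>

lemma irreducible_decomposition:
  assumes fd: "fin_dim" and char: "char_zero K"
  shows "\<exists>\<B>. finite \<B> \<and> disjoint \<B> \<and> finite (\<Union>\<B>) \<and> \<Union>\<B> \<subseteq> carrier V \<and> lin_indpt (\<Union>\<B>) \<and>
    span (\<Union>\<B>) = carrier V \<and> (\<forall>B\<in>\<B>. irreducible (span B) \<and> (\<exists>v. cyclic_piece B v))"
proof -
  define Q where "Q \<B> \<longleftrightarrow> disjoint \<B> \<and> \<Union>\<B> \<subseteq> carrier V \<and> lin_indpt (\<Union>\<B>) \<and>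
     (\<forall>B\<in>\<B>. irreducible (span B) \<and> (\<exists>v. cyclic_piece B v))" for \<B>
  have Q0: "Q {}" using lin_indpt_empty by (simp add: Q_def)
  have fin: "finite (\<Union>\<B>)" "card (\<Union>\<B>) \<le> dim" if "Q \<B>" for \<B>
    using li_le_dim[OF fd] that by (auto simp: Q_def)
  have "\<exists>\<B>. Q \<B> \<and> (\<forall>\<C>. Q \<C> \<longrightarrow> card (\<Union>\<C>) \<le> card (\<Union>\<B>))"
    by (rule ex_has_greatest_nat[of Q "{}" "\<lambda>\<B>. card (\<Union>\<B>)" "Suc dim", OF Q0]) (use fin(2) in fastforce)
  then obtain \<B> where QB: "Q \<B>" and max: "\<And>\<C>. Q \<C> \<Longrightarrow> card (\<Union>\<C>) \<le> card (\<Union>\<B>)"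
    by auto
  have UV: "\<Union>\<B> \<subseteq> carrier V" and li: "lin_indpt (\<Union>\<B>)" using QB by (auto simp: Q_def)
  have inv: "invariant (span (\<Union>\<B>))"
  proof (rule invariant_span[OF UV])
    fix g a assume g: "g \<in> carrier G" and "a \<in> \<Union>\<B>"
    then obtain B where B: "B \<in> \<B>" "a \<in> B" by blast
    then have "invariant (span B)" using QB by (auto simp: Q_def irreducible_def)
    moreover have "B \<subseteq> carrier V" using UV B by blast
    ultimately have "act g a \<in> span B" using invariantD(3)[OF _ g] B(2) in_own_span by blast
    then show "act g a \<in> span (\<Union>\<B>)" using span_is_monotone[of B "\<Union>\<B>"] B(1) by blast
  qed
  have "span (\<Union>\<B>) = carrier V"
  proof (rule ccontr)
    assume "span (\<Union>\<B>) \<noteq> carrier V"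
    then obtain U where U: "irreducible U" "U \<inter> span (\<Union>\<B>) \<subseteq> {\<zero>\<^bsub>V\<^esub>}"
      using irreducible_outside[OF fd char inv] by blast
    obtain B v where B: "finite B" "B \<subseteq> carrier V" "lin_indpt B" "span B = U" "v \<in> B"
        "B \<subseteq> (\<lambda>g. act g v) ` carrier G"
      using cyclic_basis[OF U(1)] by blast
    have disj: "B \<inter> \<Union>\<B> = {}" and li': "lin_indpt (B \<union> \<Union>\<B>)"
      using lin_indpt_Un[OF B(1-3) fin(1)[OF QB] UV li] U(2) B(4) by auto
    have "cyclic_piece B v" using B U(1) by (auto simp: cyclic_piece_def irreducible_def)
    then have "Q (insert B \<B>)"
      using QB B U(1) disj li' UV unfolding Q_def
      by (auto simp: disjoint_def)
    then have "card (B \<union> \<Union>\<B>) \<le> card (\<Union>\<B>)" using max[of "insert B \<B>"] by simp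
    moreover have "card (B \<union> \<Union>\<B>) = card B + card (\<Union>\<B>)"
      by (rule card_Un_disjoint[OF B(1) fin(1)[OF QB] disj])
    ultimately have "card B = 0" by simp
    then show False using B(1,5) by auto
  qed
  moreover have "finite \<B>"
    by (rule finite_subset[of _ "Pow (\<Union>\<B>)"]) (use fin(1)[OF QB] in auto)
  ultimately show ?thesis using QB fin(1)[OF QB] unfolding Q_def by blast
qed

lemma lincomb_extend:
  assumes "finite A" "A \<subseteq> carrier V" "finite B" "B \<subseteq> carrier V" "A \<inter> B = {}" "a \<in> A \<rightarrow> carrier K"
  shows "lincomb (\<lambda>x. if x \<in> A then a x else \<zero>\<^bsub>K\<^esub>) (A \<union> B) = lincomb a A"
proof -
  let ?a = "\<lambda>x. if x \<in> A then a x else \<zero>\<^bsub>K\<^esub>"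
  have cl: "?a \<in> A \<union> B \<rightarrow> carrier K" using assms(6) by auto
  have "lincomb ?a (A \<union> B) = lincomb ?a A \<oplus>\<^bsub>V\<^esub> lincomb ?a B"
    by (rule lincomb_union[OF assms(2,4,5,1,3) cl])
  also have "lincomb ?a A = lincomb a A"
    by (rule lincomb_cong[OF refl assms(2)]) (use assms(6) in auto)
  also have "lincomb ?a B = \<zero>\<^bsub>V\<^esub>" by (rule lincomb_zero[OF assms(4)]) (use assms(5) in auto)
  finally show ?thesis using lincomb_closed[OF assms(2,6)] by simp
qed

lemma defined_over_Un:
  assumes A: "finite A" "A \<subseteq> carrier V" "defined_over L A" and B: "finite B" "B \<subseteq> carrier V" "defined_over L B"
    and disj: "A \<inter> B = {}" and L: "L \<subseteq> carrier K" "\<zero>\<^bsub>K\<^esub> \<in> L"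
  shows "defined_over L (A \<union> B)"
  unfolding defined_over_def
proof (intro ballI)
  have LK: "a \<in> Y \<rightarrow> carrier K" if "a \<in> Y \<rightarrow> L" for a :: "'c \<Rightarrow> 'a" and Y
    using that L(1) by auto
  fix g b assume g: "g \<in> carrier G" and "b \<in> A \<union> B"
  then consider "b \<in> A" | "b \<in> B" by blast
  then show "\<exists>a\<in>A \<union> B \<rightarrow> L. act g b = lincomb a (A \<union> B)"
  proof cases
    case 1
    then obtain a where a: "a \<in> A \<rightarrow> L" "act g b = lincomb a A" using A(3) g unfolding defined_over_def by blast
    then have "act g b = lincomb (\<lambda>x. if x \<in> A then a x else \<zero>\<^bsub>K\<^esub>) (A \<union> B)"
      using lincomb_extend[OF A(1,2) B(1,2) disj, of a] LK[OF a(1)] by simp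
    then show ?thesis using a(1) L(2) by (intro bexI) auto
  next
    case 2
    then obtain a where a: "a \<in> B \<rightarrow> L" "act g b = lincomb a B" using B(3) g unfolding defined_over_def by blast
    then have "act g b = lincomb (\<lambda>x. if x \<in> B then a x else \<zero>\<^bsub>K\<^esub>) (A \<union> B)"
      using lincomb_extend[OF B(1,2) A(1,2), of a] LK[OF a(1)] disj by (simp add: Int_commute Un_commute)
    then show ?thesis using a(1) L(2) by (intro bexI) auto
  qed
qed

lemma defined_over_invariant:
  assumes B: "finite B" "B \<subseteq> carrier V" "defined_over L B" and L: "L \<subseteq> carrier K"
  shows "invariant (span B)"
proof (rule invariant_span[OF B(2)])
  fix g b assume "g \<in> carrier G" "b \<in> B"
  then obtain a where a: "a \<in> B \<rightarrow> L" "act g b = lincomb a B" using B(3) unfolding defined_over_def by blast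
  then show "act g b \<in> span B" using lincomb_in_span[OF B(1,2), of a] L by auto
qed

end

section \<open>Intertwining maps\<close>

locale intertwiner = V: linear_action K V G act + W: linear_action K W G act'
  for K :: "('a, 'm) ring_scheme" and V :: "('a, 'c, 'd) module_scheme" and G :: "('g, 'h) monoid_scheme"
    and act and W :: "('a, 'e, 'f) module_scheme" and act' +
  fixes T :: "'c \<Rightarrow> 'e"
  assumes T_closed: "v \<in> carrier V \<Longrightarrow> T v \<in> carrier W"
    and T_add: "v \<in> carrier V \<Longrightarrow> w \<in> carrier V \<Longrightarrow> T (v \<oplus>\<^bsub>V\<^esub> w) = T v \<oplus>\<^bsub>W\<^esub> T w"
    and T_smult: "c \<in> carrier K \<Longrightarrow> v \<in> carrier V \<Longrightarrow> T (c \<odot>\<^bsub>V\<^esub> v) = c \<odot>\<^bsub>W\<^esub> T v"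
    and T_act: "g \<in> carrier G \<Longrightarrow> v \<in> carrier V \<Longrightarrow> T (act g v) = act' g (T v)"
begin

lemma T_zero: "T \<zero>\<^bsub>V\<^esub> = \<zero>\<^bsub>W\<^esub>"
  using T_smult[of "\<zero>\<^bsub>K\<^esub>" "\<zero>\<^bsub>V\<^esub>"] T_closed[of "\<zero>\<^bsub>V\<^esub>"] by simp

lemma T_lincomb:
  assumes "finite B" "B \<subseteq> carrier V" "a \<in> B \<rightarrow> carrier K"
  shows "T (V.lincomb a B) = (\<Oplus>\<^bsub>W\<^esub>b\<in>B. a b \<odot>\<^bsub>W\<^esub> T b)"
  using assms
proof (induction B)
  case empty
  then show ?case by (simp add: V.lincomb_def T_zero)
next
  case (insert x B)
  then have x: "x \<in> carrier V" "a x \<in> carrier K" and B: "B \<subseteq> carrier V" "a \<in> B \<rightarrow> carrier K" by auto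
  have "V.lincomb a (insert x B) = a x \<odot>\<^bsub>V\<^esub> x \<oplus>\<^bsub>V\<^esub> V.lincomb a B"
    unfolding V.lincomb_def
    by (rule V.M.finsum_insert) (use insert.hyps x B in auto)
  then have "T (V.lincomb a (insert x B)) = a x \<odot>\<^bsub>W\<^esub> T x \<oplus>\<^bsub>W\<^esub> T (V.lincomb a B)"
    using x V.lincomb_closed[OF B] by (simp add: T_add T_smult)
  also have "\<dots> = (\<Oplus>\<^bsub>W\<^esub>b\<in>insert x B. a b \<odot>\<^bsub>W\<^esub> T b)"
    unfolding insert.IH[OF B]
    by (rule W.M.finsum_insert[symmetric]) (use insert.hyps x B T_closed in auto)
  finally show ?case .
qed

lemma lincomb_image:
  assumes "finite B" "B \<subseteq> carrier V" "inj_on T B" "c \<in> T ` B \<rightarrow> carrier K"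
  shows "W.lincomb c (T ` B) = T (V.lincomb (\<lambda>b. c (T b)) B)"
proof -
  have "W.lincomb c (T ` B) = (\<Oplus>\<^bsub>W\<^esub>b\<in>B. c (T b) \<odot>\<^bsub>W\<^esub> T b)"
    unfolding W.lincomb_def
    by (rule W.M.finsum_reindex) (use assms T_closed in auto)
  also have "\<dots> = T (V.lincomb (\<lambda>b. c (T b)) B)"
    by (rule T_lincomb[symmetric]) (use assms in auto)
  finally show ?thesis .
qed

text \<open>Schur's lemma relative to the invariant subspace \<open>span C\<close>: the vectors of \<open>span B\<close> that \<open>T\<close> maps into
\<open>span C\<close> form a proper invariant subspace of \<open>span B\<close>, so only \<open>0\<close> does. This gives at once that \<open>T\<close> is
injective on \<open>span B\<close> and that its image meets \<open>span C\<close> in \<open>0\<close> only.\<close>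

lemma irreducible_image:
  assumes B: "finite B" "B \<subseteq> carrier V" "V.lin_indpt B" "V.irreducible (V.span B)"
    and C: "W.invariant (W.span C)" and b: "b \<in> B" "T b \<notin> W.span C"
  shows "inj_on T B" "W.lin_indpt (T ` B)" "W.span (T ` B) \<inter> W.span C \<subseteq> {\<zero>\<^bsub>W\<^esub>}"
proof -
  have CS: "subspace K (W.span C) W" using C by (simp add: W.invariant_def)
  have BI: "V.invariant (V.span B)" using B(4) by (simp add: V.irreducible_def)
  have BS: "subspace K (V.span B) V" using BI by (simp add: V.invariant_def)
  define N where "N = {u \<in> V.span B. T u \<in> W.span C}"
  have NV: "N \<subseteq> V.span B" by (auto simp: N_def)
  have uV: "u \<in> carrier V" if "u \<in> V.span B" for u using V.subspaceD(1)[OF BS] that by blast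
  have "subspace K N V"
    by (rule V.subspaceI)
      (use V.subspaceD[OF BS] W.subspaceD[OF CS] uV in \<open>auto simp: N_def T_zero T_add T_smult\<close>)
  then have "V.invariant N"
    using BI C uV by (auto simp: V.invariant_def W.invariant_def N_def T_act)
  moreover have "N \<noteq> V.span B" using b V.in_own_span[OF B(2)] by (auto simp: N_def)
  ultimately have N0: "N = {\<zero>\<^bsub>V\<^esub>}" using B(4) NV by (auto simp: V.irreducible_def)
  have ker: "u = \<zero>\<^bsub>V\<^esub>" if "u \<in> V.span B" "T u \<in> W.span C" for u
    using that N0 by (auto simp: N_def)
  show inj: "inj_on T B"
  proof (rule inj_onI)
    fix x y assume xy: "x \<in> B" "y \<in> B" "T x = T y"
    have xyV: "x \<in> carrier V" "y \<in> carrier V" using xy B(2) by auto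
    have xyS: "x \<in> V.span B" "y \<in> V.span B" using xy V.in_own_span[OF B(2)] by auto
    let ?m = "(\<ominus>\<^bsub>K\<^esub> \<one>\<^bsub>K\<^esub>) \<odot>\<^bsub>V\<^esub> y"
    have "T (x \<oplus>\<^bsub>V\<^esub> ?m) = T y \<oplus>\<^bsub>W\<^esub> (\<ominus>\<^bsub>K\<^esub> \<one>\<^bsub>K\<^esub>) \<odot>\<^bsub>W\<^esub> T y"
      using xyV xy(3) by (simp add: T_add T_smult)
    also have "\<dots> = \<zero>\<^bsub>W\<^esub>"
      using T_closed[OF xyV(2)] by (simp add: W.smult_l_minus W.M.r_neg)
    finally have "T (x \<oplus>\<^bsub>V\<^esub> ?m) \<in> W.span C" using W.subspaceD(2)[OF CS] by simp
    moreover have "x \<oplus>\<^bsub>V\<^esub> ?m \<in> V.span B"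
      using xyS by (intro V.subspaceD(3,4)[OF BS]) auto
    ultimately have "x \<oplus>\<^bsub>V\<^esub> ?m = \<zero>\<^bsub>V\<^esub>" using ker by blast
    then have "x \<oplus>\<^bsub>V\<^esub> \<ominus>\<^bsub>V\<^esub> y = \<zero>\<^bsub>V\<^esub>" using xyV by (simp add: V.smult_l_minus)
    then show "x = y" using xyV by (metis V.M.minus_equality V.M.minus_minus V.M.a_inv_closed)
  qed
  have TB: "finite (T ` B)" "T ` B \<subseteq> carrier W" using B T_closed by auto
  have cT: "(\<lambda>b. c (T b)) \<in> B \<rightarrow> carrier K" if "c \<in> T ` B \<rightarrow> carrier K" for c using that by auto
  note img = lincomb_image[OF B(1,2) inj]
  show "W.lin_indpt (T ` B)"
  proof (rule W.finite_lin_indpt2[OF TB])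
    fix c assume c: "c \<in> T ` B \<rightarrow> carrier K" and "W.lincomb c (T ` B) = \<zero>\<^bsub>W\<^esub>"
    then have "T (V.lincomb (\<lambda>b. c (T b)) B) \<in> W.span C"
      using img W.subspaceD(2)[OF CS] by simp
    then have "V.lincomb (\<lambda>b. c (T b)) B = \<zero>\<^bsub>V\<^esub>"
      by (rule ker[OF V.lincomb_in_span[OF B(1,2) cT[OF c]]])
    then show "\<forall>v\<in>T ` B. c v = \<zero>\<^bsub>K\<^esub>"
      using V.not_lindepD[OF B(3,1) subset_refl cT[OF c]] by auto
  qed
  show "W.span (T ` B) \<inter> W.span C \<subseteq> {\<zero>\<^bsub>W\<^esub>}"
  proof
    fix x assume x: "x \<in> W.span (T ` B) \<inter> W.span C"
    then obtain c where c: "c \<in> T ` B \<rightarrow> carrier K" "W.lincomb c (T ` B) = x"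
      using W.finite_in_span[OF TB] by blast
    then have "V.lincomb (\<lambda>b. c (T b)) B = \<zero>\<^bsub>V\<^esub>"
      using x img by (intro ker[OF V.lincomb_in_span[OF B(1,2) cT]]) auto
    then show "x \<in> {\<zero>\<^bsub>W\<^esub>}" using c img T_zero by simp
  qed
qed

lemma defined_over_image:
  assumes B: "finite B" "B \<subseteq> carrier V" "V.defined_over L B" and inj: "inj_on T B" and L: "L \<subseteq> carrier K"
  shows "W.defined_over L (T ` B)"
  unfolding W.defined_over_def
proof (intro ballI)
  fix g x assume g: "g \<in> carrier G" and "x \<in> T ` B"
  then obtain b where b: "b \<in> B" "x = T b" by blast
  obtain a where a: "a \<in> B \<rightarrow> L" "act g b = V.lincomb a B"
    using B(3) g b(1) unfolding V.defined_over_def by blast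
  define c where "c y = a (the_inv_into B T y)" for y
  have cT: "c (T y) = a y" if "y \<in> B" for y using that inj by (simp add: c_def the_inv_into_f_f)
  have cL: "c \<in> T ` B \<rightarrow> L" using cT a(1) by auto
  have "b \<in> carrier V" using b(1) B(2) by blast
  then have "act' g x = T (V.lincomb a B)" using T_act[OF g, of b] b(2) a(2) by simp
  also have "V.lincomb a B = V.lincomb (\<lambda>b. c (T b)) B"
    by (rule V.lincomb_cong[OF refl B(2)]) (use cT a(1) L in auto)
  also have "T \<dots> = W.lincomb c (T ` B)"
    by (rule lincomb_image[OF B(1,2) inj, symmetric]) (use cL L in auto)
  finally show "\<exists>c\<in>T ` B \<rightarrow> L. act' g x = W.lincomb c (T ` B)" using cL by blast
qed

end

section \<open>The regular representation\<close>

definition regular_action :: "('g, 'h) monoid_scheme \<Rightarrow> 'g \<Rightarrow> ('g \<Rightarrow> 'a) \<Rightarrow> 'g \<Rightarrow> 'a" where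
  "regular_action G g f = (\<lambda>x\<in>carrier G. f (inv\<^bsub>G\<^esub> g \<otimes>\<^bsub>G\<^esub> x))"

abbreviation regular_space :: "('a, 'm) ring_scheme \<Rightarrow> ('g, 'h) monoid_scheme \<Rightarrow> ('a, 'g \<Rightarrow> 'a) module" where
  "regular_space K G \<equiv> ring.func_space K (carrier G)"

definition regular_delta :: "('a, 'm) ring_scheme \<Rightarrow> ('g, 'h) monoid_scheme \<Rightarrow> 'g \<Rightarrow> 'g \<Rightarrow> 'a" where
  "regular_delta K G g = (\<lambda>x\<in>carrier G. if x = g then \<one>\<^bsub>K\<^esub> else \<zero>\<^bsub>K\<^esub>)"

lemma (in ring) func_space_simps:
  "carrier (func_space S) = S \<rightarrow>\<^sub>E carrier R"
  "f \<oplus>\<^bsub>func_space S\<^esub> f' = (\<lambda>x\<in>S. f x \<oplus> f' x)"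
  "\<zero>\<^bsub>func_space S\<^esub> = (\<lambda>x\<in>S. \<zero>)"
  "c \<odot>\<^bsub>func_space S\<^esub> f = (\<lambda>x\<in>S. c \<otimes> f x)"
  by (simp_all add: func_space_def)

lemma func_space_is_vectorspace:
  assumes "field K" shows "vectorspace K (ring.func_space K S)"
proof -
  interpret field K by fact
  show ?thesis
    using func_space_is_module assms
    by (simp add: vectorspace_def module_def)
qed

lemma regular_linear_action:
  assumes K: "field K" and G: "group G" "finite (carrier G)"
  shows "linear_action K (regular_space K G) G (regular_action G)"
proof -
  let ?Reg = "regular_space K G"
  interpret K: field K by fact
  interpret G: group G by fact
  interpret V: vectorspace K ?Reg by (rule func_space_is_vectorspace[OF K])
  show ?thesis
  proof (intro linear_action.intro linear_action_axioms.intro)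
    fix g h v w c
    assume v: "v \<in> carrier ?Reg"
    then show "regular_action G \<one>\<^bsub>G\<^esub> v = v"
      by (auto simp: regular_action_def K.func_space_simps PiE_def extensional_def)
    assume g: "g \<in> carrier G"
    show "regular_action G g v \<in> carrier ?Reg"
      using g v by (auto simp: regular_action_def K.func_space_simps)
    show "regular_action G (g \<otimes>\<^bsub>G\<^esub> h) v = regular_action G g (regular_action G h v)" if h: "h \<in> carrier G"
      using g h by (auto simp: regular_action_def G.inv_mult_group G.m_assoc fun_eq_iff restrict_def)
    show "regular_action G g (v \<oplus>\<^bsub>?Reg\<^esub> w) =
        regular_action G g v \<oplus>\<^bsub>?Reg\<^esub> regular_action G g w"
      using g by (auto simp: regular_action_def K.func_space_simps fun_eq_iff restrict_def)
    show "regular_action G g (c \<odot>\<^bsub>?Reg\<^esub> v) = c \<odot>\<^bsub>?Reg\<^esub> regular_action G g v"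
      using g by (auto simp: regular_action_def K.func_space_simps fun_eq_iff restrict_def)
  qed (use G V.vectorspace_axioms in auto)
qed

lemma regular_space_generated:
  assumes K: "field K" and fin: "finite (carrier G)"
  shows "regular_delta K G ` carrier G \<subseteq> carrier (regular_space K G)"
    and "module.span K (regular_space K G) (regular_delta K G ` carrier G) = carrier (regular_space K G)"
proof -
  let ?Reg = "regular_space K G"
  interpret K: field K by fact
  interpret V: vectorspace K ?Reg by (rule func_space_is_vectorspace[OF K])
  let ?\<delta> = "regular_delta K G"
  have \<delta>: "?\<delta> g \<in> carrier ?Reg" for g
    by (auto simp: regular_delta_def K.func_space_simps)
  then show sub: "?\<delta> ` carrier G \<subseteq> carrier ?Reg" by blast
  have pointwise: "finsum ?Reg F A x = (\<Oplus>\<^bsub>K\<^esub>a\<in>A. F a x)"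
    if "finite A" "F \<in> A \<rightarrow> carrier ?Reg" "x \<in> carrier G" for F :: "'c \<Rightarrow> _" and A x
    using that(1,2)
  proof induction
    case (insert a A)
    then have cl: "F a \<in> carrier ?Reg" "F \<in> A \<rightarrow> carrier ?Reg" by auto
    have val: "F b x \<in> carrier K" if "b \<in> insert a A" for b
      using insert.prems that \<open>x \<in> carrier G\<close> by (auto simp: K.func_space_simps PiE_def Pi_def)
    have "finsum ?Reg F (insert a A) = F a \<oplus>\<^bsub>?Reg\<^esub> finsum ?Reg F A"
      by (rule V.M.finsum_insert) (use insert.hyps cl in auto)
    then have "finsum ?Reg F (insert a A) x = F a x \<oplus>\<^bsub>K\<^esub> (\<Oplus>\<^bsub>K\<^esub>a\<in>A. F a x)"
      using insert.IH[OF cl(2)] \<open>x \<in> carrier G\<close> by (simp add: K.func_space_simps)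
    also have "\<dots> = (\<Oplus>\<^bsub>K\<^esub>a\<in>insert a A. F a x)"
      by (rule K.finsum_insert[symmetric]) (use insert.hyps val in auto)
    finally show ?case .
  qed (use that(3) in \<open>simp add: K.func_space_simps\<close>)
  have "f \<in> V.span (?\<delta> ` carrier G)" if f: "f \<in> carrier ?Reg" for f
  proof -
    have fK: "f g \<in> carrier K" if "g \<in> carrier G" for g
      using f that by (auto simp: K.func_space_simps PiE_def Pi_def)
    have S: "subspace K (V.span (?\<delta> ` carrier G)) ?Reg"
      by (rule V.span_is_subspace[OF sub])
    have cl: "(\<lambda>g. f g \<odot>\<^bsub>?Reg\<^esub> ?\<delta> g) \<in> carrier G \<rightarrow> V.span (?\<delta> ` carrier G)"
      using V.subspaceD(4)[OF S] fK V.in_own_span[OF sub] by auto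
    have "(\<Oplus>\<^bsub>?Reg\<^esub>g\<in>carrier G. f g \<odot>\<^bsub>?Reg\<^esub> ?\<delta> g) = f"
    proof (rule extensionalityI[of _ "carrier G"])
      have "(\<Oplus>\<^bsub>?Reg\<^esub>g\<in>carrier G. f g \<odot>\<^bsub>?Reg\<^esub> ?\<delta> g) \<in> carrier ?Reg"
        using V.subspaceD(1,5)[OF S] cl by blast
      then show "(\<Oplus>\<^bsub>?Reg\<^esub>g\<in>carrier G. f g \<odot>\<^bsub>?Reg\<^esub> ?\<delta> g) \<in> extensional (carrier G)"
        by (simp add: K.func_space_simps PiE_def)
      show "f \<in> extensional (carrier G)" using f by (simp add: K.func_space_simps PiE_def)
      fix x assume x: "x \<in> carrier G"
      have "(\<Oplus>\<^bsub>?Reg\<^esub>g\<in>carrier G. f g \<odot>\<^bsub>?Reg\<^esub> ?\<delta> g) x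
          = (\<Oplus>\<^bsub>K\<^esub>g\<in>carrier G. (f g \<odot>\<^bsub>?Reg\<^esub> ?\<delta> g) x)"
        by (rule pointwise[OF fin _ x]) (use fK \<delta> in auto)
      also have "\<dots> = (\<Oplus>\<^bsub>K\<^esub>g\<in>carrier G. if x = g then f g else \<zero>\<^bsub>K\<^esub>)"
        by (rule K.finsum_cong') (use x fK in \<open>auto simp: K.func_space_simps regular_delta_def\<close>)
      also have "\<dots> = f x" by (rule K.add.finprod_singleton[OF x fin]) (use fK in auto)
      finally show "(\<Oplus>\<^bsub>?Reg\<^esub>g\<in>carrier G. f g \<odot>\<^bsub>?Reg\<^esub> ?\<delta> g) x = f x" .
    qed
    then show ?thesis using V.subspaceD(5)[OF S cl] by simp
  qed
  then show "V.span (?\<delta> ` carrier G) = carrier ?Reg"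
    using V.span_is_subset2[OF sub] by blast
qed

context linear_action
begin

text \<open>The map from the regular representation to \<open>V\<close> that sends \<open>\<Sum>h. f h \<cdot> h\<close> to \<open>(\<Sum>h. f h \<cdot> h) w\<close>.\<close>

definition orbit_map :: "'c \<Rightarrow> ('g \<Rightarrow> 'a) \<Rightarrow> 'c" where
  "orbit_map w f = (\<Oplus>\<^bsub>V\<^esub>h\<in>carrier G. f h \<odot>\<^bsub>V\<^esub> act h w)"

lemma orbit_map_intertwiner:
  assumes w: "w \<in> carrier V"
  shows "intertwiner K (regular_space K G) G (regular_action G) V act (orbit_map w)"
proof -
  let ?Reg = "regular_space K G"
  interpret reg: linear_action K ?Reg G "regular_action G"
    by (rule regular_linear_action) (unfold_locales, rule finite_group)
  have val: "f h \<in> carrier K" if "f \<in> carrier ?Reg" "h \<in> carrier G" for f h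
    using that by (auto simp: R.func_space_simps PiE_def Pi_def)
  have aw: "act h w \<in> carrier V" if "h \<in> carrier G" for h using act_closed[OF that w] .
  show ?thesis
  proof (intro intertwiner.intro intertwiner_axioms.intro)
    fix f assume f: "f \<in> carrier ?Reg"
    show "orbit_map w f \<in> carrier V"
      unfolding orbit_map_def by (rule M.finsum_closed) (use val[OF f] aw in auto)
    show "orbit_map w (c \<odot>\<^bsub>?Reg\<^esub> f) = c \<odot>\<^bsub>V\<^esub> orbit_map w f" if c: "c \<in> carrier K" for c
    proof -
      have "orbit_map w (c \<odot>\<^bsub>?Reg\<^esub> f) = (\<Oplus>\<^bsub>V\<^esub>h\<in>carrier G. c \<odot>\<^bsub>V\<^esub> (f h \<odot>\<^bsub>V\<^esub> act h w))"
        unfolding orbit_map_def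
        by (rule M.finsum_cong') (use val[OF f] aw c in \<open>auto simp: R.func_space_simps smult_assoc1\<close>)
      also have "\<dots> = c \<odot>\<^bsub>V\<^esub> orbit_map w f"
        unfolding orbit_map_def
        by (rule finsum_smult[symmetric]) (use val[OF f] aw c finite_group in auto)
      finally show ?thesis .
    qed
    show "orbit_map w (f \<oplus>\<^bsub>?Reg\<^esub> f') = orbit_map w f \<oplus>\<^bsub>V\<^esub> orbit_map w f'"
      if f': "f' \<in> carrier ?Reg" for f'
    proof -
      have "orbit_map w (f \<oplus>\<^bsub>?Reg\<^esub> f')
          = (\<Oplus>\<^bsub>V\<^esub>h\<in>carrier G. f h \<odot>\<^bsub>V\<^esub> act h w \<oplus>\<^bsub>V\<^esub> f' h \<odot>\<^bsub>V\<^esub> act h w)"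
        unfolding orbit_map_def
        by (rule M.finsum_cong') (use val[OF f] val[OF f'] aw in \<open>auto simp: R.func_space_simps smult_l_distr\<close>)
      also have "\<dots> = orbit_map w f \<oplus>\<^bsub>V\<^esub> orbit_map w f'"
        unfolding orbit_map_def by (rule M.finsum_addf) (use val[OF f] val[OF f'] aw in auto)
      finally show ?thesis .
    qed
    show "orbit_map w (regular_action G g f) = act g (orbit_map w f)" if g: "g \<in> carrier G" for g
    proof -
      let ?F = "\<lambda>h. regular_action G g f h \<odot>\<^bsub>V\<^esub> act h w"
      have F: "?F h \<in> carrier V" if "h \<in> carrier G" for h
        using val[OF reg.act_closed[OF g f]] aw that by auto
      have img: "(\<lambda>h. g \<otimes>\<^bsub>G\<^esub> h) ` carrier G = carrier G" by (rule G.surj_const_mult[OF g])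
      have "orbit_map w (regular_action G g f) = (\<Oplus>\<^bsub>V\<^esub>h\<in>(\<lambda>h. g \<otimes>\<^bsub>G\<^esub> h) ` carrier G. ?F h)"
        unfolding orbit_map_def img ..
      also have "\<dots> = (\<Oplus>\<^bsub>V\<^esub>h\<in>carrier G. ?F (g \<otimes>\<^bsub>G\<^esub> h))"
        by (rule M.finsum_reindex) (use img F G.inj_on_cmult[OF g] in auto)
      also have "\<dots> = (\<Oplus>\<^bsub>V\<^esub>h\<in>carrier G. act g (f h \<odot>\<^bsub>V\<^esub> act h w))"
      proof (rule M.finsum_cong')
        fix h assume h: "h \<in> carrier G"
        have "inv\<^bsub>G\<^esub> g \<otimes>\<^bsub>G\<^esub> (g \<otimes>\<^bsub>G\<^esub> h) = h" using g h by (simp add: G.m_assoc[symmetric])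
        then show "?F (g \<otimes>\<^bsub>G\<^esub> h) = act g (f h \<odot>\<^bsub>V\<^esub> act h w)"
          using g h w val[OF f h] aw[OF h] by (simp add: regular_action_def act_mult act_smult)
      qed (use g val[OF f] aw act_closed in auto)
      also have "\<dots> = act g (orbit_map w f)"
        unfolding orbit_map_def
        by (rule act_finsum[symmetric]) (use g val[OF f] aw finite_group in auto)
      finally show ?thesis .
    qed
  qed (fact reg.linear_action_axioms linear_action_axioms)+
qed

lemma orbit_map_delta_one:
  assumes w: "w \<in> carrier V"
  shows "orbit_map w (regular_delta K G \<one>\<^bsub>G\<^esub>) = w"
proof -
  have "orbit_map w (regular_delta K G \<one>\<^bsub>G\<^esub>) = (\<Oplus>\<^bsub>V\<^esub>h\<in>carrier G. if \<one>\<^bsub>G\<^esub> = h then act h w else \<zero>\<^bsub>V\<^esub>)"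
    unfolding orbit_map_def
    by (rule M.finsum_cong') (use act_closed w in \<open>auto simp: regular_delta_def\<close>)
  also have "\<dots> = act \<one>\<^bsub>G\<^esub> w"
    by (rule M.add.finprod_singleton) (use act_closed w finite_group in auto)
  finally show ?thesis using act_one[OF w] by simp
qed

end

text \<open>Take a largest independent set \<open>C\<close> whose structure constants are in \<open>L\<close>. If some \<open>w\<close> were not in its span,
the map \<open>orbit_map w\<close>, which has \<open>w\<close> in its image, would send some basis vector of an irreducible summand of
the regular representation outside \<open>span C\<close>. The image of the basis of this summand has the
same structure constants and could be added to \<open>C\<close>.\<close>

theorem basis_defined_over:
  assumes action: "linear_action K V G act" and fd: "vectorspace.fin_dim K V"
    and L: "L \<subseteq> carrier K" "\<zero>\<^bsub>K\<^esub> \<in> L"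
    and \<B>: "\<And>B. B \<in> \<B> \<Longrightarrow> finite B \<and> B \<subseteq> carrier (regular_space K G) \<and>
        \<not> module.lin_dep K (regular_space K G) B \<and>
        linear_action.irreducible K (regular_space K G) G (regular_action G) (module.span K (regular_space K G) B) \<and>
        linear_action.defined_over (regular_space K G) G (regular_action G) L B"
    and gen: "module.span K (regular_space K G) (\<Union>\<B>) = carrier (regular_space K G)"
  shows "\<exists>C. finite C \<and> C \<subseteq> carrier V \<and> \<not> module.lin_dep K V C \<and> module.span K V C = carrier V \<and>
    linear_action.defined_over V G act L C"
proof -
  let ?Reg = "regular_space K G"
  interpret V: linear_action K V G act by (rule action)
  define Q where "Q C \<longleftrightarrow> C \<subseteq> carrier V \<and> V.lin_indpt C \<and> V.defined_over L C" for C
  have Q0: "Q {}" using V.lin_indpt_empty by (simp add: Q_def V.defined_over_def)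
  have finQ: "finite C" "card C \<le> V.dim" if "Q C" for C
    using V.li_le_dim[OF fd] that by (auto simp: Q_def)
  have "\<exists>C. Q C \<and> (\<forall>C'. Q C' \<longrightarrow> card C' \<le> card C)"
    by (rule ex_has_greatest_nat[of Q "{}" card "Suc V.dim", OF Q0]) (use finQ(2) in fastforce)
  then obtain C where QC: "Q C" and max: "\<And>C'. Q C' \<Longrightarrow> card C' \<le> card C"
    by auto
  have C: "finite C" "C \<subseteq> carrier V" "V.lin_indpt C" "V.defined_over L C"
    using QC finQ(1) by (auto simp: Q_def)
  have invC: "V.invariant (V.span C)" by (rule V.defined_over_invariant[OF C(1,2,4) L(1)])
  have "w \<in> V.span C" if w: "w \<in> carrier V" for w
  proof (rule ccontr)
    assume n: "w \<notin> V.span C"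
    interpret T: intertwiner K ?Reg G "regular_action G" V act "V.orbit_map w"
      by (rule V.orbit_map_intertwiner[OF w])
    have UV: "\<Union>\<B> \<subseteq> carrier ?Reg" using \<B> by blast
    have "\<exists>b\<in>\<Union>\<B>. V.orbit_map w b \<notin> V.span C"
    proof (rule ccontr)
      assume a: "\<not> (\<exists>b\<in>\<Union>\<B>. V.orbit_map w b \<notin> V.span C)"
      note S = V.subspaceD[OF V.invariantD(1)[OF invC]]
      have "subspace K {f \<in> carrier ?Reg. V.orbit_map w f \<in> V.span C} ?Reg"
        by (rule T.V.subspaceI) (auto simp: T.T_zero T.T_add T.T_smult S)
      then have "T.V.span (\<Union>\<B>) \<subseteq> {f \<in> carrier ?Reg. V.orbit_map w f \<in> V.span C}"
        using T.V.subspaceD(6) a UV by blast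
      moreover have "regular_delta K G \<one>\<^bsub>G\<^esub> \<in> carrier ?Reg"
        by (auto simp: regular_delta_def V.R.func_space_simps)
      ultimately have "V.orbit_map w (regular_delta K G \<one>\<^bsub>G\<^esub>) \<in> V.span C" using gen by blast
      then show False using n V.orbit_map_delta_one[OF w] by simp
    qed
    then obtain B b where Bb: "B \<in> \<B>" "b \<in> B" "V.orbit_map w b \<notin> V.span C" by blast
    have B: "finite B" "B \<subseteq> carrier ?Reg" "T.V.lin_indpt B" "T.V.irreducible (T.V.span B)"
      "T.V.defined_over L B" using \<B>[OF Bb(1)] by auto
    let ?TB = "V.orbit_map w ` B"
    note img = T.irreducible_image[OF B(1-4) invC Bb(2,3)]
    have TB: "finite ?TB" "?TB \<subseteq> carrier V" using B T.T_closed by auto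
    have disj: "?TB \<inter> C = {}" and li: "V.lin_indpt (?TB \<union> C)"
      using V.lin_indpt_Un[OF TB img(2) C(1-3) img(3)] by auto
    have "V.defined_over L (?TB \<union> C)"
      by (rule V.defined_over_Un[OF TB T.defined_over_image[OF B(1,2,5) img(1) L(1)] C(1,2,4) disj L])
    then have "Q (?TB \<union> C)" using TB C li by (auto simp: Q_def)
    then have "card (?TB \<union> C) \<le> card C" by (rule max)
    moreover have "card (?TB \<union> C) = card ?TB + card C" by (rule card_Un_disjoint[OF TB(1) C(1) disj])
    ultimately have "card ?TB = 0" by simp
    then show False using TB(1) Bb(2) by auto
  qed
  then have "V.span C = carrier V" using V.span_is_subset2[OF C(2)] by blast
  then show ?thesis using C by blast
qed

section \<open>Column vectors and matrices\<close>

lemma (in abelian_monoid) finsum_swap: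
  assumes "finite A" "finite B" "\<And>i j. i \<in> A \<Longrightarrow> j \<in> B \<Longrightarrow> f i j \<in> carrier G"
  shows "(\<Oplus>i\<in>A. \<Oplus>j\<in>B. f i j) = (\<Oplus>j\<in>B. \<Oplus>i\<in>A. f i j)"
  using assms(1,3)
proof induction
  case (insert a A)
  have "(\<Oplus>i\<in>insert a A. \<Oplus>j\<in>B. f i j) = (\<Oplus>j\<in>B. f a j) \<oplus> (\<Oplus>i\<in>A. \<Oplus>j\<in>B. f i j)"
    by (rule finsum_insert) (use insert in auto)
  also have "\<dots> = (\<Oplus>j\<in>B. f a j) \<oplus> (\<Oplus>j\<in>B. \<Oplus>i\<in>A. f i j)"
    using insert by simp
  also have "\<dots> = (\<Oplus>j\<in>B. f a j \<oplus> (\<Oplus>i\<in>A. f i j))"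
    by (rule finsum_addf[symmetric]) (use insert.prems in auto)
  also have "\<dots> = (\<Oplus>j\<in>B. \<Oplus>i\<in>insert a A. f i j)"
    by (intro finsum_cong' refl) (use insert in \<open>auto simp: finsum_insert\<close>)
  finally show ?case .
qed simp

lemma col_space_simps:
  "carrier (col_space R n) = {v \<in> carrier_vec n. \<forall>i<n. v $ i \<in> carrier R}"
  "\<zero>\<^bsub>col_space R n\<^esub> = vec n (\<lambda>_. \<zero>\<^bsub>R\<^esub>)"
  "v \<oplus>\<^bsub>col_space R n\<^esub> w = vec n (\<lambda>i. v $ i \<oplus>\<^bsub>R\<^esub> w $ i)"
  "c \<odot>\<^bsub>col_space R n\<^esub> v = vec n (\<lambda>i. c \<otimes>\<^bsub>R\<^esub> v $ i)"
  by (simp_all add: col_space_def)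

lemma col_space_dim: "v \<in> carrier (col_space R n) \<Longrightarrow> dim_vec v = n"
  by (simp add: col_space_simps)

lemma mat_vec_index: "i < n \<Longrightarrow> mat_vec R n A v $ i = (\<Oplus>\<^bsub>R\<^esub>j\<in>{..<n}. A $$ (i, j) \<otimes>\<^bsub>R\<^esub> v $ j)"
  by (simp add: mat_vec_def)

lemma mat_monoid_simps:
  "carrier (mat_monoid R n) = {A \<in> carrier_mat n n. \<forall>i<n. \<forall>j<n. A $$ (i, j) \<in> carrier R}"
  "A \<otimes>\<^bsub>mat_monoid R n\<^esub> B = mat n n (\<lambda>(i, j). \<Oplus>\<^bsub>R\<^esub>l\<in>{..<n}. A $$ (i, l) \<otimes>\<^bsub>R\<^esub> B $$ (l, j))"
  "\<one>\<^bsub>mat_monoid R n\<^esub> = mat n n (\<lambda>(i, j). if i = j then \<one>\<^bsub>R\<^esub> else \<zero>\<^bsub>R\<^esub>)"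
  by (simp_all add: mat_monoid_def)

definition mat_column :: "nat \<Rightarrow> 'b mat \<Rightarrow> nat \<Rightarrow> 'b vec" where
  "mat_column n A j = vec n (\<lambda>i. A $$ (i, j))"

definition unit_column :: "('b, 'm) ring_scheme \<Rightarrow> nat \<Rightarrow> nat \<Rightarrow> 'b vec" where
  "unit_column R n j = vec n (\<lambda>i. if i = j then \<one>\<^bsub>R\<^esub> else \<zero>\<^bsub>R\<^esub>)"

lemma mat_eq_by_columns:
  assumes "A \<in> carrier_mat n n" "B \<in> carrier_mat n n"
    and "\<And>j. j < n \<Longrightarrow> mat_column n A j = mat_column n B j"
  shows "A = B"
proof (rule eq_matI)
  fix i j assume "i < dim_row B" "j < dim_col B"
  then have ij: "i < n" "j < n" using assms(2) by auto
  show "A $$ (i, j) = B $$ (i, j)"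
    using arg_cong[OF assms(3)[OF ij(2)], of "\<lambda>v. v $ i"] ij(1) by (simp add: mat_column_def)
qed (use assms in auto)

context cring
begin

lemma mat_column_closed: "A \<in> carrier (mat_monoid R n) \<Longrightarrow> j < n \<Longrightarrow> mat_column n A j \<in> carrier (col_space R n)"
  by (auto simp: mat_monoid_simps col_space_simps mat_column_def)

lemma mat_column_one: "j < n \<Longrightarrow> mat_column n \<one>\<^bsub>mat_monoid R n\<^esub> j = unit_column R n j"
  by (auto simp: mat_monoid_simps mat_column_def unit_column_def)

lemma unit_column_closed: "unit_column R n j \<in> carrier (col_space R n)"
  by (auto simp: col_space_simps unit_column_def)

lemma mat_column_mult:
  assumes "A \<in> carrier (mat_monoid R n)" "B \<in> carrier (mat_monoid R n)" "j < n"
  shows "mat_column n (A \<otimes>\<^bsub>mat_monoid R n\<^esub> B) j = mat_vec R n A (mat_column n B j)"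
proof (rule eq_vecI)
  fix i assume "i < dim_vec (mat_vec R n A (mat_column n B j))"
  then have i: "i < n" by (simp add: mat_vec_def)
  have "(\<Oplus>l\<in>{..<n}. A $$ (i, l) \<otimes> B $$ (l, j)) = (\<Oplus>l\<in>{..<n}. A $$ (i, l) \<otimes> mat_column n B j $ l)"
    by (rule finsum_cong') (use assms i in \<open>auto simp: mat_column_def mat_monoid_simps\<close>)
  then show "mat_column n (A \<otimes>\<^bsub>mat_monoid R n\<^esub> B) j $ i = mat_vec R n A (mat_column n B j) $ i"
    using assms(3) i by (simp add: mat_monoid_simps mat_column_def[of _ "mat _ _ _"] mat_vec_def)
qed (simp add: mat_vec_def mat_column_def)

lemma mat_vec_closed:
  "A \<in> carrier (mat_monoid R n) \<Longrightarrow> v \<in> carrier (col_space R n) \<Longrightarrow> mat_vec R n A v \<in> carrier (col_space R n)"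
  by (auto simp: mat_vec_def mat_monoid_simps col_space_simps intro!: finsum_closed)

lemma mat_vec_one: "v \<in> carrier (col_space R n) \<Longrightarrow> mat_vec R n \<one>\<^bsub>mat_monoid R n\<^esub> v = v"
proof -
  assume v: "v \<in> carrier (col_space R n)"
  show ?thesis
  proof (rule eq_vecI)
    fix i assume "i < dim_vec v"
    then have i: "i < n" using col_space_dim[OF v] by simp
    have "mat_vec R n \<one>\<^bsub>mat_monoid R n\<^esub> v $ i = (\<Oplus>j\<in>{..<n}. if i = j then v $ j else \<zero>)"
      unfolding mat_vec_index[OF i]
      by (rule finsum_cong') (use i v in \<open>auto simp: mat_monoid_simps col_space_simps\<close>)
    also have "\<dots> = v $ i"
      by (rule add.finprod_singleton) (use i v in \<open>auto simp: col_space_simps\<close>)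
    finally show "mat_vec R n \<one>\<^bsub>mat_monoid R n\<^esub> v $ i = v $ i" .
  qed (use v in \<open>simp add: mat_vec_def col_space_dim\<close>)
qed

lemma mat_mult_closed:
  "A \<in> carrier (mat_monoid R n) \<Longrightarrow> B \<in> carrier (mat_monoid R n) \<Longrightarrow>
    A \<otimes>\<^bsub>mat_monoid R n\<^esub> B \<in> carrier (mat_monoid R n)"
  by (auto simp: mat_monoid_simps intro!: finsum_closed)

lemma mat_vec_mult:
  assumes A: "A \<in> carrier (mat_monoid R n)" and B: "B \<in> carrier (mat_monoid R n)"
    and v: "v \<in> carrier (col_space R n)"
  shows "mat_vec R n (A \<otimes>\<^bsub>mat_monoid R n\<^esub> B) v = mat_vec R n A (mat_vec R n B v)"
proof (rule eq_vecI)
  fix i assume "i < dim_vec (mat_vec R n A (mat_vec R n B v))"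
  then have i: "i < n" by (simp add: mat_vec_def)
  have cl: "A $$ (p, q) \<in> carrier R" "B $$ (p, q) \<in> carrier R" "v $ p \<in> carrier R" if "p < n" "q < n" for p q
    using A B v that by (auto simp: mat_monoid_simps col_space_simps)
  have "mat_vec R n (A \<otimes>\<^bsub>mat_monoid R n\<^esub> B) v $ i
      = (\<Oplus>j\<in>{..<n}. (\<Oplus>l\<in>{..<n}. A $$ (i, l) \<otimes> B $$ (l, j)) \<otimes> v $ j)"
    unfolding mat_vec_index[OF i]
    by (rule finsum_cong') (use i cl in \<open>auto simp: mat_monoid_simps intro!: finsum_closed\<close>)
  also have "\<dots> = (\<Oplus>j\<in>{..<n}. \<Oplus>l\<in>{..<n}. A $$ (i, l) \<otimes> (B $$ (l, j) \<otimes> v $ j))"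
    using i cl by (intro finsum_cong') (auto simp: finsum_ldistr m_assoc intro!: finsum_cong')
  also have "\<dots> = (\<Oplus>l\<in>{..<n}. \<Oplus>j\<in>{..<n}. A $$ (i, l) \<otimes> (B $$ (l, j) \<otimes> v $ j))"
    by (rule finsum_swap) (use i cl in auto)
  also have "\<dots> = (\<Oplus>l\<in>{..<n}. A $$ (i, l) \<otimes> (\<Oplus>j\<in>{..<n}. B $$ (l, j) \<otimes> v $ j))"
    using i cl by (intro finsum_cong') (auto simp: finsum_rdistr intro!: finsum_closed)
  also have "\<dots> = mat_vec R n A (mat_vec R n B v) $ i"
    unfolding mat_vec_index[OF i]
    by (rule finsum_cong') (use i cl in \<open>auto simp: mat_vec_index intro!: m_closed finsum_closed\<close>)
  finally show "mat_vec R n (A \<otimes>\<^bsub>mat_monoid R n\<^esub> B) v $ i = mat_vec R n A (mat_vec R n B v) $ i" .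
qed (simp add: mat_vec_def)

lemma mat_monoid_monoid: "Group.monoid (mat_monoid R n)"
proof (rule Group.monoidI)
  fix A B C assume A: "A \<in> carrier (mat_monoid R n)" and B: "B \<in> carrier (mat_monoid R n)"
    and C: "C \<in> carrier (mat_monoid R n)"
  show "(A \<otimes>\<^bsub>mat_monoid R n\<^esub> B) \<otimes>\<^bsub>mat_monoid R n\<^esub> C = A \<otimes>\<^bsub>mat_monoid R n\<^esub> (B \<otimes>\<^bsub>mat_monoid R n\<^esub> C)"
  proof (rule mat_eq_by_columns[of _ n])
    fix j assume "j < n"
    then show "mat_column n ((A \<otimes>\<^bsub>mat_monoid R n\<^esub> B) \<otimes>\<^bsub>mat_monoid R n\<^esub> C) j =
        mat_column n (A \<otimes>\<^bsub>mat_monoid R n\<^esub> (B \<otimes>\<^bsub>mat_monoid R n\<^esub> C)) j"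
      using A B C by (simp add: mat_column_mult mat_mult_closed mat_vec_mult mat_column_closed)
  qed (simp_all add: mat_monoid_simps)
  have one: "\<one>\<^bsub>mat_monoid R n\<^esub> \<in> carrier (mat_monoid R n)" by (auto simp: mat_monoid_simps)
  show "A \<otimes>\<^bsub>mat_monoid R n\<^esub> \<one>\<^bsub>mat_monoid R n\<^esub> = A"
  proof (rule mat_eq_by_columns[of _ n])
    fix j assume j: "j < n"
    show "mat_column n (A \<otimes>\<^bsub>mat_monoid R n\<^esub> \<one>\<^bsub>mat_monoid R n\<^esub>) j = mat_column n A j"
      unfolding mat_column_mult[OF A one j] mat_column_one[OF j]
    proof (rule eq_vecI)
      fix i assume "i < dim_vec (mat_column n A j)"
      then have i: "i < n" by (simp add: mat_column_def)
      have "mat_vec R n A (unit_column R n j) $ i = (\<Oplus>l\<in>{..<n}. if j = l then A $$ (i, l) else \<zero>)"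
        unfolding mat_vec_index[OF i]
        by (rule finsum_cong') (use i A in \<open>auto simp: mat_monoid_simps unit_column_def\<close>)
      also have "\<dots> = A $$ (i, j)"
        by (rule add.finprod_singleton) (use i j A in \<open>auto simp: mat_monoid_simps\<close>)
      finally show "mat_vec R n A (unit_column R n j) $ i = mat_column n A j $ i"
        using i by (simp add: mat_column_def)
    qed (simp add: mat_vec_def mat_column_def)
  qed (use A in \<open>simp_all add: mat_monoid_simps\<close>)
  show "\<one>\<^bsub>mat_monoid R n\<^esub> \<otimes>\<^bsub>mat_monoid R n\<^esub> A = A"
  proof (rule mat_eq_by_columns[of _ n])
    fix j assume "j < n"
    then show "mat_column n (\<one>\<^bsub>mat_monoid R n\<^esub> \<otimes>\<^bsub>mat_monoid R n\<^esub> A) j = mat_column n A j"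
      using A one by (simp add: mat_column_mult mat_vec_one mat_column_closed)
  qed (use A in \<open>simp_all add: mat_monoid_simps\<close>)
qed (auto simp: mat_mult_closed, auto simp: mat_monoid_simps)

lemma mat_vec_add:
  assumes A: "A \<in> carrier (mat_monoid R n)" and v: "v \<in> carrier (col_space R n)" and w: "w \<in> carrier (col_space R n)"
  shows "mat_vec R n A (v \<oplus>\<^bsub>col_space R n\<^esub> w) = mat_vec R n A v \<oplus>\<^bsub>col_space R n\<^esub> mat_vec R n A w"
proof (rule eq_vecI)
  fix i assume "i < dim_vec (mat_vec R n A v \<oplus>\<^bsub>col_space R n\<^esub> mat_vec R n A w)"
  then have i: "i < n" by (simp add: col_space_simps)
  have cl: "A $$ (i, q) \<in> carrier R" "v $ q \<in> carrier R" "w $ q \<in> carrier R" if "q < n" for q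
    using A v w that i by (auto simp: mat_monoid_simps col_space_simps)
  have "mat_vec R n A (v \<oplus>\<^bsub>col_space R n\<^esub> w) $ i = (\<Oplus>j\<in>{..<n}. A $$ (i, j) \<otimes> v $ j \<oplus> A $$ (i, j) \<otimes> w $ j)"
    unfolding mat_vec_index[OF i]
    by (rule finsum_cong') (use i cl in \<open>auto simp: col_space_simps r_distr\<close>)
  also have "\<dots> = (\<Oplus>j\<in>{..<n}. A $$ (i, j) \<otimes> v $ j) \<oplus> (\<Oplus>j\<in>{..<n}. A $$ (i, j) \<otimes> w $ j)"
    by (rule finsum_addf) (use cl in auto)
  finally show "mat_vec R n A (v \<oplus>\<^bsub>col_space R n\<^esub> w) $ i
      = (mat_vec R n A v \<oplus>\<^bsub>col_space R n\<^esub> mat_vec R n A w) $ i"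
    using i by (simp add: mat_vec_def col_space_simps)
qed (simp add: mat_vec_def col_space_simps)

lemma mat_vec_smult:
  assumes A: "A \<in> carrier (mat_monoid R n)" and c: "c \<in> carrier R" and v: "v \<in> carrier (col_space R n)"
  shows "mat_vec R n A (c \<odot>\<^bsub>col_space R n\<^esub> v) = c \<odot>\<^bsub>col_space R n\<^esub> mat_vec R n A v"
proof (rule eq_vecI)
  fix i assume "i < dim_vec (c \<odot>\<^bsub>col_space R n\<^esub> mat_vec R n A v)"
  then have i: "i < n" by (simp add: col_space_simps)
  have cl: "A $$ (i, q) \<in> carrier R" "v $ q \<in> carrier R" if "q < n" for q
    using A v that i by (auto simp: mat_monoid_simps col_space_simps)
  have "mat_vec R n A (c \<odot>\<^bsub>col_space R n\<^esub> v) $ i = (\<Oplus>j\<in>{..<n}. c \<otimes> (A $$ (i, j) \<otimes> v $ j))"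
    unfolding mat_vec_index[OF i]
    by (rule finsum_cong') (use i cl c in \<open>auto simp: col_space_simps m_lcomm\<close>)
  also have "\<dots> = c \<otimes> (\<Oplus>j\<in>{..<n}. A $$ (i, j) \<otimes> v $ j)"
    by (rule finsum_rdistr[symmetric]) (use cl c in auto)
  finally show "mat_vec R n A (c \<odot>\<^bsub>col_space R n\<^esub> v) $ i = (c \<odot>\<^bsub>col_space R n\<^esub> mat_vec R n A v) $ i"
    using i by (simp add: mat_vec_def col_space_simps)
qed (simp add: mat_vec_def col_space_simps)

end

lemma col_space_vectorspace:
  assumes "field K" shows "vectorspace K (col_space K n)"
proof -
  interpret field K by fact
  show ?thesis
  proof (rule vs_criteria[OF assms])
    show "\<forall>v\<in>carrier (col_space K n). \<exists>w\<in>carrier (col_space K n). v \<oplus>\<^bsub>col_space K n\<^esub> w = \<zero>\<^bsub>col_space K n\<^esub>"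
    proof
      fix v assume "v \<in> carrier (col_space K n)"
      then show "\<exists>w\<in>carrier (col_space K n). v \<oplus>\<^bsub>col_space K n\<^esub> w = \<zero>\<^bsub>col_space K n\<^esub>"
        by (intro bexI[of _ "vec n (\<lambda>i. \<ominus>\<^bsub>K\<^esub> v $ i)"]) (auto simp: col_space_simps r_neg)
    qed
  qed (auto simp: col_space_simps a_ac m_assoc l_distr r_distr intro!: eq_vecI)
qed

lemma GL_group:
  assumes "field K" shows "group (GL K n)"
proof -
  interpret field K by fact
  show ?thesis unfolding GL_def by (rule monoid.units_group[OF mat_monoid_monoid])
qed

lemma GL_simps:
  "carrier (GL R n) = Units (mat_monoid R n)"
  "A \<otimes>\<^bsub>GL R n\<^esub> B = A \<otimes>\<^bsub>mat_monoid R n\<^esub> B"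
  "\<one>\<^bsub>GL R n\<^esub> = \<one>\<^bsub>mat_monoid R n\<^esub>"
  by (simp_all add: GL_def units_of_def)

lemma representation_linear_action:
  assumes K: "field K" and G: "group G" "finite (carrier G)" and rep: "representation K G n \<rho>"
  shows "linear_action K (col_space K n) G (\<lambda>g. mat_vec K n (\<rho> g))"
proof -
  interpret K: field K by fact
  interpret G: group G by fact
  interpret V: vectorspace K "col_space K n" by (rule col_space_vectorspace[OF K])
  have hom: "\<rho> \<in> hom G (GL K n)" using rep by (simp add: representation_def)
  interpret h: group_hom G "GL K n" \<rho>
    by (intro group_hom.intro group_hom_axioms.intro GL_group K G hom)
  have \<rho>: "\<rho> g \<in> carrier (mat_monoid K n)" if "g \<in> carrier G" for g
    using h.hom_closed[OF that] by (auto simp: GL_simps Units_def)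
  show ?thesis
  proof (intro linear_action.intro linear_action_axioms.intro)
    fix g h v assume "g \<in> carrier G" "h \<in> carrier G" "v \<in> carrier (col_space K n)"
    then show "mat_vec K n (\<rho> (g \<otimes>\<^bsub>G\<^esub> h)) v = mat_vec K n (\<rho> g) (mat_vec K n (\<rho> h) v)"
      using hom_mult[OF hom] K.mat_vec_mult \<rho> by (simp add: GL_simps)
  next
    fix v assume "v \<in> carrier (col_space K n)"
    then show "mat_vec K n (\<rho> \<one>\<^bsub>G\<^esub>) v = v" using h.hom_one K.mat_vec_one by (simp add: GL_simps)
  qed (use G K.mat_vec_closed K.mat_vec_add K.mat_vec_smult \<rho> V.vectorspace_axioms in auto)
qed

context
  fixes K :: "('b, 'm) ring_scheme" and n :: nat
  assumes K: "field K"
begin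

interpretation K: field K by (rule K)
interpretation V: vectorspace K "col_space K n" by (rule col_space_vectorspace[OF K])

lemma col_space_finsum:
  assumes "finite A" "F \<in> A \<rightarrow> carrier (col_space K n)" "i < n"
  shows "finsum (col_space K n) F A $ i = (\<Oplus>\<^bsub>K\<^esub>a\<in>A. F a $ i)"
  using assms(1,2)
proof induction
  case empty
  then show ?case using assms(3) by (simp add: col_space_simps)
next
  case (insert a A)
  have "finsum (col_space K n) F (insert a A) = F a \<oplus>\<^bsub>col_space K n\<^esub> finsum (col_space K n) F A"
    by (rule V.M.finsum_insert) (use insert in auto)
  then have "finsum (col_space K n) F (insert a A) $ i = F a $ i \<oplus>\<^bsub>K\<^esub> (\<Oplus>\<^bsub>K\<^esub>a\<in>A. F a $ i)"
    using insert assms(3) by (simp add: col_space_simps)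
  also have "\<dots> = (\<Oplus>\<^bsub>K\<^esub>a\<in>insert a A. F a $ i)"
    by (rule K.finsum_insert[symmetric]) (use insert assms(3) in \<open>auto simp: col_space_simps\<close>)
  finally show ?case .
qed

text \<open>This translates between linear combinations of a set of vectors and matrices, whose columns are
ordered by \<open>e\<close>.\<close>

lemma mat_vec_lincomb:
  assumes e: "bij_betw e {..<n} C" and C: "C \<subseteq> carrier (col_space K n)"
    and a: "a \<in> C \<rightarrow> carrier K"
  shows "mat_vec K n (mat n n (\<lambda>(i, j). e j $ i)) (vec n (\<lambda>l. a (e l))) = module.lincomb (col_space K n) a C"
proof -
  have fin: "finite C" using e bij_betw_finite by blast
  have eC: "e j \<in> C" if "j < n" for j using e that by (auto simp: bij_betw_def)
  have cl: "e j $ i \<in> carrier K" "a (e j) \<in> carrier K" if "i < n" "j < n" for i j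
    using eC[OF that(2)] C a that(1) by (auto simp: col_space_simps)
  have L: "V.lincomb a C \<in> carrier (col_space K n)" by (rule V.lincomb_closed[OF C a])
  show ?thesis
  proof (rule eq_vecI)
    fix i assume "i < dim_vec (V.lincomb a C)"
    then have i: "i < n" using col_space_dim[OF L] by simp
    have "V.lincomb a C $ i = (\<Oplus>\<^bsub>K\<^esub>c\<in>C. (a c \<odot>\<^bsub>col_space K n\<^esub> c) $ i)"
      unfolding V.lincomb_def by (rule col_space_finsum[OF fin _ i]) (use a C in auto)
    also have "\<dots> = (\<Oplus>\<^bsub>K\<^esub>c\<in>C. a c \<otimes>\<^bsub>K\<^esub> c $ i)"
      by (rule K.finsum_cong') (use i a C in \<open>auto simp: col_space_simps\<close>)
    also have "\<dots> = (\<Oplus>\<^bsub>K\<^esub>c\<in>e ` {..<n}. a c \<otimes>\<^bsub>K\<^esub> c $ i)"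
      using e by (simp add: bij_betw_def)
    also have "\<dots> = (\<Oplus>\<^bsub>K\<^esub>j\<in>{..<n}. a (e j) \<otimes>\<^bsub>K\<^esub> e j $ i)"
      by (rule K.finsum_reindex) (use e cl i in \<open>auto simp: bij_betw_def\<close>)
    also have "\<dots> = (\<Oplus>\<^bsub>K\<^esub>j\<in>{..<n}. e j $ i \<otimes>\<^bsub>K\<^esub> a (e j))"
      by (rule K.finsum_cong') (use i cl K.m_comm in auto)
    also have "\<dots> = mat_vec K n (mat n n (\<lambda>(i, j). e j $ i)) (vec n (\<lambda>l. a (e l))) $ i"
      unfolding mat_vec_index[OF i]
      by (rule K.finsum_cong') (use i cl in auto)
    finally show "mat_vec K n (mat n n (\<lambda>(i, j). e j $ i)) (vec n (\<lambda>l. a (e l))) $ i = V.lincomb a C $ i" ..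
  qed (use L in \<open>simp add: mat_vec_def col_space_dim\<close>)
qed

lemma unit_columns_basis:
  shows "V.basis (unit_column K n ` {..<n})" "inj_on (unit_column K n) {..<n}"
    "V.dim = n" "V.fin_dim"
proof -
  let ?U = "unit_column K n ` {..<n}"
  show inj: "inj_on (unit_column K n) {..<n}"
  proof (rule inj_onI)
    fix i j assume ij: "i \<in> {..<n}" "j \<in> {..<n}" "unit_column K n i = unit_column K n j"
    from arg_cong[OF ij(3), of "\<lambda>v. v $ i"] show "i = j"
      using ij(1,2) K.one_not_zero by (auto simp: unit_column_def split: if_splits)
  qed
  then have bij: "bij_betw (unit_column K n) {..<n} ?U" by (simp add: bij_betw_def)
  have U: "finite ?U" "?U \<subseteq> carrier (col_space K n)" using K.unit_column_closed by auto
  have one: "mat n n (\<lambda>(i, j). unit_column K n j $ i) = \<one>\<^bsub>mat_monoid K n\<^esub>"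
    by (auto simp: mat_monoid_simps unit_column_def intro!: eq_matI)
  have comb: "V.lincomb a ?U = vec n (\<lambda>l. a (unit_column K n l))" if a: "a \<in> ?U \<rightarrow> carrier K" for a
  proof -
    have "vec n (\<lambda>l. a (unit_column K n l)) \<in> carrier (col_space K n)"
      using a by (auto simp: col_space_simps)
    then show ?thesis
      using mat_vec_lincomb[OF bij U(2) a] K.mat_vec_one unfolding one by simp
  qed
  have "V.lin_indpt ?U"
  proof (rule V.finite_lin_indpt2[OF U])
    fix a assume a: "a \<in> ?U \<rightarrow> carrier K" and "V.lincomb a ?U = \<zero>\<^bsub>col_space K n\<^esub>"
    then have eq: "vec n (\<lambda>l. a (unit_column K n l)) = vec n (\<lambda>_. \<zero>\<^bsub>K\<^esub>)"
      using comb[OF a] by (simp add: col_space_simps)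
    have "a (unit_column K n l) = \<zero>\<^bsub>K\<^esub>" if "l < n" for l
      using arg_cong[OF eq, of "\<lambda>v. v $ l"] that by simp
    then show "\<forall>v\<in>?U. a v = \<zero>\<^bsub>K\<^esub>" by auto
  qed
  moreover have "v \<in> V.span ?U" if v: "v \<in> carrier (col_space K n)" for v
  proof -
    define a where "a u = v $ the_inv_into {..<n} (unit_column K n) u" for u
    have au: "a (unit_column K n l) = v $ l" if "l < n" for l
      using that inj by (simp add: a_def the_inv_into_f_f)
    then have a: "a \<in> ?U \<rightarrow> carrier K" using v by (auto simp: col_space_simps)
    have "V.lincomb a ?U = v"
      unfolding comb[OF a] using v au by (auto simp: col_space_simps intro!: eq_vecI)
    then show ?thesis using V.lincomb_in_span[OF U a] by simp
  qed
  ultimately show basis: "V.basis ?U"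
    using U V.span_is_subset2[OF U(2)] by (auto simp: V.basis_def)
  show "V.dim = n" using V.dim_basis[OF U(1) basis] card_image[OF inj] by simp
  show "V.fin_dim" using basis U by (auto simp: V.fin_dim_def V.basis_def)
qed

end

section \<open>Essential dimension\<close>

text \<open>The matrix \<open>P\<close> whose columns are the vectors of \<open>C\<close> conjugates \<open>\<rho>\<close> into a representation \<open>\<sigma>\<close> whose entries
are the structure constants of \<open>C\<close>. Since the entries of \<open>\<sigma> g\<close> and of its inverse \<open>\<sigma> (inv g)\<close> are all in
\<open>L\<close>, the matrices \<open>\<sigma> g\<close> are invertible over \<open>L\<close>.\<close>

lemma equivalent_rep_over_subfield:
  assumes K: "field K" and G: "group G" "finite (carrier G)" and rep: "representation K G n \<rho>"
    and L: "subfield L K"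
    and C: "finite C" "C \<subseteq> carrier (col_space K n)" "\<not> module.lin_dep K (col_space K n) C"
      "module.span K (col_space K n) C = carrier (col_space K n)"
    and def: "linear_action.defined_over (col_space K n) G (\<lambda>g. mat_vec K n (\<rho> g)) L C"
  shows "\<exists>\<sigma>. representation (K\<lparr>carrier := L\<rparr>) G n \<sigma> \<and> equivalent_reps K G n \<rho> \<sigma>"
proof -
  interpret K: field K by (rule K)
  interpret G: group G by (rule G)
  interpret V: linear_action K "col_space K n" G "\<lambda>g. mat_vec K n (\<rho> g)"
    by (rule representation_linear_action[OF K G rep])
  interpret GL: group "GL K n" by (rule GL_group[OF K])
  interpret M: Group.monoid "mat_monoid K n" by (rule K.mat_monoid_monoid)
  let ?V = "col_space K n" and ?M = "mat_monoid K n" and ?L = "K\<lparr>carrier := L\<rparr>"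
  have n1: "n \<ge> 1" and hom: "\<rho> \<in> hom G (GL K n)" using rep by (simp_all add: representation_def)
  have Ls: "subring L K" by (rule subfieldE(1)[OF L])
  have LK: "L \<subseteq> carrier K" by (rule subringE(1)[OF Ls])
  have \<rho>U: "\<rho> g \<in> Units ?M" if "g \<in> carrier G" for g
    using hom that by (auto simp: hom_def GL_simps)
  then have \<rho>M: "\<rho> g \<in> carrier ?M" if "g \<in> carrier G" for g using that M.Units_closed by blast
  have "card C = n"
    using V.dim_basis[OF C(1)] C unit_columns_basis(3)[OF K] by (simp add: V.basis_def)
  then obtain e where e: "bij_betw e {..<n} C"
    using ex_bij_betw_nat_finite[OF C(1)] by (auto simp: atLeast0LessThan)
  have eC: "e j \<in> C" "e j \<in> carrier ?V" if "j < n" for j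
    using e that C(2) by (auto simp: bij_betw_def)
  define P where "P = mat n n (\<lambda>(i, j). e j $ i)"
  have P: "P \<in> carrier ?M" using eC by (auto simp: P_def mat_monoid_simps col_space_simps)
  have P_col: "mat_column n P j = e j" if "j < n" for j
    using eC(2)[OF that] that by (auto simp: P_def mat_column_def col_space_simps intro!: eq_vecI)
  have P_lincomb: "mat_vec K n P (vec n (\<lambda>l. a (e l))) = V.lincomb a C" if "a \<in> C \<rightarrow> carrier K" for a
    unfolding P_def by (rule mat_vec_lincomb[OF K e C(2) that])
  have P_inj: "x = y" if x: "x \<in> carrier ?V" and y: "y \<in> carrier ?V"
    and eq: "mat_vec K n P x = mat_vec K n P y" for x y
  proof -
    define co where "co z c = z $ the_inv_into {..<n} e c" for z :: "'a vec" and c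
    have co: "co z (e l) = z $ l" if "l < n" for z l
      using e that by (simp add: co_def bij_betw_def the_inv_into_f_f)
    have co_cl: "co z \<in> C \<rightarrow> carrier K" if "z \<in> carrier ?V" for z
      using that co e by (auto simp: col_space_simps bij_betw_def)
    have co_vec: "vec n (\<lambda>l. co z (e l)) = z" if "z \<in> carrier ?V" for z
      using that co by (auto simp: col_space_simps intro!: eq_vecI)
    have "V.lincomb (co x) C = V.lincomb (co y) C"
      using eq P_lincomb[OF co_cl[OF x]] P_lincomb[OF co_cl[OF y]] co_vec[OF x] co_vec[OF y] by simp
    then have "x $ l = y $ l" if "l < n" for l
      using V.lincomb_unique[OF C(1-3) co_cl[OF x] co_cl[OF y] _ eC(1)[OF that]] co[OF that] by simp
    then show ?thesis using x y by (auto simp: col_space_simps intro!: eq_vecI)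
  qed
  have P_surj: "\<exists>x\<in>carrier ?V. mat_vec K n P x = v" if v: "v \<in> carrier ?V" for v
  proof -
    obtain a where a: "a \<in> C \<rightarrow> carrier K" "V.lincomb a C = v"
      using V.finite_in_span[OF C(1,2)] v C(4) by blast
    have "vec n (\<lambda>l. a (e l)) \<in> carrier ?V" using a(1) eC by (auto simp: col_space_simps)
    then show ?thesis using P_lincomb[OF a(1)] a(2) by blast
  qed
  obtain q where q: "\<And>j. q j \<in> carrier ?V" "\<And>j. mat_vec K n P (q j) = unit_column K n j"
    using P_surj[OF K.unit_column_closed] by metis
  define Q where "Q = mat n n (\<lambda>(i, j). q j $ i)"
  have Q: "Q \<in> carrier ?M" using q(1) by (auto simp: Q_def mat_monoid_simps col_space_simps)
  have Q_col: "mat_column n Q j = q j" if "j < n" for j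
    using q(1)[of j] that by (auto simp: Q_def mat_column_def col_space_simps intro!: eq_vecI)
  have PQ: "P \<otimes>\<^bsub>?M\<^esub> Q = \<one>\<^bsub>?M\<^esub>"
  proof (rule mat_eq_by_columns[of _ n])
    fix j assume j: "j < n"
    show "mat_column n (P \<otimes>\<^bsub>?M\<^esub> Q) j = mat_column n \<one>\<^bsub>?M\<^esub> j"
      unfolding K.mat_column_mult[OF P Q j] Q_col[OF j] q(2) K.mat_column_one[OF j] ..
  qed (simp_all add: mat_monoid_simps)
  \<comment> \<open>\<open>P (Q P) = P\<close>, and \<open>P\<close> is injective because its columns are independent.\<close>
  have QP: "Q \<otimes>\<^bsub>?M\<^esub> P = \<one>\<^bsub>?M\<^esub>"
  proof (rule mat_eq_by_columns[of _ n])
    fix j assume j: "j < n"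
    show "mat_column n (Q \<otimes>\<^bsub>?M\<^esub> P) j = mat_column n \<one>\<^bsub>?M\<^esub> j"
    proof (rule P_inj)
      have "mat_vec K n P (mat_column n (Q \<otimes>\<^bsub>?M\<^esub> P) j) = mat_column n (P \<otimes>\<^bsub>?M\<^esub> (Q \<otimes>\<^bsub>?M\<^esub> P)) j"
        using P Q j by (simp add: K.mat_column_mult)
      also have "P \<otimes>\<^bsub>?M\<^esub> (Q \<otimes>\<^bsub>?M\<^esub> P) = P \<otimes>\<^bsub>?M\<^esub> \<one>\<^bsub>?M\<^esub>"
        using P Q PQ by (simp add: M.m_assoc[symmetric])
      also have "mat_column n \<dots> j = mat_vec K n P (mat_column n \<one>\<^bsub>?M\<^esub> j)"
        by (rule K.mat_column_mult[OF P M.one_closed j])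
      finally show "mat_vec K n P (mat_column n (Q \<otimes>\<^bsub>?M\<^esub> P) j) = mat_vec K n P (mat_column n \<one>\<^bsub>?M\<^esub> j)" .
    qed (use j P Q in \<open>auto intro!: K.mat_column_closed\<close>)
  qed (simp_all add: mat_monoid_simps)
  have PU: "P \<in> Units ?M" and QU: "Q \<in> Units ?M" using P Q PQ QP by (auto simp: Units_def)
  have invQ: "inv\<^bsub>GL K n\<^esub> Q = P"
    by (rule GL.inv_equality) (use PU QU PQ in \<open>simp_all add: GL_simps\<close>)
  define \<sigma> where "\<sigma> g = Q \<otimes>\<^bsub>?M\<^esub> \<rho> g \<otimes>\<^bsub>?M\<^esub> P" for g
  have \<sigma>M: "\<sigma> g \<in> carrier ?M" if "g \<in> carrier G" for g
    using P Q \<rho>M[OF that] by (simp add: \<sigma>_def)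
  have \<sigma>L: "\<sigma> g $$ (i, j) \<in> L" if g: "g \<in> carrier G" and i: "i < n" and j: "j < n" for g i j
  proof -
    obtain a where a: "a \<in> C \<rightarrow> L" "mat_vec K n (\<rho> g) (e j) = V.lincomb a C"
      using def g eC(1)[OF j] unfolding V.defined_over_def by blast
    have aK: "a \<in> C \<rightarrow> carrier K" using a(1) LK by auto
    have "mat_vec K n P (mat_column n (\<sigma> g) j) = mat_column n (P \<otimes>\<^bsub>?M\<^esub> \<sigma> g) j"
      by (rule K.mat_column_mult[OF P \<sigma>M[OF g] j, symmetric])
    also have "P \<otimes>\<^bsub>?M\<^esub> \<sigma> g = \<rho> g \<otimes>\<^bsub>?M\<^esub> P"
      using P Q \<rho>M[OF g] PQ by (simp add: \<sigma>_def M.m_assoc[symmetric])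
    also have "mat_column n \<dots> j = mat_vec K n (\<rho> g) (e j)"
      unfolding K.mat_column_mult[OF \<rho>M[OF g] P j] P_col[OF j] ..
    also have "\<dots> = mat_vec K n P (vec n (\<lambda>l. a (e l)))"
      unfolding a(2) by (rule P_lincomb[OF aK, symmetric])
    finally have eq: "mat_vec K n P (mat_column n (\<sigma> g) j) = mat_vec K n P (vec n (\<lambda>l. a (e l)))" .
    have "vec n (\<lambda>l. a (e l)) \<in> carrier ?V" using aK eC by (auto simp: col_space_simps)
    from P_inj[OF K.mat_column_closed[OF \<sigma>M[OF g] j] this eq]
    have "mat_column n (\<sigma> g) j = vec n (\<lambda>l. a (e l))" .
    from arg_cong[OF this, of "\<lambda>v. v $ i"] have "\<sigma> g $$ (i, j) = a (e i)"
      using i by (simp add: mat_column_def)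
    then show ?thesis using a(1) eC(1)[OF i] by auto
  qed
  have \<sigma>_mult: "\<sigma> (g \<otimes>\<^bsub>G\<^esub> h) = \<sigma> g \<otimes>\<^bsub>?M\<^esub> \<sigma> h" if g: "g \<in> carrier G" and h: "h \<in> carrier G" for g h
  proof -
    note cl = P Q \<rho>M[OF g] \<rho>M[OF h]
    have "\<sigma> g \<otimes>\<^bsub>?M\<^esub> \<sigma> h = Q \<otimes>\<^bsub>?M\<^esub> \<rho> g \<otimes>\<^bsub>?M\<^esub> (P \<otimes>\<^bsub>?M\<^esub> Q) \<otimes>\<^bsub>?M\<^esub> \<rho> h \<otimes>\<^bsub>?M\<^esub> P"
      using cl by (simp add: \<sigma>_def M.m_assoc)
    also have "\<dots> = Q \<otimes>\<^bsub>?M\<^esub> (\<rho> g \<otimes>\<^bsub>?M\<^esub> \<rho> h) \<otimes>\<^bsub>?M\<^esub> P"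
      using cl by (simp add: PQ M.m_assoc)
    also have "\<rho> g \<otimes>\<^bsub>?M\<^esub> \<rho> h = \<rho> (g \<otimes>\<^bsub>G\<^esub> h)" using hom_mult[OF hom g h] by (simp add: GL_simps)
    finally show ?thesis by (simp add: \<sigma>_def)
  qed
  have carrier_sub: "carrier (mat_monoid ?L n) = {A \<in> carrier_mat n n. \<forall>i<n. \<forall>j<n. A $$ (i, j) \<in> L}"
    by (simp add: mat_monoid_simps)
  have \<sigma>_sub: "\<sigma> g \<in> carrier (mat_monoid ?L n)" if "g \<in> carrier G" for g
    using \<sigma>L[OF that] \<sigma>M[OF that] unfolding carrier_sub by (simp add: mat_monoid_simps)
  have multL: "A \<otimes>\<^bsub>mat_monoid ?L n\<^esub> B = A \<otimes>\<^bsub>?M\<^esub> B"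
    if "A \<in> carrier (mat_monoid ?L n)" "B \<in> carrier (mat_monoid ?L n)" for A B
  proof -
    have "(\<Oplus>\<^bsub>?L\<^esub>l\<in>{..<n}. A $$ (i, l) \<otimes>\<^bsub>K\<^esub> B $$ (l, j)) = (\<Oplus>\<^bsub>K\<^esub>l\<in>{..<n}. A $$ (i, l) \<otimes>\<^bsub>K\<^esub> B $$ (l, j))"
      if "i < n" "j < n" for i j
      by (rule K.subring_finsum[OF Ls])
        (use that \<open>A \<in> _\<close> \<open>B \<in> _\<close> subringE(6)[OF Ls] in \<open>auto simp: carrier_sub\<close>)
    then show ?thesis by (auto simp: mat_monoid_simps intro!: eq_matI)
  qed
  have oneL: "\<one>\<^bsub>mat_monoid ?L n\<^esub> = \<one>\<^bsub>?M\<^esub>"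
    by (simp add: mat_monoid_simps cong: if_cong)
  have \<sigma>_one: "\<sigma> \<one>\<^bsub>G\<^esub> = \<one>\<^bsub>?M\<^esub>"
  proof -
    interpret h: group_hom G "GL K n" \<rho>
      by (intro group_hom.intro group_hom_axioms.intro GL_group K G hom)
    have "\<rho> \<one>\<^bsub>G\<^esub> = \<one>\<^bsub>?M\<^esub>" using h.hom_one by (simp add: GL_simps)
    then show ?thesis using P Q QP by (simp add: \<sigma>_def)
  qed
  have \<sigma>U: "\<sigma> g \<in> Units (mat_monoid ?L n)" if g: "g \<in> carrier G" for g
  proof -
    have g': "inv\<^bsub>G\<^esub> g \<in> carrier G" using g by simp
    have "\<sigma> g \<otimes>\<^bsub>mat_monoid ?L n\<^esub> \<sigma> (inv\<^bsub>G\<^esub> g) = \<one>\<^bsub>mat_monoid ?L n\<^esub>"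
      "\<sigma> (inv\<^bsub>G\<^esub> g) \<otimes>\<^bsub>mat_monoid ?L n\<^esub> \<sigma> g = \<one>\<^bsub>mat_monoid ?L n\<^esub>"
      using g g' by (simp_all add: multL \<sigma>_sub oneL \<sigma>_mult[symmetric] \<sigma>_one)
    then show ?thesis using \<sigma>_sub[OF g] \<sigma>_sub[OF g'] by (auto simp: Units_def)
  qed
  have "\<sigma> \<in> hom G (GL ?L n)"
    unfolding hom_def using \<sigma>U \<sigma>_mult multL \<sigma>_sub by (auto simp: GL_simps)
  then have "representation ?L G n \<sigma>" using n1 by (simp add: representation_def)
  moreover have "equivalent_reps K G n \<rho> \<sigma>"
    unfolding equivalent_reps_def
    using QU invQ by (intro bexI[of _ Q]) (simp_all add: GL_simps \<sigma>_def)
  ultimately show ?thesis by blast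
qed

lemma ed_le:
  assumes "subfield L K" "F \<subseteq> L" "representation (K\<lparr>carrier := L\<rparr>) G n \<sigma>" "equivalent_reps K G n \<rho> \<sigma>"
    and "trdeg (K\<lparr>carrier := L\<rparr>) F \<le> m"
  shows "ed F K G n \<rho> \<le> m"
  unfolding ed_def by (rule INF_lower2[of L]) (use assms in auto)

text \<open>The difference to be bridged is that \<open>irreducible_rep\<close> speaks of submodules as additive subgroups
closed under scalars.\<close>

lemma irreducible_rep_action:
  assumes K: "field K" and G: "group G" "finite (carrier G)" and irr: "irreducible_rep K G n \<rho>"
  shows "linear_action.irreducible K (col_space K n) G (\<lambda>g. mat_vec K n (\<rho> g)) (carrier (col_space K n))"
proof -
  have rep: "representation K G n \<rho>" using irr by (simp add: irreducible_rep_def)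
  interpret K: field K by (rule K)
  interpret V: linear_action K "col_space K n" G "\<lambda>g. mat_vec K n (\<rho> g)"
    by (rule representation_linear_action[OF K G rep])
  let ?V = "col_space K n"
  have n1: "n \<ge> 1" using rep by (simp add: representation_def)
  have "unit_column K n 0 \<noteq> \<zero>\<^bsub>?V\<^esub>"
  proof
    assume "unit_column K n 0 = \<zero>\<^bsub>?V\<^esub>"
    from arg_cong[OF this, of "\<lambda>v. v $ 0"] show False
      using n1 K.one_not_zero by (simp add: unit_column_def col_space_simps)
  qed
  then have ne: "carrier ?V \<noteq> {\<zero>\<^bsub>?V\<^esub>}" using K.unit_column_closed by blast
  have "U = {\<zero>\<^bsub>?V\<^esub>} \<or> U = carrier ?V" if U: "V.invariant U" for U
  proof -
    note S = V.subspaceD[OF V.invariantD(1)[OF U]]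
    have "Module.submodule U K ?V"
    proof (intro Module.submodule.intro Module.submodule_axioms.intro subgroup.intro)
      fix x assume x: "x \<in> U"
      then have "(\<ominus>\<^bsub>K\<^esub> \<one>\<^bsub>K\<^esub>) \<odot>\<^bsub>?V\<^esub> x = \<ominus>\<^bsub>?V\<^esub> x"
        using S(1) by (auto simp: V.smult_l_minus)
      then show "inv\<^bsub>add_monoid ?V\<^esub> x \<in> U"
        using S(4)[of "\<ominus>\<^bsub>K\<^esub> \<one>\<^bsub>K\<^esub>" x] x by (simp add: a_inv_def)
    qed (use S in auto)
    moreover have "\<forall>g\<in>carrier G. \<forall>w\<in>U. mat_vec K n (\<rho> g) w \<in> U"
      using V.invariantD(3)[OF U] by blast
    ultimately show ?thesis using irr unfolding irreducible_rep_def by blast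
  qed
  moreover have "V.invariant (carrier ?V)"
    using V.whole_subspace V.act_closed by (simp add: V.invariant_def)
  ultimately show ?thesis using ne by (auto simp: V.irreducible_def)
qed

theorem ed_irreducible:
  assumes K: "field K" and char: "char_zero K" and G: "group G" "finite (carrier G)"
    and F: "subring F K" and irr: "irreducible_rep K G n \<rho>"
  shows "ed F K G n \<rho> \<le> enat (n - 1)"
proof -
  have rep: "representation K G n \<rho>" using irr by (simp add: irreducible_rep_def)
  interpret K: field K by (rule K)
  interpret V: linear_action K "col_space K n" G "\<lambda>g. mat_vec K n (\<rho> g)"
    by (rule representation_linear_action[OF K G rep])
  have irrV: "V.irreducible (carrier (col_space K n))" by (rule irreducible_rep_action[OF K G irr])
  obtain B v where B: "finite B" "B \<subseteq> carrier (col_space K n)" "V.lin_indpt B"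
      "V.span B = carrier (col_space K n)" "v \<in> B" "B \<subseteq> (\<lambda>g. mat_vec K n (\<rho> g) v) ` carrier G"
    using V.cyclic_basis[OF irrV] by blast
  have piece: "V.cyclic_piece B v"
    using B irrV by (simp add: V.cyclic_piece_def V.irreducible_def)
  let ?L = "constant_field K F (\<Union>A\<in>{B}. V.structure_constants A)"
  have FK: "F \<subseteq> carrier K" by (rule subringE(1)[OF F])
  have PK: "(\<Union>A\<in>{B}. V.structure_constants A) \<subseteq> carrier K"
    using V.structure_constants_closed[OF piece] by simp
  note L = constant_field_contains[OF FK PK]
  have "V.defined_over ?L B"
    by (rule V.defined_over_structure_constants[OF piece]) (use L(2) in auto)
  then obtain \<sigma> where \<sigma>: "representation (K\<lparr>carrier := ?L\<rparr>) G n \<sigma>" "equivalent_reps K G n \<rho> \<sigma>"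
    using equivalent_rep_over_subfield[OF K G rep K.constant_field_subfield B(1-4)] by blast
  have "card B = n"
    using V.dim_basis[OF B(1)] B unit_columns_basis(3)[OF K] by (simp add: V.basis_def)
  then have "card (SIGMA A:{B}. A - {v}) = n - 1"
    using B(1,5) by simp
  then have "trdeg (K\<lparr>carrier := ?L\<rparr>) F \<le> enat (n - 1)"
    using V.trdeg_structure_constants[OF char F, of "{B}" "\<lambda>_. v"] piece by simp
  then show ?thesis by (rule ed_le[OF K.constant_field_subfield L(1) \<sigma>])
qed

text \<open>One field serves for all representations of \<open>G\<close> over \<open>K\<close>: the field of constants that belongs to the structure constants of
all summands of the regular representation.\<close>

theorem ed_arbitrary:
  assumes K: "field K" and char: "char_zero K" and G: "group G" "finite (carrier G)"
    and F: "subring F K" and rep: "representation K G n \<rho>"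
  shows "ed F K G n \<rho> \<le> enat (order G - 1)"
proof -
  interpret K: field K by (rule K)
  interpret V: linear_action K "col_space K n" G "\<lambda>g. mat_vec K n (\<rho> g)"
    by (rule representation_linear_action[OF K G rep])
  interpret reg: linear_action K "regular_space K G" G "regular_action G"
    by (rule regular_linear_action[OF K G])
  let ?\<Delta> = "regular_delta K G ` carrier G"
  note gen = regular_space_generated[OF K G(2)]
  have fd: "reg.fin_dim" using gen G(2) by (auto simp: reg.fin_dim_def)
  obtain \<B> where \<B>: "finite \<B>" "disjoint \<B>" "finite (\<Union>\<B>)" "\<Union>\<B> \<subseteq> carrier (regular_space K G)"
      "reg.lin_indpt (\<Union>\<B>)" "reg.span (\<Union>\<B>) = carrier (regular_space K G)"
      "\<And>B. B \<in> \<B> \<Longrightarrow> reg.irreducible (reg.span B) \<and> (\<exists>v. reg.cyclic_piece B v)"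
    using reg.irreducible_decomposition[OF fd char] by blast
  obtain v where piece: "\<And>B. B \<in> \<B> \<Longrightarrow> reg.cyclic_piece B (v B)" using \<B>(7) by metis
  let ?L = "constant_field K F (\<Union>B\<in>\<B>. reg.structure_constants B)"
  have FK: "F \<subseteq> carrier K" by (rule subringE(1)[OF F])
  have PK: "(\<Union>B\<in>\<B>. reg.structure_constants B) \<subseteq> carrier K"
    using reg.structure_constants_closed[OF piece] by blast
  note L = constant_field_contains[OF FK PK]
  note Ls = subfieldE(1)[OF K.constant_field_subfield]
  have "\<exists>C. finite C \<and> C \<subseteq> carrier (col_space K n) \<and> V.lin_indpt C \<and> V.span C = carrier (col_space K n) \<and>
    V.defined_over ?L C"
  proof (rule basis_defined_over[OF V.linear_action_axioms unit_columns_basis(4)[OF K] subringE(1,2)[OF Ls] _ \<B>(6)])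
    fix B assume B: "B \<in> \<B>"
    have "reg.defined_over ?L B"
      by (rule reg.defined_over_structure_constants[OF piece[OF B]]) (use L(2) B in auto)
    then show "finite B \<and> B \<subseteq> carrier (regular_space K G) \<and> reg.lin_indpt B \<and>
        reg.irreducible (reg.span B) \<and> reg.defined_over ?L B"
      using piece[OF B] \<B>(7)[OF B] by (simp add: reg.cyclic_piece_def)
  qed
  then obtain \<sigma> where \<sigma>: "representation (K\<lparr>carrier := ?L\<rparr>) G n \<sigma>" "equivalent_reps K G n \<rho> \<sigma>"
    using equivalent_rep_over_subfield[OF K G rep K.constant_field_subfield] by blast
  have "card (\<Union>\<B>) \<le> card ?\<Delta>"
    by (rule reg.li_smaller_than_gen) (use \<B> gen G(2) in auto)
  also have "\<dots> \<le> order G" unfolding order_def by (rule card_image_le[OF G(2)])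
  finally have card_le: "card (\<Union>\<B>) \<le> order G" .
  let ?I = "SIGMA B:\<B>. B - {v B}"
  have "card ?I \<le> order G - 1"
  proof (cases "\<B> = {}")
    case False
    then obtain A where A: "A \<in> \<B>" by blast
    have vB: "v B \<in> B" if "B \<in> \<B>" for B using piece[OF that] by (simp add: reg.cyclic_piece_def)
    have same: "B = B'" if "B \<in> \<B>" "B' \<in> \<B>" "x \<in> B" "x \<in> B'" for B B' x
      using \<B>(2) that by (auto simp: disjoint_def)
    have "card ?I \<le> card (\<Union>\<B> - {v A})"
    proof (rule card_inj_on_le)
      \<comment> \<open>The bases are disjoint, so the conditions are indexed by \<open>\<Union>\<B>\<close> without the generators; dropping one of these suffices.\<close>
      show "inj_on snd ?I" using same by (auto simp: inj_on_def)
      show "snd ` ?I \<subseteq> \<Union>\<B> - {v A}" using same vB A by fastforce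
    qed (use \<B>(3) in simp)
    also have "\<dots> = card (\<Union>\<B>) - 1" using vB[OF A] A \<B>(3) by (intro card_Diff_singleton) auto
    finally show ?thesis using card_le by simp
  qed simp
  then have "trdeg (K\<lparr>carrier := ?L\<rparr>) F \<le> enat (order G - 1)"
    using reg.trdeg_structure_constants[OF char F \<B>(1) piece] by (meson enat_ord_simps(1) order_trans)
  then show ?thesis by (rule ed_le[OF K.constant_field_subfield L(1) \<sigma>])
qed

lemma pred_le_square_div_4:
  assumes "m \<le> enat (n - 1)" "n \<ge> 1"
  shows "ereal_of_enat m \<le> ereal ((real n)\<^sup>2 / 4)"
proof -
  have "0 \<le> (real n - 2)\<^sup>2" by simp
  then have "real (n - 1) \<le> (real n)\<^sup>2 / 4"
    using assms(2) by (simp add: power2_eq_square algebra_simps of_nat_diff)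
  then have "ereal_of_enat (enat (n - 1)) \<le> ereal ((real n)\<^sup>2 / 4)" by simp
  moreover have "ereal_of_enat m \<le> ereal_of_enat (enat (n - 1))"
    using assms(1) by (simp only: ereal_of_enat_le_iff)
  ultimately show ?thesis by (rule order_trans[rotated])
qed

lemma field_extension_base:
  assumes ext: "field_extension k K \<iota>" and char: "char_zero k"
  shows "subring (\<iota> ` carrier k) K" "char_zero K"
proof -
  have k: "field k" and K: "field K" and hom: "\<iota> \<in> ring_hom k K"
    using ext by (auto simp: field_extension_def)
  interpret k: field k by (rule k)
  interpret K: field K by (rule K)
  interpret h: ring_hom_ring k K \<iota>
    by (intro ring_hom_ringI2 k.ring_axioms K.ring_axioms hom)
  show "subring (\<iota> ` carrier k) K" by (rule h.img_is_subring[OF k.carrier_is_subring])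
  have pow: "add_pow K (m::nat) \<one>\<^bsub>K\<^esub> = \<iota> (add_pow k m \<one>\<^bsub>k\<^esub>)" for m
    by (induction m) simp_all
  show "char_zero K"
    unfolding char_zero_def
  proof (intro allI impI)
    fix m :: nat assume "m > 0"
    let ?x = "add_pow k m \<one>\<^bsub>k\<^esub>"
    have "?x \<noteq> \<zero>\<^bsub>k\<^esub>" using char \<open>m > 0\<close> by (simp add: char_zero_def)
    then have x: "?x \<in> Units k" by (simp add: k.field_Units)
    then have "\<iota> ?x \<otimes>\<^bsub>K\<^esub> \<iota> (inv\<^bsub>k\<^esub> ?x) = \<one>\<^bsub>K\<^esub>"
      using h.hom_mult[of ?x "inv\<^bsub>k\<^esub> ?x"] by simp
    then have "\<iota> ?x \<noteq> \<zero>\<^bsub>K\<^esub>" using K.one_not_zero x by auto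
    then show "add_pow K m \<one>\<^bsub>K\<^esub> \<noteq> \<zero>\<^bsub>K\<^esub>" by (simp add: pow)
  qed
qed

theorem proposition9p2:
  fixes k :: "'a ring" and G :: "'g monoid"
  assumes "field k" and "char_zero k"
    and "group G" and "finite (carrier G)"
  shows "(\<forall>(K :: 'b ring) \<iota> n \<rho>. field_extension k K \<iota> \<and> representation K G n \<rho> \<and>
            irreducible_rep K G n \<rho> \<longrightarrow>
            ereal_of_enat (ed (\<iota> ` carrier k) K G n \<rho>) \<le> ereal ((real n)\<^sup>2 / 4))
       \<and> (\<forall>(K :: 'b ring) \<iota> n \<rho>. field_extension k K \<iota> \<and> representation K G n \<rho> \<longrightarrow>
            ereal_of_enat (ed (\<iota> ` carrier k) K G n \<rho>) \<le> ereal ((real (order G))\<^sup>2 / 4))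
       \<and> ereal_of_enat (ed_Rep TYPE('b) k G) \<le> ereal ((real (order G))\<^sup>2 / 4)"
proof -
  interpret G: group G by fact
  have order: "order G \<ge> 1"
    using assms(4) G.order_gt_0_iff_finite by simp
  have arbitrary: "ed (\<iota> ` carrier k) K G n \<rho> \<le> enat (order G - 1)"
    if "field_extension k K \<iota>" "representation K G n \<rho>" for K :: "'b ring" and \<iota> n \<rho>
    using that ed_arbitrary[OF _ field_extension_base(2)[OF that(1) assms(2)] assms(3,4)
        field_extension_base(1)[OF that(1) assms(2)] that(2)]
    by (simp add: field_extension_def)
  have irreducible: "ereal_of_enat (ed (\<iota> ` carrier k) K G n \<rho>) \<le> ereal ((real n)\<^sup>2 / 4)"
    if *: "field_extension k K \<iota>" "representation K G n \<rho>" "irreducible_rep K G n \<rho>"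
    for K :: "'b ring" and \<iota> n \<rho>
  proof (rule pred_le_square_div_4)
    show "ed (\<iota> ` carrier k) K G n \<rho> \<le> enat (n - 1)"
      using *(1) ed_irreducible[OF _ field_extension_base(2)[OF *(1) assms(2)] assms(3,4)
          field_extension_base(1)[OF *(1) assms(2)] *(3)]
      by (simp add: field_extension_def)
    show "n \<ge> 1" using *(2) by (simp add: representation_def)
  qed
  have "ed_Rep TYPE('b) k G \<le> enat (order G - 1)"
    unfolding ed_Rep_def by (rule Sup_least) (use arbitrary in auto)
  then show ?thesis
    using irreducible pred_le_square_div_4[OF arbitrary order] pred_le_square_div_4[OF _ order]
    by blast
qed

end
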